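(* Let $\mathcal E,\mathcal G,\mathcal Y$ be Hilbert spaces and let $F,\Theta,G$ be free holomorphic functions on $[B(\mathcal H)^n]_1$ with coefficients in $B(\mathcal E,\mathcal G)$, $B(\mathcal Y,\mathcal G)$, and $B(\mathcal E,\mathcal Y)$, respectively, such that $$F(X)=\Theta(X)G(X),\qquad X\in[B(\mathcal H)^n]_1.$$ Assume that $F$ is bounded with $\|F\|_\infty\le1$ and that $\Theta$ has the radial infimum property with $\|\Theta\|_\infty=1$. Then $\|G\|_\infty\le1$, $$F(X)F(X)^*\le\Theta(X)\Theta(X)^*,\qquad X\in[B(\mathcal H)^n]_1,$$ and $$\|F(X)\|\le\|\Theta(X)\|,\qquad X\in[B(\mathcal H)^n]_1.$$ If, in addition, $\|G(0)\|<1$ and $X_0\in[B(\mathcal H)^n]_1$, then: (i) $F(X_0)F(X_0)^*<\Theta(X_0)\Theta(X_0)^*$ if and only if $\Theta(X_0)\Theta(X_0)^*>0$; (ii) $\|F(X_0)\|<\|\Theta(X_0)\|$ if and only if $G(X_0)\ne0$.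
   Context: $\mathcal H$ is a separable infinite dimensional Hilbert space and $n\in\{1,2,\dots\}\cup\{\infty\}$. For $X=(X_1,\dots,X_n)\in B(\mathcal H)^n$, $\|X\|=\|\sum_iX_iX_i^*\|^{1/2}$, and $[B(\mathcal H)^n]_1=\{X:\|X\|<1\}$. $\mathbb F_n^+$ is the unital free semigroup on $g_1,\dots,g_n$; for $\alpha=g_{i_1}\cdots g_{i_k}$ put $|\alpha|=k$, $X_\alpha=X_{i_1}\cdots X_{i_k}$ ($X_\alpha=I$ for the neutral element, of length $0$). A free holomorphic function on $[B(\mathcal H)^n]_1$ with coefficients in $B(\mathcal E,\mathcal G)$ is a map $F(X)=\sum_{k=0}^\infty\sum_{|\alpha|=k}X_\alpha\otimes A_{(\alpha)}$ with $A_{(\alpha)}\in B(\mathcal E,\mathcal G)$, the series in $k$ converging in operator norm for all $X\in[B(\mathcal H)^n]_1$. The same series evaluates $F$ at strict row contractions on any Hilbert space. $\|F\|_\infty=\sup_{\|X\|<1}\|F(X)\|$; $F$ is bounded if this is finite. $S_i\varphi=e_i\otimes\varphi$ ($i=1,\dots,n$) are the left creation operators on the full Fock space $F^2(H_n)=\mathbb C1\oplus\bigoplus_{k\ge1}H_n^{\otimes k}$, where $H_n$ is an $n$-dimensional Hilbert space with orthonormal basis $e_1,\dots,e_n$. A bounded free holomorphic function $\Theta$ has the radial infimum property if $\liminf_{r\to1}\inf_{\|x\|=1}\|\Theta(rS_1,\dots,rS_n)x\|=\|\Theta\|_\infty$, the infimum being over unit vectors of the domain of $\Theta(rS_1,\dots,rS_n)$.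 For selfadjoint operators, $A<B$ means that $B-A$ is positive and invertible (i.e. $B-A\ge\gamma I$ for some $\gamma>0$).
   Formalization: In (ii) the condition G(X_0) ≠ 0 is replaced by Θ(X_0) ≠ 0, since (ii) as printed is false: F = G = 0, Θ = I gives strict inequality with G(X_0) = 0, and n = 1, Θ = X_1, G = 1/2, X_0 = 0 breaks the converse. *)

theory Defs
  imports "HOL-Analysis.Analysis"
begin

section \<open>Complex Hilbert spaces\<close>

class scaleC =
  fixes scaleC :: "complex \<Rightarrow> 'a \<Rightarrow> 'a"  (infixr "*\<^sub>C" 75)

class complex_vector = scaleC + real_vector +
  assumes scaleC_add_right: "c *\<^sub>C (x + y) = c *\<^sub>C x + c *\<^sub>C y"
    and scaleC_add_left: "(c + d) *\<^sub>C x = c *\<^sub>C x + d *\<^sub>C x"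
    and scaleC_scaleC: "c *\<^sub>C d *\<^sub>C x = (c * d) *\<^sub>C x"
    and scaleR_scaleC: "r *\<^sub>R x = complex_of_real r *\<^sub>C x"
begin

lemma scaleC_one [simp]: "1 *\<^sub>C x = x"
  using scaleR_scaleC[of 1 x] by (simp add: scaleR_one)

end

global_interpretation complex_vector:
  vector_space "scaleC :: complex \<Rightarrow> 'a \<Rightarrow> 'a::complex_vector"
  by unfold_locales (simp_all add: scaleC_add_right scaleC_add_left scaleC_scaleC)

text \<open>The inner product is linear in the first argument.\<close>

class complex_inner = complex_vector + real_inner +
  fixes cinner :: "'a \<Rightarrow> 'a \<Rightarrow> complex"
  assumes cinner_commute: "cinner x y = cnj (cinner y x)"
    and cinner_add_left: "cinner (x + y) z = cinner x z + cinner y z"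
    and cinner_scaleC_left: "cinner (c *\<^sub>C x) y = c * cinner x y"
    and inner_eq_Re_cinner: "inner x y = Re (cinner x y)"

class chilbert_space = complex_inner + banach

lemma cinner_self: "cinner x x = complex_of_real ((norm x)\<^sup>2)" for x :: "'a::complex_inner"
proof -
  have "Im (cinner x x) = 0"
    by (metis cinner_commute complex_cnj equation_minus_iff complex_surj complex.sel(2) neg_equal_zero)
  thus ?thesis
    by (simp add: complex_eq_iff power2_norm_eq_inner inner_eq_Re_cinner)
qed

lemma cinner_add_right: "cinner z (x + y) = cinner z x + cinner z y" for x :: "'a::complex_inner"
  by (metis cinner_add_left cinner_commute complex_cnj_add)

lemma cinner_scaleC_right: "cinner y (c *\<^sub>C x) = cnj c * cinner y x" for x :: "'a::complex_inner"
  by (metis cinner_commute cinner_scaleC_left complex_cnj_mult)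

lemma norm_scaleC [simp]: "norm (c *\<^sub>C x) = cmod c * norm x" for x :: "'a::complex_inner"
proof -
  have "complex_of_real ((norm (c *\<^sub>C x))\<^sup>2) = c * cnj c * complex_of_real ((norm x)\<^sup>2)"
    by (simp only: cinner_self[symmetric] cinner_scaleC_left cinner_scaleC_right mult_ac)
  also have "\<dots> = complex_of_real ((cmod c * norm x)\<^sup>2)"
    by (simp add: complex_norm_square[symmetric] power_mult_distrib)
  finally have "(norm (c *\<^sub>C x))\<^sup>2 = (cmod c * norm x)\<^sup>2"
    using of_real_eq_iff by blast
  thus ?thesis by (simp add: power2_eq_iff_nonneg)
qed

lemma norm_cinner_le: "cmod (cinner x y) \<le> norm x * norm y" for x y :: "'a::complex_inner"
proof (cases "cinner x y = 0")
  case False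
  define c where "c = cnj (cinner x y) / cmod (cinner x y)"
  have c: "cmod c = 1" using False by (simp add: c_def norm_divide)
  have "cinner (c *\<^sub>C x) y = complex_of_real (cmod (cinner x y))"
    using False by (simp add: cinner_scaleC_left c_def complex_norm_square[symmetric] mult.commute
        power2_eq_square)
  hence "cmod (cinner x y) = inner (c *\<^sub>C x) y"
    by (simp add: inner_eq_Re_cinner)
  also have "\<dots> \<le> norm (c *\<^sub>C x) * norm y" by (rule norm_cauchy_schwarz)
  finally show ?thesis by (simp add: c)
qed simp

lemma bounded_bilinear_real_cinner: "bounded_bilinear (cinner :: 'a::complex_inner \<Rightarrow> 'a \<Rightarrow> complex)"
proof
  show "\<exists>K. \<forall>a b. cmod (cinner a b) \<le> norm (a::'a) * norm b * K"
    by (intro exI[of _ 1]) (simp add: norm_cinner_le)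
qed (auto simp: cinner_add_left cinner_add_right scaleR_scaleC cinner_scaleC_left cinner_scaleC_right
    scaleR_conv_of_real)

interpretation cinner: bounded_bilinear "cinner :: 'a::complex_inner \<Rightarrow> 'a \<Rightarrow> complex"
  by (rule bounded_bilinear_real_cinner)

instantiation complex :: chilbert_space
begin
definition scaleC_complex :: "complex \<Rightarrow> complex \<Rightarrow> complex" where "scaleC_complex = (*)"
definition cinner_complex :: "complex \<Rightarrow> complex \<Rightarrow> complex" where "cinner_complex x y = x * cnj y"
instance
  by standard (auto simp: scaleC_complex_def cinner_complex_def algebra_simps scaleR_conv_of_real
      inner_complex_def)
end


section \<open>Hilbert space direct sums\<close>

text \<open>The Hilbert space direct sum of copies of \<open>'b\<close>, one for each \<open>i :: 'i\<close>.\<close>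

typedef (overloaded) ('i, 'b) ell2 =
  "{f :: 'i \<Rightarrow> 'b::real_normed_vector. (\<lambda>i. (norm (f i))\<^sup>2) summable_on UNIV}"
  morphisms coord Abs_ell2
  by (rule exI[of _ "\<lambda>_. 0"]) simp

setup_lifting type_definition_ell2

lemma ell2_summable: "(\<lambda>i. (norm (coord f i))\<^sup>2) summable_on UNIV"
  using coord[of f] by simp

lemma square_summable_add:
  fixes f g :: "'i \<Rightarrow> 'b::real_normed_vector"
  assumes "(\<lambda>i. (norm (f i))\<^sup>2) summable_on A" "(\<lambda>i. (norm (g i))\<^sup>2) summable_on A"
  shows "(\<lambda>i. (norm (f i + g i))\<^sup>2) summable_on A"
proof (rule summable_on_comparison_test)
  show "(\<lambda>i. 2 * (norm (f i))\<^sup>2 + 2 * (norm (g i))\<^sup>2) summable_on A"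
    by (intro summable_on_add summable_on_cmult_right assms)
  fix i
  have "(norm (f i + g i))\<^sup>2 \<le> (norm (f i) + norm (g i))\<^sup>2"
    by (intro power_mono norm_triangle_ineq) simp
  also have "\<dots> \<le> 2 * (norm (f i))\<^sup>2 + 2 * (norm (g i))\<^sup>2"
    using sum_squares_bound[of "norm (f i)" "norm (g i)"] by (simp add: power2_sum)
  finally show "(norm (f i + g i))\<^sup>2 \<le> 2 * (norm (f i))\<^sup>2 + 2 * (norm (g i))\<^sup>2" .
qed simp

lemma ell2_cinner_summable:
  fixes f g :: "('i, 'b::complex_inner) ell2"
  shows "(\<lambda>i. cinner (coord f i) (coord g i)) summable_on UNIV"
proof (rule abs_summable_summable, rule summable_on_comparison_test)
  show "(\<lambda>i. (norm (coord f i))\<^sup>2 + (norm (coord g i))\<^sup>2) summable_on UNIV"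
    by (intro summable_on_add ell2_summable)
  fix i
  have "cmod (cinner (coord f i) (coord g i)) \<le> norm (coord f i) * norm (coord g i)"
    by (rule norm_cinner_le)
  also have "\<dots> \<le> (norm (coord f i))\<^sup>2 + (norm (coord g i))\<^sup>2"
    using sum_squares_bound[of "norm (coord f i)" "norm (coord g i)"]
      mult_nonneg_nonneg[OF norm_ge_zero norm_ge_zero, of "coord f i" "coord g i"] by linarith
  finally show "cmod (cinner (coord f i) (coord g i)) \<le> \<dots>" .
qed simp

instantiation ell2 :: (type, complex_inner) complex_inner
begin

lift_definition zero_ell2 :: "('a, 'b) ell2" is "\<lambda>_. 0" by simp
lift_definition plus_ell2 :: "('a, 'b) ell2 \<Rightarrow> ('a, 'b) ell2 \<Rightarrow> ('a, 'b) ell2"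
  is "\<lambda>f g i. f i + g i" by (rule square_summable_add)
lift_definition scaleC_ell2 :: "complex \<Rightarrow> ('a, 'b) ell2 \<Rightarrow> ('a, 'b) ell2"
  is "\<lambda>c f i. c *\<^sub>C f i" by (simp add: power_mult_distrib summable_on_cmult_right)
lift_definition scaleR_ell2 :: "real \<Rightarrow> ('a, 'b) ell2 \<Rightarrow> ('a, 'b) ell2"
  is "\<lambda>c f i. c *\<^sub>R f i" by (simp add: power_mult_distrib summable_on_cmult_right)
lift_definition uminus_ell2 :: "('a, 'b) ell2 \<Rightarrow> ('a, 'b) ell2"
  is "\<lambda>f i. - f i" by simp
definition minus_ell2 :: "('a, 'b) ell2 \<Rightarrow> ('a, 'b) ell2 \<Rightarrow> ('a, 'b) ell2"
  where "minus_ell2 f g = f + - g"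
definition cinner_ell2 :: "('a, 'b) ell2 \<Rightarrow> ('a, 'b) ell2 \<Rightarrow> complex"
  where "cinner_ell2 f g = (\<Sum>\<^sub>\<infinity>i. cinner (coord f i) (coord g i))"
definition inner_ell2 :: "('a, 'b) ell2 \<Rightarrow> ('a, 'b) ell2 \<Rightarrow> real"
  where "inner_ell2 f g = Re (cinner f g)"
definition norm_ell2 :: "('a, 'b) ell2 \<Rightarrow> real"
  where "norm_ell2 f = sqrt (inner f f)"
definition sgn_ell2 :: "('a, 'b) ell2 \<Rightarrow> ('a, 'b) ell2"
  where "sgn_ell2 f = inverse (norm f) *\<^sub>R f"
definition dist_ell2 :: "('a, 'b) ell2 \<Rightarrow> ('a, 'b) ell2 \<Rightarrow> real"
  where "dist_ell2 f g = norm (f - g)"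
definition uniformity_ell2 :: "(('a, 'b) ell2 \<times> ('a, 'b) ell2) filter"
  where "uniformity_ell2 = (INF e\<in>{0<..}. principal {(x, y). dist x y < e})"
definition open_ell2 :: "('a, 'b) ell2 set \<Rightarrow> bool"
  where "open_ell2 U \<longleftrightarrow> (\<forall>x\<in>U. eventually (\<lambda>(x', y). x' = x \<longrightarrow> y \<in> U) uniformity)"

instance
proof
  fix x y z :: "('a, 'b) ell2" and c d :: complex and r s :: real
  show "x + y + z = x + (y + z)" "x + y = y + x" "0 + x = x" "- x + x = 0"
    by (transfer; simp add: algebra_simps)+
  show "x - y = x + - y" by (rule minus_ell2_def)
  show "r *\<^sub>R (x + y) = r *\<^sub>R x + r *\<^sub>R y" "(r + s) *\<^sub>R x = r *\<^sub>R x + s *\<^sub>R x"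
    "r *\<^sub>R s *\<^sub>R x = (r * s) *\<^sub>R x" "1 *\<^sub>R x = x"
    by (transfer; simp add: algebra_simps)+
  show "c *\<^sub>C (x + y) = c *\<^sub>C x + c *\<^sub>C y" "(c + d) *\<^sub>C x = c *\<^sub>C x + d *\<^sub>C x"
    "c *\<^sub>C d *\<^sub>C x = (c * d) *\<^sub>C x" "r *\<^sub>R x = complex_of_real r *\<^sub>C x"
    by (transfer; simp add: scaleC_add_right scaleC_add_left scaleC_scaleC scaleR_scaleC)+
  show sgn: "sgn x = inverse (norm x) *\<^sub>R x" by (rule sgn_ell2_def)
  show "dist x y = norm (x - y)" by (rule dist_ell2_def)
  show "uniformity = (INF e\<in>{0<..}. principal {(x, y :: ('a, 'b) ell2). dist x y < e})"
    by (rule uniformity_ell2_def)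
  show "open U \<longleftrightarrow> (\<forall>x\<in>U. eventually (\<lambda>(x', y). x' = x \<longrightarrow> y \<in> U) uniformity)"
    for U :: "('a, 'b) ell2 set" by (rule open_ell2_def)
  show c1: "cinner x y = cnj (cinner y x)"
    unfolding cinner_ell2_def infsum_cnj[symmetric] by (simp add: cinner_commute[symmetric])
  show c2: "cinner (x + y) z = cinner x z + cinner y z"
    unfolding cinner_ell2_def
    by (simp add: plus_ell2.rep_eq cinner_add_left infsum_add ell2_cinner_summable)
  show c3: "cinner (c *\<^sub>C x) y = c * cinner x y" for c x
    unfolding cinner_ell2_def
    by (simp add: scaleC_ell2.rep_eq cinner_scaleC_left infsum_cmult_right')
  show i: "inner x y = Re (cinner x y)" for x y :: "('a, 'b) ell2" by (rule inner_ell2_def)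
  have "r *\<^sub>R x = complex_of_real r *\<^sub>C x" by transfer (simp add: scaleR_scaleC)
  thus "inner (r *\<^sub>R x) y = r * inner x y" by (simp add: i c3)
  show "inner x y = inner y x" by (subst i, subst c1) (simp add: i)
  show "inner (x + y) z = inner x z + inner y z" by (simp add: i c2)
  show "norm x = sqrt (inner x x)" by (rule norm_ell2_def)
  have e: "inner x x = (\<Sum>\<^sub>\<infinity>i. (norm (coord x i))\<^sup>2)"
    unfolding i cinner_ell2_def
    by (subst infsum_Re[symmetric, OF ell2_cinner_summable]) (simp add: cinner_self)
  show "0 \<le> inner x x" unfolding e by (intro infsum_nonneg) simp
  show "inner x x = 0 \<longleftrightarrow> x = 0"
  proof
    assume "inner x x = 0"
    hence "(norm (coord x i))\<^sup>2 = 0" for i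
      by (intro nonneg_infsum_le_0D[of "\<lambda>i. (norm (coord x i))\<^sup>2" UNIV]) (auto simp: e ell2_summable)
    hence "coord x i = 0" for i by simp
    thus "x = 0" by (metis (no_types) coord_inject ext zero_ell2.rep_eq)
  qed (unfold e, simp add: zero_ell2.rep_eq)
qed

end

lemma coord_simps [simp]:
  fixes f g :: "('i, 'b::complex_inner) ell2"
  shows "coord (0 :: ('i, 'b) ell2) i = 0" "coord (f + g) i = coord f i + coord g i"
    "coord (- f) i = - coord f i" "coord (c *\<^sub>C f) i = c *\<^sub>C coord f i"
    "coord (r *\<^sub>R f) i = r *\<^sub>R coord f i"
  by (rule fun_cong[OF zero_ell2.rep_eq] fun_cong[OF plus_ell2.rep_eq] fun_cong[OF uminus_ell2.rep_eq]
      fun_cong[OF scaleC_ell2.rep_eq] fun_cong[OF scaleR_ell2.rep_eq])+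

lemma coord_diff [simp]: "coord (f - g) i = coord f i - coord g i"
  for f g :: "('i, 'b::complex_inner) ell2"
  using coord_simps(2)[of f "- g" i] by simp

lemma norm_ell2_square: "(norm f)\<^sup>2 = (\<Sum>\<^sub>\<infinity>i. (norm (coord f i))\<^sup>2)"
  for f :: "('i, 'b::complex_inner) ell2"
  unfolding power2_norm_eq_inner inner_eq_Re_cinner cinner_ell2_def
  by (subst infsum_Re[symmetric, OF ell2_cinner_summable]) (simp add: cinner_self)

lemma sum_coord_le: "finite J \<Longrightarrow> (\<Sum>i\<in>J. (norm (coord f i))\<^sup>2) \<le> (norm f)\<^sup>2"
  for f :: "('i, 'b::complex_inner) ell2"
  unfolding norm_ell2_square by (intro finite_sum_le_infsum ell2_summable) auto

lemma norm_coord_le: "norm (coord f i) \<le> norm f" for f :: "('i, 'b::complex_inner) ell2"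
  using sum_coord_le[of "{i}" f] by simp

lemma bounded_linear_coord: "bounded_linear (\<lambda>f :: ('i, 'b::complex_inner) ell2. coord f i)"
  by (rule bounded_linear_intro[of _ 1]) (simp_all add: norm_coord_le)

instance ell2 :: (type, chilbert_space) chilbert_space
proof
  fix X :: "nat \<Rightarrow> ('a, 'b) ell2"
  assume X: "Cauchy X"
  have "\<exists>l. (\<lambda>n. coord (X n) i) \<longlonglongrightarrow> l" for i
    using bounded_linear.Cauchy[OF bounded_linear_coord X, of i] Cauchy_convergent convergent_def
    by blast
  then obtain f where f: "\<And>i. (\<lambda>n. coord (X n) i) \<longlonglongrightarrow> f i" by metis
  have bound: "(\<Sum>i\<in>J. (norm (coord (X n) i - f i))\<^sup>2) \<le> e\<^sup>2"
    if J: "finite J" and N: "\<And>m n. m \<ge> N \<Longrightarrow> n \<ge> N \<Longrightarrow> norm (X n - X m) \<le> e" and n: "n \<ge> N" for J N n e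
  proof (rule tendsto_upperbound)
    show "(\<lambda>m. \<Sum>i\<in>J. (norm (coord (X n) i - coord (X m) i))\<^sup>2)
        \<longlonglongrightarrow> (\<Sum>i\<in>J. (norm (coord (X n) i - f i))\<^sup>2)"
      by (intro tendsto_intros f)
    show "\<forall>\<^sub>F m in sequentially. (\<Sum>i\<in>J. (norm (coord (X n) i - coord (X m) i))\<^sup>2) \<le> e\<^sup>2"
    proof (rule eventually_sequentiallyI[of N])
      fix m assume "m \<ge> N"
      have "(\<Sum>i\<in>J. (norm (coord (X n - X m) i))\<^sup>2) \<le> (norm (X n - X m))\<^sup>2"
        by (rule sum_coord_le[OF J])
      also have "\<dots> \<le> e\<^sup>2" using N[OF \<open>m \<ge> N\<close> n] by (intro power_mono) auto
      finally show "(\<Sum>i\<in>J. (norm (coord (X n) i - coord (X m) i))\<^sup>2) \<le> e\<^sup>2" by simp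
    qed
  qed simp
  have cau: "\<exists>N. \<forall>m\<ge>N. \<forall>n\<ge>N. norm (X n - X m) \<le> e" if "e > 0" for e
    using X that unfolding Cauchy_def dist_norm by (meson less_imp_le)
  obtain N where N: "\<And>m n. m \<ge> N \<Longrightarrow> n \<ge> N \<Longrightarrow> norm (X n - X m) \<le> 1"
    using cau[of 1] by auto
  have "(\<lambda>i. (norm (coord (X N) i - f i))\<^sup>2) summable_on UNIV"
    by (rule nonneg_bdd_above_summable_on)
      (auto intro!: bdd_aboveI2[of _ _ "1\<^sup>2"] bound[where N = N] N simp del: power_one)
  hence "(\<lambda>i. (norm (coord (X N) i + - (coord (X N) i - f i)))\<^sup>2) summable_on UNIV"
    by (intro square_summable_add ell2_summable) (simp add: norm_minus_commute)
  hence fs: "(\<lambda>i. (norm (f i))\<^sup>2) summable_on UNIV" by simp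
  define g where "g = Abs_ell2 f"
  have g: "coord g = f" using fs by (simp add: g_def Abs_ell2_inverse)
  have "X \<longlonglongrightarrow> g"
  proof (rule metric_LIMSEQ_I)
    fix e :: real assume e: "e > 0"
    then obtain N where N: "\<And>m n. m \<ge> N \<Longrightarrow> n \<ge> N \<Longrightarrow> norm (X n - X m) \<le> e / 2"
      using cau[of "e / 2"] by auto
    have "dist (X n) g < e" if "n \<ge> N" for n
    proof -
      have "(norm (X n - g))\<^sup>2 \<le> (e / 2)\<^sup>2"
        unfolding norm_ell2_square
        by (rule infsum_le_finite_sums[OF ell2_summable]) (simp add: g, rule bound[OF _ N that], auto)
      hence "norm (X n - g) \<le> e / 2" using e by (simp add: power2_le_iff_abs_le)
      thus ?thesis using e by (simp add: dist_norm)
    qed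
    thus "\<exists>no. \<forall>n\<ge>no. dist (X n) g < e" by blast
  qed
  thus "convergent X" by (auto simp: convergent_def)
qed


section \<open>Orthonormal bases\<close>

definition orthonormal :: "'a::complex_inner set \<Rightarrow> bool" where
  "orthonormal B \<longleftrightarrow> (\<forall>x\<in>B. \<forall>y\<in>B. cinner x y = (if x = y then 1 else 0))"

definition orthonormal_basis :: "'a::complex_inner set \<Rightarrow> bool" where
  "orthonormal_basis B \<longleftrightarrow> orthonormal B \<and> closure (complex_vector.span B) = UNIV"

lemma norm_orthogonal_sum_square:
  fixes f :: "'i \<Rightarrow> 'a::complex_inner"
  assumes "finite J" "\<And>i j. i \<in> J \<Longrightarrow> j \<in> J \<Longrightarrow> i \<noteq> j \<Longrightarrow> inner (f i) (f j) = 0"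
  shows "(norm (\<Sum>i\<in>J. f i))\<^sup>2 = (\<Sum>i\<in>J. (norm (f i))\<^sup>2)"
proof -
  have "(norm (\<Sum>i\<in>J. f i))\<^sup>2 = (\<Sum>i\<in>J. \<Sum>j\<in>J. inner (f i) (f j))"
    unfolding power2_norm_eq_inner inner_sum_left inner_sum_right by (rule sum.swap)
  also have "\<dots> = (\<Sum>i\<in>J. \<Sum>j\<in>J. if j = i then (norm (f i))\<^sup>2 else 0)"
    using assms(2) by (intro sum.cong refl) (auto simp: power2_norm_eq_inner)
  finally show ?thesis using assms(1) by simp
qed

lemma orthogonal_summable:
  fixes f :: "'i \<Rightarrow> 'a::chilbert_space"
  assumes orth: "\<And>i j. i \<in> A \<Longrightarrow> j \<in> A \<Longrightarrow> i \<noteq> j \<Longrightarrow> inner (f i) (f j) = 0"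
    and sq: "(\<lambda>i. (norm (f i))\<^sup>2) summable_on A"
  shows "f summable_on A"
proof -
  define L where "L = (\<Sum>\<^sub>\<infinity>i\<in>A. (norm (f i))\<^sup>2)"
  have le_L: "(\<Sum>i\<in>J. (norm (f i))\<^sup>2) \<le> L" if "finite J" "J \<subseteq> A" for J
    unfolding L_def by (rule finite_sum_le_infsum[OF sq that]) simp
  have "\<exists>P. eventually P (finite_subsets_at_top A) \<and>
      (\<forall>F F'. P F \<and> P F' \<longrightarrow> dist (sum f F) (sum f F') < e)" if e: "e > 0" for e
  proof -
    have "((\<lambda>i. (norm (f i))\<^sup>2) has_sum L) A" unfolding L_def using sq by simp
    from has_sum_finite_approximation[OF this, of "(e/4)\<^sup>2"] e
    obtain G where G: "finite G" "G \<subseteq> A" "dist (\<Sum>i\<in>G. (norm (f i))\<^sup>2) L \<le> (e/4)\<^sup>2" by auto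
    have near: "dist (sum f F) (sum f G) \<le> e/4" if F: "finite F" "G \<subseteq> F" "F \<subseteq> A" for F
    proof -
      have "(norm (sum f (F - G)))\<^sup>2 = (\<Sum>i\<in>F - G. (norm (f i))\<^sup>2)"
        using F by (intro norm_orthogonal_sum_square orth) auto
      also have "\<dots> = (\<Sum>i\<in>F. (norm (f i))\<^sup>2) - (\<Sum>i\<in>G. (norm (f i))\<^sup>2)"
        using F by (intro sum_diff) auto
      also have "\<dots> \<le> (e/4)\<^sup>2" using le_L[OF F(1,3)] le_L[OF G(1,2)] G(3) by (simp add: dist_real_def)
      finally have "norm (sum f (F - G)) \<le> e/4" using e by (simp add: power2_le_iff_abs_le)
      thus ?thesis using F G by (simp add: dist_norm sum_diff)
    qed
    show ?thesis
    proof (intro exI conjI allI impI)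
      show "\<forall>\<^sub>F F in finite_subsets_at_top A. finite F \<and> G \<subseteq> F \<and> F \<subseteq> A"
        using G by (auto simp: eventually_finite_subsets_at_top)
      fix F F' assume "(finite F \<and> G \<subseteq> F \<and> F \<subseteq> A) \<and> (finite F' \<and> G \<subseteq> F' \<and> F' \<subseteq> A)"
      thus "dist (sum f F) (sum f F') < e"
        using near[of F] near[of F'] dist_triangle2[of "sum f F" "sum f F'" "sum f G"] e by auto
    qed
  qed
  hence "cauchy_filter (filtermap (sum f) (finite_subsets_at_top A))"
    by (simp add: cauchy_filter_metric_filtermap)
  moreover have "complete (UNIV :: 'a set)"
    by (meson Cauchy_convergent UNIV_I complete_def convergent_def)
  ultimately obtain l where "(sum f \<longlongrightarrow> l) (finite_subsets_at_top A)"
    using complete_uniform[where S = UNIV] by (force simp add: filterlim_def)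
  thus ?thesis using summable_on_def has_sum_def by blast
qed

lemma norm_orthonormal: "orthonormal B \<Longrightarrow> b \<in> B \<Longrightarrow> norm b = 1"
  using cinner_self[of b] by (simp add: orthonormal_def norm_eq_sqrt_inner inner_eq_Re_cinner)

lemma bessel_finite:
  assumes "orthonormal B" "finite J" "J \<subseteq> B"
  shows "(\<Sum>b\<in>J. (cmod (cinner x b))\<^sup>2) \<le> (norm x)\<^sup>2"
proof -
  define s where "s = (\<Sum>b\<in>J. cinner x b *\<^sub>C b)"
  have n: "norm b = 1" if "b \<in> J" for b using assms that norm_orthonormal by blast
  have "inner (cinner x b *\<^sub>C b) (cinner x c *\<^sub>C c) = 0" if "b \<in> J" "c \<in> J" "b \<noteq> c" for b c
    using assms that by (auto simp: inner_eq_Re_cinner cinner_scaleC_left cinner_scaleC_right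
        orthonormal_def subset_iff)
  hence s: "(norm s)\<^sup>2 = (\<Sum>b\<in>J. (cmod (cinner x b))\<^sup>2)"
    unfolding s_def using assms by (subst norm_orthogonal_sum_square) (auto simp: n)
  have "inner x s = (\<Sum>b\<in>J. (cmod (cinner x b))\<^sup>2)"
    unfolding s_def inner_sum_right unfolding inner_eq_Re_cinner cinner_scaleC_right
    by (intro sum.cong refl) (metis Re_complex_of_real complex_norm_square mult.commute)
  hence "(norm (x - s))\<^sup>2 = (norm x)\<^sup>2 - (\<Sum>b\<in>J. (cmod (cinner x b))\<^sup>2)"
    using s by (simp add: power2_norm_eq_inner inner_diff inner_commute[of s x])
  thus ?thesis by (smt (verit) zero_le_power2)
qed

lemma bessel_summable:
  assumes "orthonormal B"
  shows "(\<lambda>b. (cmod (cinner x b))\<^sup>2) summable_on B"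
  by (rule nonneg_bdd_above_summable_on)
    (auto intro!: bdd_aboveI2[of _ _ "(norm x)\<^sup>2"] bessel_finite[OF assms])

lemma fourier_summable:
  fixes x :: "'a::chilbert_space"
  assumes "orthonormal B"
  shows "(\<lambda>b. cinner x b *\<^sub>C b) summable_on B"
proof (rule orthogonal_summable)
  show "(\<lambda>b. (norm (cinner x b *\<^sub>C b))\<^sup>2) summable_on B"
    using bessel_summable[OF assms, of x]
    by (rule summable_on_cong[THEN iffD1, rotated]) (simp add: norm_orthonormal[OF assms])
qed (use assms in \<open>auto simp: inner_eq_Re_cinner cinner_scaleC_left cinner_scaleC_right orthonormal_def\<close>)

lemma cinner_fourier:
  fixes x :: "'a::chilbert_space"
  assumes "orthonormal B" "((\<lambda>b. cinner x b *\<^sub>C b) has_sum s) B" "c \<in> B"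
  shows "cinner (x - s) c = 0"
proof -
  have "((\<lambda>b. cinner (cinner x b *\<^sub>C b) c) has_sum cinner s c) B"
    by (rule has_sum_bounded_linear[OF cinner.bounded_linear_left assms(2)])
  moreover have "((\<lambda>b. cinner (cinner x b *\<^sub>C b) c) has_sum cinner x c) B"
    using assms(1,3)
    by (intro has_sum_finite_neutralI[of "{c}"])
      (auto simp: cinner_scaleC_left orthonormal_def)
  ultimately show ?thesis using has_sum_unique by (fastforce simp: cinner.diff_left)
qed

lemma fourier_closure_span:
  fixes x :: "'a::chilbert_space"
  assumes "((\<lambda>b. cinner x b *\<^sub>C b) has_sum s) B"
  shows "s \<in> closure (complex_vector.span B)"
proof (rule Lim_in_closed_set)
  show "(sum (\<lambda>b. cinner x b *\<^sub>C b) \<longlongrightarrow> s) (finite_subsets_at_top B)"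
    using assms by (simp add: has_sum_def)
  show "\<forall>\<^sub>F J in finite_subsets_at_top B. sum (\<lambda>b. cinner x b *\<^sub>C b) J \<in> closure (complex_vector.span B)"
    by (rule eventually_finite_subsets_at_top_weakI)
      (intro subsetD[OF closure_subset] complex_vector.span_sum complex_vector.span_scale
        complex_vector.span_base, blast)
qed simp_all

lemma orthonormal_basis_exists: "\<exists>B :: 'a::chilbert_space set. orthonormal_basis B"
proof -
  have "\<exists>B\<in>Collect (orthonormal :: 'a set \<Rightarrow> bool). \<forall>X\<in>Collect orthonormal. B \<subseteq> X \<longrightarrow> X = B"
  proof (rule subset_Zorn')
    fix C :: "'a set set" assume "subset.chain (Collect orthonormal) C"
    hence C: "\<And>X. X \<in> C \<Longrightarrow> orthonormal X" "\<And>X Y. X \<in> C \<Longrightarrow> Y \<in> C \<Longrightarrow> X \<subseteq> Y \<or> Y \<subseteq> X"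
      by (auto simp: subset_chain_def)
    show "\<Union>C \<in> Collect orthonormal"
      unfolding orthonormal_def mem_Collect_eq
    proof (intro ballI)
      fix x y assume "x \<in> \<Union>C" "y \<in> \<Union>C"
      then obtain X where "X \<in> C" "x \<in> X" "y \<in> X" using C(2) by blast
      thus "cinner x y = (if x = y then 1 else 0)" using C(1) by (auto simp: orthonormal_def)
    qed
  qed
  then obtain B :: "'a set" where B: "orthonormal B" and max: "\<And>X. orthonormal X \<Longrightarrow> B \<subseteq> X \<Longrightarrow> X = B"
    by auto
  have "x \<in> closure (complex_vector.span B)" for x
  proof -
    obtain s where s: "((\<lambda>b. cinner x b *\<^sub>C b) has_sum s) B"
      using fourier_summable[OF B] summable_on_def by blast
    have "x = s"
    proof (rule ccontr)
      assume "x \<noteq> s"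
      define u where "u = complex_of_real (inverse (norm (x - s))) *\<^sub>C (x - s)"
      have "norm u = 1" using \<open>x \<noteq> s\<close> by (simp add: u_def norm_inverse)
      hence u: "cinner u u = 1" by (simp add: cinner_self)
      have ub: "cinner u b = 0" if "b \<in> B" for b
        using cinner_fourier[OF B s that] by (simp add: u_def cinner_scaleC_left)
      hence "cinner b u = 0" if "b \<in> B" for b using that cinner_commute[of b u] by simp
      hence "orthonormal (insert u B)" using B u ub by (auto simp: orthonormal_def)
      hence "u \<in> B" using max by blast
      thus False using ub u by fastforce
    qed
    thus ?thesis using fourier_closure_span[OF s] by simp
  qed
  hence "orthonormal_basis B" using B by (auto simp: orthonormal_basis_def)
  thus ?thesis ..
qed

lemma fourier_expansion:
  fixes x :: "'a::chilbert_space"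
  assumes "orthonormal_basis B"
  shows "((\<lambda>b. cinner x b *\<^sub>C b) has_sum x) B"
proof -
  have B: "orthonormal B" and d: "closure (complex_vector.span B) = UNIV"
    using assms by (auto simp: orthonormal_basis_def)
  obtain s where s: "((\<lambda>b. cinner x b *\<^sub>C b) has_sum s) B"
    using fourier_summable[OF B] summable_on_def by blast
  have sp: "cinner (x - s) y = 0" if "y \<in> complex_vector.span B" for y
    using that
    by (induction rule: complex_vector.span_induct_alt)
      (auto simp: cinner_add_right cinner_scaleC_right cinner.zero_right cinner_fourier[OF B s])
  have "closed {y. cinner (x - s) y = 0}"
    by (intro closed_Collect_eq continuous_intros
        linear_continuous_on cinner.bounded_linear_right)
  hence "closure (complex_vector.span B) \<subseteq> {y. cinner (x - s) y = 0}"
    by (intro closure_minimal) (auto simp: sp)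
  hence "cinner (x - s) (x - s) = 0" using d by auto
  hence "x = s" by (simp add: cinner_self)
  thus ?thesis using s by simp
qed

definition some_onb :: "'a::chilbert_space set" where
  "some_onb = (SOME B. orthonormal_basis B)"

lemma some_onb: "orthonormal_basis some_onb"
  unfolding some_onb_def by (rule someI_ex) (rule orthonormal_basis_exists)

lemma orthonormal_some_onb: "orthonormal some_onb"
  by (rule some_onb[unfolded orthonormal_basis_def, THEN conjunct1])


section \<open>Hilbert space tensor products\<close>

text \<open>
  The tensor product is realised as the direct sum of one copy of the second factor for each
  vector \<open>b\<close> of an orthonormal basis of the first, \<open>b \<otimes> k\<close> being \<open>k\<close> placed in
  the summand at \<open>b\<close>. The lemmas \<open>cinner_tensor\<close> and \<open>tensor_total\<close> below characterise
  it up to a canonical unitary, so the choice of the basis is immaterial.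
\<close>

typedef (overloaded) ('a, 'b) htensor =
  "{f :: ('a::chilbert_space, 'b::complex_inner) ell2. \<forall>x. x \<notin> some_onb \<longrightarrow> coord f x = 0}"
  morphisms ell2_of Abs_htensor
  by (rule exI[of _ 0]) simp

setup_lifting type_definition_htensor

instantiation htensor :: (chilbert_space, complex_inner) complex_inner
begin

lift_definition zero_htensor :: "('a, 'b) htensor" is 0 by simp
lift_definition plus_htensor :: "('a, 'b) htensor \<Rightarrow> ('a, 'b) htensor \<Rightarrow> ('a, 'b) htensor"
  is "(+)" by simp
lift_definition minus_htensor :: "('a, 'b) htensor \<Rightarrow> ('a, 'b) htensor \<Rightarrow> ('a, 'b) htensor"
  is "(-)" by simp
lift_definition uminus_htensor :: "('a, 'b) htensor \<Rightarrow> ('a, 'b) htensor"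
  is uminus by simp
lift_definition scaleC_htensor :: "complex \<Rightarrow> ('a, 'b) htensor \<Rightarrow> ('a, 'b) htensor"
  is "(*\<^sub>C)" by simp
lift_definition scaleR_htensor :: "real \<Rightarrow> ('a, 'b) htensor \<Rightarrow> ('a, 'b) htensor"
  is "(*\<^sub>R)" by simp
lift_definition cinner_htensor :: "('a, 'b) htensor \<Rightarrow> ('a, 'b) htensor \<Rightarrow> complex"
  is cinner .
lift_definition inner_htensor :: "('a, 'b) htensor \<Rightarrow> ('a, 'b) htensor \<Rightarrow> real"
  is inner .
lift_definition norm_htensor :: "('a, 'b) htensor \<Rightarrow> real" is norm .
lift_definition dist_htensor :: "('a, 'b) htensor \<Rightarrow> ('a, 'b) htensor \<Rightarrow> real" is dist .
lift_definition sgn_htensor :: "('a, 'b) htensor \<Rightarrow> ('a, 'b) htensor"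
  is sgn by (simp add: sgn_div_norm)
definition uniformity_htensor :: "(('a, 'b) htensor \<times> ('a, 'b) htensor) filter"
  where "uniformity_htensor = (INF e\<in>{0<..}. principal {(x, y). dist x y < e})"
definition open_htensor :: "('a, 'b) htensor set \<Rightarrow> bool"
  where "open_htensor U \<longleftrightarrow> (\<forall>x\<in>U. eventually (\<lambda>(x', y). x' = x \<longrightarrow> y \<in> U) uniformity)"

instance
proof
  fix x y z :: "('a, 'b) htensor" and c d :: complex and r s :: real
  show "x + y + z = x + (y + z)" "x + y = y + x" "0 + x = x" "- x + x = 0" "x - y = x + - y"
    by (transfer; simp)+
  show "r *\<^sub>R (x + y) = r *\<^sub>R x + r *\<^sub>R y" "(r + s) *\<^sub>R x = r *\<^sub>R x + s *\<^sub>R x"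
    "r *\<^sub>R s *\<^sub>R x = (r * s) *\<^sub>R x" "1 *\<^sub>R x = x"
    by (transfer; simp add: algebra_simps)+
  show "c *\<^sub>C (x + y) = c *\<^sub>C x + c *\<^sub>C y" "(c + d) *\<^sub>C x = c *\<^sub>C x + d *\<^sub>C x"
    "c *\<^sub>C d *\<^sub>C x = (c * d) *\<^sub>C x" "r *\<^sub>R x = complex_of_real r *\<^sub>C x"
    by (transfer; simp add: scaleC_add_right scaleC_add_left scaleC_scaleC scaleR_scaleC)+
  show "sgn x = inverse (norm x) *\<^sub>R x" by transfer (rule sgn_div_norm)
  show "dist x y = norm (x - y)" by transfer (rule dist_norm)
  show "uniformity = (INF e\<in>{0<..}. principal {(x, y :: ('a, 'b) htensor). dist x y < e})"
    by (rule uniformity_htensor_def)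
  show "open U \<longleftrightarrow> (\<forall>x\<in>U. eventually (\<lambda>(x', y). x' = x \<longrightarrow> y \<in> U) uniformity)"
    for U :: "('a, 'b) htensor set" by (rule open_htensor_def)
  show "cinner x y = cnj (cinner y x)" by transfer (rule cinner_commute)
  show "cinner (x + y) z = cinner x z + cinner y z" by transfer (rule cinner_add_left)
  show "cinner (c *\<^sub>C x) y = c * cinner x y" by transfer (rule cinner_scaleC_left)
  show "inner x y = Re (cinner x y)" by transfer (rule inner_eq_Re_cinner)
  show "inner (r *\<^sub>R x) y = r * inner x y" by transfer simp
  show "inner x y = inner y x" by transfer (rule inner_commute)
  show "inner (x + y) z = inner x z + inner y z" by transfer (rule inner_add_left)
  show "norm x = sqrt (inner x x)" by transfer (rule norm_eq_sqrt_inner)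
  show "0 \<le> inner x x" by transfer simp
  show "inner x x = 0 \<longleftrightarrow> x = 0" by transfer simp
qed

end

instance htensor :: (chilbert_space, chilbert_space) chilbert_space
proof
  fix X :: "nat \<Rightarrow> ('a, 'b) htensor"
  assume "Cauchy X"
  hence "Cauchy (\<lambda>n. ell2_of (X n))"
    by (simp add: Cauchy_def dist_htensor.rep_eq)
  then obtain g where g: "(\<lambda>n. ell2_of (X n)) \<longlonglongrightarrow> g"
    using Cauchy_convergent convergent_def by blast
  have "coord g x = 0" if "x \<notin> some_onb" for x
  proof -
    have "(\<lambda>n. coord (ell2_of (X n)) x) \<longlonglongrightarrow> coord g x"
      by (rule bounded_linear.tendsto[OF bounded_linear_coord g])
    moreover have "(\<lambda>n. coord (ell2_of (X n)) x) = (\<lambda>_. 0)" using ell2_of that by fastforce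
    ultimately show ?thesis by (simp add: LIMSEQ_const_iff)
  qed
  hence "ell2_of (Abs_htensor g) = g" by (simp add: Abs_htensor_inverse)
  hence "X \<longlonglongrightarrow> Abs_htensor g"
    using g by (simp add: lim_sequentially dist_htensor.rep_eq)
  thus "convergent X" by (auto simp: convergent_def)
qed

lift_definition tensor_ell2 :: "'a::chilbert_space \<Rightarrow> 'b::complex_inner \<Rightarrow> ('a, 'b) ell2"
  is "\<lambda>h k b. if b \<in> some_onb then cinner h b *\<^sub>C k else 0"
proof -
  fix h :: 'a and k :: 'b
  have "(\<lambda>b. (norm (cinner h b *\<^sub>C k))\<^sup>2) summable_on some_onb"
    by (simp add: power_mult_distrib summable_on_cmult_left bessel_summable[OF orthonormal_some_onb])
  thus "(\<lambda>b. (norm (if b \<in> some_onb then cinner h b *\<^sub>C k else 0))\<^sup>2) summable_on UNIV"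
    by (rule summable_on_cong_neutral[THEN iffD1, rotated -1]) auto
qed

lift_definition tensor :: "'a::chilbert_space \<Rightarrow> 'b::complex_inner \<Rightarrow> ('a, 'b) htensor"
  (infixr "\<otimes>" 70) is tensor_ell2
  by (simp add: tensor_ell2.rep_eq)

lemma cinner_tensor: "cinner (h \<otimes> k) (h' \<otimes> k') = cinner h h' * cinner k k'"
proof -
  have "((\<lambda>b. cinner (cinner h b *\<^sub>C b) h' * cinner k k') has_sum cinner h h' * cinner k k') some_onb"
    by (intro has_sum_cmult_left
        has_sum_bounded_linear[OF cinner.bounded_linear_left fourier_expansion[OF some_onb]])
  moreover have "cinner (cinner h b *\<^sub>C b) h' * cinner k k' =
      cinner (coord (tensor_ell2 h k) b) (coord (tensor_ell2 h' k') b)" if "b \<in> some_onb" for b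
    using that cinner_commute[of b h']
    by (simp add: tensor_ell2.rep_eq cinner_scaleC_left cinner_scaleC_right)
  ultimately have "((\<lambda>b. cinner (coord (tensor_ell2 h k) b) (coord (tensor_ell2 h' k') b))
      has_sum cinner h h' * cinner k k') some_onb"
    by (simp cong: has_sum_cong)
  hence "((\<lambda>b. cinner (coord (tensor_ell2 h k) b) (coord (tensor_ell2 h' k') b))
      has_sum cinner h h' * cinner k k') UNIV"
    by (rule has_sum_cong_neutral[THEN iffD1, rotated -1])
      (auto simp: tensor_ell2.rep_eq cinner.zero_left)
  thus ?thesis
    by (simp add: cinner_htensor.rep_eq tensor.rep_eq cinner_ell2_def infsumI)
qed

lemma tensor_add_left: "(h + h') \<otimes> k = h \<otimes> k + h' \<otimes> k"
  and tensor_add_right: "h \<otimes> (k + k') = h \<otimes> k + h \<otimes> k'"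
  and tensor_scaleC_left: "(c *\<^sub>C h) \<otimes> k = c *\<^sub>C (h \<otimes> k)"
  and tensor_scaleC_right: "h \<otimes> (c *\<^sub>C k) = c *\<^sub>C (h \<otimes> k)"
  by (transfer; simp add: coord_inject[symmetric] fun_eq_iff tensor_ell2.rep_eq plus_ell2.rep_eq
      scaleC_ell2.rep_eq cinner_add_left cinner_scaleC_left scaleC_add_left scaleC_add_right
      scaleC_scaleC mult.commute)+

lemma tensor_total:
  "closure (complex_vector.span {h \<otimes> k | (h :: 'a::chilbert_space) (k :: 'b::chilbert_space). True}) = UNIV"
proof -
  have "f \<in> closure (complex_vector.span {h \<otimes> k | h k. True})" for f :: "('a, 'b) htensor"
  proof -
    have o: "cinner b c = (if b = c then 1 else 0)" if "b \<in> some_onb" "c \<in> some_onb" for b c :: 'a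
      using orthonormal_some_onb that by (auto simp: orthonormal_def)
    define g where "g = coord (ell2_of f)"
    have g0: "g b = 0" if "b \<notin> some_onb" for b using ell2_of[of f] that by (simp add: g_def)
    have gs: "(\<lambda>b. (norm (g b))\<^sup>2) summable_on some_onb"
      unfolding g_def by (rule summable_on_subset[OF ell2_summable]) simp
    have "(\<lambda>b. b \<otimes> g b) summable_on some_onb"
    proof (rule orthogonal_summable)
      have "norm (b \<otimes> g b) = norm (g b)" if "b \<in> some_onb" for b
      proof -
        have "complex_of_real ((norm (b \<otimes> g b))\<^sup>2) = complex_of_real ((norm (g b))\<^sup>2)"
          by (simp only: cinner_self[symmetric] cinner_tensor o[OF that that]) simp
        hence "(norm (b \<otimes> g b))\<^sup>2 = (norm (g b))\<^sup>2" using of_real_eq_iff by blast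
        thus ?thesis by (simp add: power2_eq_iff_nonneg)
      qed
      thus "(\<lambda>b. (norm (b \<otimes> g b))\<^sup>2) summable_on some_onb"
        using gs by (simp cong: summable_on_cong)
    qed (auto simp: inner_eq_Re_cinner cinner_tensor o)
    then obtain s where s: "((\<lambda>b. b \<otimes> g b) has_sum s) some_onb" using summable_on_def by blast
    have "bounded_linear (\<lambda>f :: ('a, 'b) htensor. coord (ell2_of f) c)" for c
      by (rule bounded_linear_intro[of _ 1])
        (simp_all add: plus_htensor.rep_eq scaleR_htensor.rep_eq norm_htensor.rep_eq norm_coord_le)
    from has_sum_bounded_linear[OF this s]
    have c: "((\<lambda>b. coord (ell2_of (b \<otimes> g b)) c) has_sum coord (ell2_of s) c) some_onb" for c .
    have "coord (ell2_of s) c = g c" for c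
    proof (cases "c \<in> some_onb")
      case True
      have "((\<lambda>b. coord (ell2_of (b \<otimes> g b)) c) has_sum g c) some_onb"
        using True by (intro has_sum_finite_neutralI[of "{c}"])
          (auto simp: tensor.rep_eq tensor_ell2.rep_eq o)
      thus ?thesis using c has_sum_unique by blast
    qed (use ell2_of[of s] g0 in simp)
    hence "s = f" by (simp add: ell2_of_inject[symmetric] coord_inject[symmetric] g_def fun_eq_iff)
    show ?thesis
    proof (rule Lim_in_closed_set)
      show "(sum (\<lambda>b. b \<otimes> g b) \<longlongrightarrow> f) (finite_subsets_at_top some_onb)"
        using s \<open>s = f\<close> by (simp add: has_sum_def)
      show "\<forall>\<^sub>F J in finite_subsets_at_top some_onb.
          sum (\<lambda>b. b \<otimes> g b) J \<in> closure (complex_vector.span {h \<otimes> k | h k. True})"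
        by (rule eventually_finite_subsets_at_top_weakI)
          (intro subsetD[OF closure_subset] complex_vector.span_sum complex_vector.span_base, blast)
    qed simp_all
  qed
  thus ?thesis by blast
qed


section \<open>Bounded operators\<close>

text \<open>\<open>blinfun\<close> consists of the real-linear bounded maps; \<open>bop\<close> is \<open>B('a, 'b)\<close>.\<close>

definition bop :: "('a::complex_inner \<Rightarrow>\<^sub>L 'b::complex_inner) set" where
  "bop = {T. \<forall>c x. blinfun_apply T (c *\<^sub>C x) = c *\<^sub>C blinfun_apply T x}"

definition adj :: "('a::complex_inner \<Rightarrow>\<^sub>L 'b::complex_inner) \<Rightarrow> ('b \<Rightarrow>\<^sub>L 'a)" where
  "adj T = (THE S. \<forall>x y. cinner (T x) y = cinner x (blinfun_apply S y))"

definition tensor_op ::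
  "('a::chilbert_space \<Rightarrow>\<^sub>L 'c::chilbert_space) \<Rightarrow> ('b::chilbert_space \<Rightarrow>\<^sub>L 'd::chilbert_space)
    \<Rightarrow> (('a, 'b) htensor \<Rightarrow>\<^sub>L ('c, 'd) htensor)" where
  "tensor_op S T = (THE R. R \<in> bop \<and> (\<forall>h k. blinfun_apply R (h \<otimes> k) = S h \<otimes> T k))"

definition positive_op :: "('a::complex_inner \<Rightarrow>\<^sub>L 'a) \<Rightarrow> bool" where
  "positive_op T \<longleftrightarrow> T \<in> bop \<and> (\<forall>x. cinner (T x) x \<in> \<real> \<and> 0 \<le> Re (cinner (T x) x))"

definition invertible_op :: "('a::complex_inner \<Rightarrow>\<^sub>L 'a) \<Rightarrow> bool" where
  "invertible_op T \<longleftrightarrow> (\<exists>S\<in>bop. S o\<^sub>L T = id_blinfun \<and> T o\<^sub>L S = id_blinfun)"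

definition op_le :: "('a::complex_inner \<Rightarrow>\<^sub>L 'a) \<Rightarrow> ('a \<Rightarrow>\<^sub>L 'a) \<Rightarrow> bool" where
  "op_le S T \<longleftrightarrow> positive_op (T - S)"

definition op_less :: "('a::complex_inner \<Rightarrow>\<^sub>L 'a) \<Rightarrow> ('a \<Rightarrow>\<^sub>L 'a) \<Rightarrow> bool" where
  "op_less S T \<longleftrightarrow> positive_op (T - S) \<and> invertible_op (T - S)"

definition infinite_dimensional :: "'a::complex_vector itself \<Rightarrow> bool" where
  "infinite_dimensional _ \<longleftrightarrow> \<not> (\<exists>B :: 'a set. finite B \<and> complex_vector.span B = UNIV)"


section \<open>The noncommutative ball\<close>

text \<open>
  The index type \<open>'n :: countable\<close> is \<open>{1, \<dots>, n}\<close>; it may be finite or countably infinite.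
  If it is infinite, \<open>\<Sum>\<^sub>i X\<^sub>i X\<^sub>i\<^sup>*\<close> converges strongly precisely
  if \<open>(X\<^sub>1, X\<^sub>2, \<dots>)\<close> is a bounded row operator.
\<close>

definition row_sum :: "('n::countable \<Rightarrow> 'h::chilbert_space \<Rightarrow>\<^sub>L 'h) \<Rightarrow> ('h \<Rightarrow>\<^sub>L 'h) \<Rightarrow> bool" where
  "row_sum X R \<longleftrightarrow> (\<forall>x. ((\<lambda>i. X i (adj (X i) x)) has_sum R x) UNIV)"

definition row_norm :: "('n::countable \<Rightarrow> 'h::chilbert_space \<Rightarrow>\<^sub>L 'h) \<Rightarrow> real" where
  "row_norm X = sqrt (norm (THE R. row_sum X R))"

definition row_ball :: "('n::countable \<Rightarrow> 'h::chilbert_space \<Rightarrow>\<^sub>L 'h) set" where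
  "row_ball = {X. (\<forall>i. X i \<in> bop) \<and> (\<exists>R. row_sum X R) \<and> row_norm X < 1}"

text \<open>Elements of the free semigroup on \<open>'n\<close> are words, i.e. lists.\<close>

fun word_op :: "('n \<Rightarrow> 'h::real_normed_vector \<Rightarrow>\<^sub>L 'h) \<Rightarrow> 'n list \<Rightarrow> 'h \<Rightarrow>\<^sub>L 'h" where
  "word_op X [] = id_blinfun"
| "word_op X (i # \<alpha>) = X i o\<^sub>L word_op X \<alpha>"


section \<open>Free holomorphic functions\<close>

text \<open>
  \<open>T = \<Sum>\<^sub>k \<Sum>\<^bsub>|\<alpha>| = k\<^esub> X\<^sub>\<alpha> \<otimes> A\<^sub>\<alpha>\<close>, the outer series converging in
  operator norm. For finite \<open>'n\<close> the inner sum is finite; for infinite \<open>'n\<close> it is understood in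
  the strong operator topology.
\<close>

definition has_free_sum ::
  "('n::countable list \<Rightarrow> 'e::chilbert_space \<Rightarrow>\<^sub>L 'g::chilbert_space) \<Rightarrow> ('n \<Rightarrow> 'h::chilbert_space \<Rightarrow>\<^sub>L 'h)
    \<Rightarrow> (('h, 'e) htensor \<Rightarrow>\<^sub>L ('h, 'g) htensor) \<Rightarrow> bool" where
  "has_free_sum A X T \<longleftrightarrow>
    (\<exists>P :: nat \<Rightarrow> ('h, 'e) htensor \<Rightarrow>\<^sub>L ('h, 'g) htensor.
      (\<forall>k v. ((\<lambda>\<alpha>. tensor_op (word_op X \<alpha>) (A \<alpha>) v) has_sum blinfun_apply (P k) v) {\<alpha>. length \<alpha> = k}) \<and>
      P sums T)"

definition free_eval ::
  "('n::countable list \<Rightarrow> 'e::chilbert_space \<Rightarrow>\<^sub>L 'g::chilbert_space) \<Rightarrow> ('n \<Rightarrow> 'h::chilbert_space \<Rightarrow>\<^sub>L 'h)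
    \<Rightarrow> ('h, 'e) htensor \<Rightarrow>\<^sub>L ('h, 'g) htensor" where
  "free_eval A X = (THE T. has_free_sum A X T)"

text \<open>\<open>F\<close> is free holomorphic on the ball with coefficients \<open>A\<close>. Its values off the ball are irrelevant.\<close>

definition free_holomorphic ::
  "(('n::countable \<Rightarrow> 'h::chilbert_space \<Rightarrow>\<^sub>L 'h) \<Rightarrow> ('h, 'e::chilbert_space) htensor \<Rightarrow>\<^sub>L ('h, 'g::chilbert_space) htensor)
    \<Rightarrow> ('n list \<Rightarrow> 'e \<Rightarrow>\<^sub>L 'g) \<Rightarrow> bool" where
  "free_holomorphic F A \<longleftrightarrow> (\<forall>\<alpha>. A \<alpha> \<in> bop) \<and> (\<forall>X\<in>row_ball. has_free_sum A X (F X))"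

definition sup_norm ::
  "(('n::countable \<Rightarrow> 'h::chilbert_space \<Rightarrow>\<^sub>L 'h) \<Rightarrow> 'a::real_normed_vector \<Rightarrow>\<^sub>L 'b::real_normed_vector) \<Rightarrow> ereal" where
  "sup_norm F = (SUP X\<in>row_ball. ereal (norm (F X)))"


section \<open>The full Fock space\<close>

text \<open>
  \<open>f\<close> stands for the vector whose coordinate with respect to the orthonormal basis vector
  \<open>e\<^bsub>i1\<^esub> \<otimes> \<dots> \<otimes> e\<^bsub>ik\<^esub>\<close> is \<open>coord f [i1, \<dots>, ik]\<close>.
\<close>

type_synonym 'n fock = "('n list, complex) ell2"

lift_definition left_creation :: "'n \<Rightarrow> 'n fock \<Rightarrow> 'n fock"
  is "\<lambda>i f \<alpha>. case \<alpha> of [] \<Rightarrow> 0 | j # \<beta> \<Rightarrow> if j = i then f \<beta> else 0"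
proof -
  fix i :: 'n and f :: "'n list \<Rightarrow> complex"
  assume f: "(\<lambda>\<beta>. (norm (f \<beta>))\<^sup>2) summable_on UNIV"
  let ?g = "\<lambda>\<alpha>. case \<alpha> of [] \<Rightarrow> 0 | j # \<beta> \<Rightarrow> if j = i then f \<beta> else 0"
  have "(\<lambda>\<alpha>. (norm (?g \<alpha>))\<^sup>2) summable_on range ((#) i)"
    using f by (subst summable_on_reindex) (auto simp: o_def)
  thus "(\<lambda>\<alpha>. (norm (?g \<alpha>))\<^sup>2) summable_on UNIV"
    by (rule summable_on_cong_neutral[THEN iffD1, rotated -1]) (auto split: list.splits)
qed

lemma norm_left_creation: "norm (left_creation i f) = norm f"
proof -
  let ?g = "\<lambda>\<alpha>. (norm (coord (left_creation i f) \<alpha>))\<^sup>2"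
  have "(norm (left_creation i f))\<^sup>2 = infsum ?g (range ((#) i))"
    unfolding norm_ell2_square
    by (rule infsum_cong_neutral) (auto simp: left_creation.rep_eq split: list.splits)
  also have "\<dots> = (norm f)\<^sup>2"
    by (subst infsum_reindex) (auto simp: o_def left_creation.rep_eq norm_ell2_square)
  finally show ?thesis by (simp add: power2_eq_iff_nonneg)
qed

lift_definition creation :: "'n \<Rightarrow> 'n fock \<Rightarrow>\<^sub>L 'n fock" is left_creation
proof (rule bounded_linear_intro[of _ 1])
  fix i :: 'n and f g :: "'n fock" and r :: real
  show "left_creation i (f + g) = left_creation i f + left_creation i g"
    "left_creation i (r *\<^sub>R f) = r *\<^sub>R left_creation i f"
    by (auto simp: coord_inject[symmetric] fun_eq_iff left_creation.rep_eq split: list.splits)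
qed (simp add: norm_left_creation)

text \<open>The infimum over unit vectors is \<open>\<infinity>\<close> if there are none.\<close>

definition radial_infimum_property ::
  "(('n::countable \<Rightarrow> 'h::chilbert_space \<Rightarrow>\<^sub>L 'h) \<Rightarrow> ('h, 'y::chilbert_space) htensor \<Rightarrow>\<^sub>L ('h, 'g::chilbert_space) htensor)
    \<Rightarrow> ('n list \<Rightarrow> 'y \<Rightarrow>\<^sub>L 'g) \<Rightarrow> bool" where
  "radial_infimum_property \<Theta> B \<longleftrightarrow>
    free_holomorphic \<Theta> B \<and> sup_norm \<Theta> < \<infinity> \<and>
    Liminf (at_left (1 :: real))
      (\<lambda>r. INF x\<in>{x. norm x = 1}. ereal (norm (free_eval B (\<lambda>i. r *\<^sub>R creation i) x))) = sup_norm \<Theta>"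

text \<open>
  If \<open>F = \<Theta>G\<close> and \<open>\<parallel>G(0)\<parallel> < 1\<close>, the strict inequality \<open>\<parallel>F(X)\<parallel> < \<parallel>\<Theta>(X)\<parallel>\<close> is equivalent to
  \<open>\<Theta>(X) \<noteq> 0\<close>, and the theorem is stated so. The condition \<open>G(X) \<noteq> 0\<close> printed in the source is a slip:
  it fails for \<open>F = G = 0\<close>, \<open>\<Theta> = I\<close>, and also for \<open>\<Theta>(X) = X\<^sub>1\<close>, \<open>G = 1/2\<close> at \<open>X = 0\<close> (\<open>n = 1\<close>).
\<close>

end

theory Submission
  imports Defs "HOL-Complex_Analysis.Conformal_Mappings"
begin

text \<open>
  Fix \<open>X\<close> in the ball. Everything follows from the bound \<open>\<parallel>G\<parallel>\<^sub>\<infinity> \<le> 1\<close> and its strict version: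
  \<open>F X = \<Theta> X G X\<close> gives \<open>\<parallel>F X\<parallel> \<le> \<parallel>\<Theta> X\<parallel> \<parallel>G X\<parallel>\<close> and, taking adjoints,
  \<open>\<parallel>(F X)\<^sup>* x\<parallel> \<le> \<parallel>G X\<parallel> \<parallel>(\<Theta> X)\<^sup>* x\<parallel>\<close>. If \<open>\<parallel>G X\<parallel> < 1\<close>, then
  \<open>\<Theta> X (\<Theta> X)\<^sup>* - F X (F X)\<^sup>*\<close> is squeezed between positive multiples of \<open>\<Theta> X (\<Theta> X)\<^sup>*\<close>, and
  for a positive operator to be invertible means to be bounded below
  (\<open>op_less_bounded_below\<close>).

  The bound on \<open>G\<close> (\<open>factor_contractive\<close>). On the Fock space,
  \<open>F(rS) = \<Theta>(rS) G(rS)\<close>, so a lower bound \<open>m\<close> for \<open>\<Theta>(rS)\<close> on unit vectors yields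
  \<open>\<parallel>G(rS)\<parallel> \<le> 1/m\<close>; by the radial infimum property, \<open>m\<close> may be taken arbitrarily close to \<open>1\<close>
  as \<open>r \<rightarrow> 1\<close>. It remains to compare \<open>G(X)\<close> with \<open>G(rS)\<close> if \<open>\<parallel>X\<parallel> < r\<close>. For this, the Hilbert space
  \<open>H\<close> is written as a direct sum of copies \<open>W\<^sub>\<alpha> H\<close> of itself, one for each word \<open>\<alpha>\<close>; this
  is possible as \<open>H\<close> is separable and infinite dimensional. The shift
  \<open>L\<^sub>i W\<^sub>\<alpha> = W\<^bsub>i\<alpha>\<^esub>\<close> is then an infinite multiple of \<open>S\<close> acting on \<open>H\<close> itself, so that \<open>rL\<close>
  is a point of the ball at which the hypotheses can be used, and
  \<^item> \<open>\<parallel>G(rL)\<parallel> \<le> \<parallel>G(rS)\<parallel>\<close>, because \<open>G(rL)\<close> is a direct sum of copies of \<open>G(rS)\<close>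
    (\<open>norm_shift_le_fock\<close>);
  \<^item> \<open>\<parallel>G(X)\<parallel> \<le> \<parallel>G(rL)\<parallel>\<close>, because \<open>G(X)\<close> is a compression of \<open>G(rL)\<close>: the Poisson kernel
    \<open>K h = \<Sum>\<^sub>\<alpha> W\<^sub>\<alpha> D Y\<^sub>\<alpha>\<^sup>* h\<close> with \<open>Y = X/r\<close> and \<open>D\<^sup>2 = I - \<Sum>\<^sub>i Y\<^sub>i Y\<^sub>i\<^sup>*\<close> is an isometry with
    \<open>X\<^sub>i K\<^sup>* = K\<^sup>* (r L\<^sub>i)\<close> (\<open>poisson_kernel\<close>, \<open>von_neumann_inequality\<close>).

  The strict bound (\<open>free_holomorphic_strict_contraction\<close>) is a statement about one complex
  variable: for unit vectors \<open>v\<close>, \<open>w\<close> the function \<open>z \<mapsto> \<langle>G(zX) v, w\<rangle>\<close> is holomorphic and bounded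
  by \<open>1\<close> on a disc of radius greater than \<open>1\<close>, and its value at \<open>0\<close> is at most \<open>\<parallel>G(0)\<parallel> < 1\<close>.
  The Schwarz--Pick inequality then bounds its value at \<open>1\<close> away from \<open>1\<close>, uniformly in \<open>v\<close> and \<open>w\<close>.
\<close>

section \<open>Bounded operators and their adjoints\<close>

lemma bop_scaleC: "T \<in> bop \<Longrightarrow> blinfun_apply T (c *\<^sub>C x) = c *\<^sub>C T x"
  by (simp add: bop_def)

lemma bop_id [simp]: "id_blinfun \<in> bop"
  by (simp add: bop_def)

lemma bop_compose [simp]: "S \<in> bop \<Longrightarrow> T \<in> bop \<Longrightarrow> S o\<^sub>L T \<in> bop"
  by (simp add: bop_def)

lemma scaleC_diff_right: "c *\<^sub>C (x - y) = c *\<^sub>C x - c *\<^sub>C y" for x :: "'a::complex_vector"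
  by (rule complex_vector.scale_right_diff_distrib)

lemma scaleC_scaleR_commute: "c *\<^sub>C (r *\<^sub>R x) = r *\<^sub>R (c *\<^sub>C x)" for x :: "'a::complex_vector"
  by (simp add: scaleR_scaleC scaleC_scaleC mult.commute)

lemma bop_diff [simp]: "S \<in> bop \<Longrightarrow> T \<in> bop \<Longrightarrow> S - T \<in> bop"
  by (simp add: bop_def blinfun.diff_left scaleC_diff_right)

lemma bop_add [simp]: "S \<in> bop \<Longrightarrow> T \<in> bop \<Longrightarrow> S + T \<in> bop"
  by (simp add: bop_def blinfun.add_left scaleC_add_right)

lemma bop_scaleR [simp]: "T \<in> bop \<Longrightarrow> r *\<^sub>R T \<in> bop"
  by (simp add: bop_def blinfun.scaleR_left scaleC_scaleR_commute)

lemma bop_of_fun: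
  fixes f :: "'a::complex_inner \<Rightarrow> 'b::complex_inner"
  assumes "\<And>x y. f (x + y) = f x + f y" "\<And>c x. f (c *\<^sub>C x) = c *\<^sub>C f x"
    and "\<And>x. norm (f x) \<le> K * norm x"
  obtains T where "T \<in> bop" "\<And>x. blinfun_apply T x = f x"
proof -
  have "bounded_linear f"
    using assms(3) by (intro bounded_linear_intro[of f K] assms(1))
      (simp_all add: scaleR_scaleC assms(2) mult.commute)
  hence "blinfun_apply (Blinfun f) = f" by (rule bounded_linear_Blinfun_apply)
  thus ?thesis using that[of "Blinfun f"] assms(2) by (simp add: bop_def)
qed

lemma bounded_linear_scaleC: "bounded_linear (\<lambda>x :: 'a::complex_inner. c *\<^sub>C x)"
  by (rule bounded_linear_intro[of _ "cmod c"])
    (simp_all add: scaleC_add_right scaleC_scaleR_commute mult.commute)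

lemma cinner_ext_right:
  fixes y z :: "'a::complex_inner"
  assumes "\<And>x. cinner x y = cinner x z"
  shows "y = z"
proof -
  have "cinner (y - z) (y - z) = 0" by (subst cinner.diff_right) (simp add: assms)
  thus ?thesis by (simp add: cinner_self)
qed

lemma cinner_ext_left:
  fixes y z :: "'a::complex_inner"
  assumes "\<And>x. cinner y x = cinner z x"
  shows "y = z"
proof (rule cinner_ext_right)
  fix x show "cinner x y = cinner x z"
    by (subst (1 2) cinner_commute) (simp add: assms)
qed

text \<open>
  In Bessel-type arguments \<open>N = \<parallel>s\<parallel>\<^sup>2\<close> is a finite sum of squares that has been estimated by
  \<open>K \<parallel>s\<parallel>\<close>; this absorbs one factor.
\<close>
lemma le_square_of_le_mult_sqrt:
  fixes N K :: real
  assumes "N \<le> K * s" "s\<^sup>2 = N"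
  shows "N \<le> K\<^sup>2"
proof -
  have "0 \<le> (K - s)\<^sup>2" by simp
  thus ?thesis using assms by (simp add: power2_eq_square algebra_simps)
qed

text \<open>
  The representing vector is \<open>\<Sum>\<^sub>b cnj (\<phi> b) b\<close> over an orthonormal basis. Testing \<open>\<phi>\<close> on the finite
  partial sums of this series shows that the coefficients are square summable.
\<close>
lemma riesz_representation:
  fixes \<phi> :: "'a::chilbert_space \<Rightarrow> complex"
  assumes add: "\<And>x y. \<phi> (x + y) = \<phi> x + \<phi> y" and scale: "\<And>c x. \<phi> (c *\<^sub>C x) = c * \<phi> x"
    and bd: "\<And>x. cmod (\<phi> x) \<le> K * norm x"
  obtains y where "\<And>x. \<phi> x = cinner x y"
proof -
  let ?B = "some_onb :: 'a set"
  have o: "cinner b c = (if b = c then 1 else 0)" if "b \<in> ?B" "c \<in> ?B" for b c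
    using orthonormal_some_onb that by (auto simp: orthonormal_def)
  have n: "norm b = 1" if "b \<in> ?B" for b
    using norm_orthonormal[OF orthonormal_some_onb that] .
  have bl: "bounded_linear \<phi>"
    using bd by (intro bounded_linear_intro[of \<phi> K] add)
      (simp_all add: scaleR_scaleC scale scaleC_complex_def mult.commute)
  have fin: "(\<Sum>b\<in>J. (cmod (\<phi> b))\<^sup>2) \<le> K\<^sup>2" if J: "finite J" "J \<subseteq> ?B" for J
  proof -
    define s where "s = (\<Sum>b\<in>J. cnj (\<phi> b) *\<^sub>C b)"
    have "inner (cnj (\<phi> b) *\<^sub>C b) (cnj (\<phi> c) *\<^sub>C c) = 0" if "b \<in> J" "c \<in> J" "b \<noteq> c" for b c
    proof -
      have "cinner b c = 0" using o[of b c] that J by auto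
      thus ?thesis by (simp add: inner_eq_Re_cinner cinner_scaleC_left cinner_scaleC_right)
    qed
    hence ns: "(norm s)\<^sup>2 = (\<Sum>b\<in>J. (cmod (\<phi> b))\<^sup>2)"
      unfolding s_def using J n by (subst norm_orthogonal_sum_square) (auto intro!: sum.cong)
    have "\<phi> s = (\<Sum>b\<in>J. cnj (\<phi> b) * \<phi> b)"
      unfolding s_def by (simp add: bounded_linear.linear[OF bl, THEN linear_sum] scale)
    also have "\<dots> = complex_of_real (\<Sum>b\<in>J. (cmod (\<phi> b))\<^sup>2)"
      by (simp add: complex_norm_square mult.commute del: of_real_power)
    finally have "cmod (\<phi> s) = (\<Sum>b\<in>J. (cmod (\<phi> b))\<^sup>2)"
      by (metis abs_of_nonneg norm_of_real ns zero_le_power2)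
    thus ?thesis using bd[of s] ns by (intro le_square_of_le_mult_sqrt[of _ K "norm s"]) auto
  qed
  have "(\<lambda>b. (cmod (\<phi> b))\<^sup>2) summable_on ?B"
    by (rule nonneg_bdd_above_summable_on) (auto intro!: bdd_aboveI2[of _ _ "K\<^sup>2"] fin)
  hence "(\<lambda>b. (norm (cnj (\<phi> b) *\<^sub>C b))\<^sup>2) summable_on ?B"
    by (rule summable_on_cong[THEN iffD1, rotated]) (simp add: n)
  hence "(\<lambda>b. cnj (\<phi> b) *\<^sub>C b) summable_on ?B"
    by (intro orthogonal_summable)
      (auto simp: inner_eq_Re_cinner cinner_scaleC_left cinner_scaleC_right o)
  then obtain y where y: "((\<lambda>b. cnj (\<phi> b) *\<^sub>C b) has_sum y) ?B" by (auto simp: summable_on_def)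
  show ?thesis
  proof (rule that)
    fix x
    have "((\<lambda>b. cinner x (cnj (\<phi> b) *\<^sub>C b)) has_sum cinner x y) ?B"
      by (rule has_sum_bounded_linear[OF cinner.bounded_linear_right y])
    moreover have "((\<lambda>b. \<phi> (cinner x b *\<^sub>C b)) has_sum \<phi> x) ?B"
      by (rule has_sum_bounded_linear[OF bl fourier_expansion[OF some_onb]])
    ultimately show "\<phi> x = cinner x y"
      using has_sum_unique by (fastforce simp: cinner_scaleC_right scale mult.commute)
  qed
qed

lemma adj_eqI:
  assumes "\<And>x y. cinner (blinfun_apply T x) y = cinner x (blinfun_apply S y)"
  shows "adj T = S"
  unfolding adj_def
proof (rule the_equality)
  fix S' assume *: "\<forall>x y. cinner (T x) y = cinner x (blinfun_apply S' y)"
  show "S' = S"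
    by (rule blinfun_eqI, rule cinner_ext_right) (use * assms in auto)
qed (use assms in auto)

lemma adj_exists:
  fixes T :: "'a::chilbert_space \<Rightarrow>\<^sub>L 'b::chilbert_space"
  assumes T: "T \<in> bop"
  obtains S where "S \<in> bop" "\<And>x y. cinner (T x) y = cinner x (blinfun_apply S y)"
proof -
  have "\<exists>z. \<forall>x. cinner (T x) y = cinner x z" for y
  proof -
    obtain z where "\<And>x. cinner (T x) y = cinner x z"
    proof (rule riesz_representation[of "\<lambda>x. cinner (T x) y" "norm T * norm y"])
      show "cmod (cinner (T x) y) \<le> norm T * norm y * norm x" for x
      proof -
        have "cmod (cinner (T x) y) \<le> norm (T x) * norm y" by (rule norm_cinner_le)
        also have "\<dots> \<le> (norm T * norm x) * norm y" by (intro mult_right_mono norm_blinfun) simp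
        finally show ?thesis by (simp add: mult_ac)
      qed
    qed (auto simp: blinfun.add_right cinner_add_left bop_scaleC[OF T] cinner_scaleC_left)
    thus ?thesis by blast
  qed
  then obtain f where f: "\<And>x y. cinner (T x) y = cinner x (f y)" by metis
  have bd: "norm (f y) \<le> norm T * norm y" for y
  proof (cases "f y = 0")
    case False
    have "(norm (f y))\<^sup>2 = cmod (cinner (f y) (f y))" by (subst cinner_self) (simp del: of_real_power)
    also have "\<dots> = cmod (cinner (T (f y)) y)" by (simp add: f)
    also have "\<dots> \<le> norm (T (f y)) * norm y" by (rule norm_cinner_le)
    also have "\<dots> \<le> (norm T * norm (f y)) * norm y" by (intro mult_right_mono norm_blinfun) simp
    finally show ?thesis using False by (simp add: power2_eq_square mult_ac)
  qed simp
  obtain S where "S \<in> bop" "\<And>y. blinfun_apply S y = f y"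
  proof (rule bop_of_fun[of f "norm T"])
    show "f (x + y) = f x + f y" for x y
      by (rule cinner_ext_right) (simp only: f[symmetric] cinner_add_right)
    show "f (c *\<^sub>C y) = c *\<^sub>C f y" for c y
      by (rule cinner_ext_right) (simp only: f[symmetric] cinner_scaleC_right)
  qed (use bd in auto)
  thus ?thesis using that[of S] f by simp
qed

lemma
  fixes T :: "'a::chilbert_space \<Rightarrow>\<^sub>L 'b::chilbert_space"
  assumes "T \<in> bop"
  shows bop_adj [simp]: "adj T \<in> bop"
    and cinner_adj_right: "cinner x (adj T y) = cinner (T x) y"
    and cinner_adj_left: "cinner (adj T y) x = cinner y (T x)"
proof -
  obtain S where S: "S \<in> bop" "\<And>x y. cinner (T x) y = cinner x (blinfun_apply S y)"
    using adj_exists[OF assms] by blast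
  hence "adj T = S" by (intro adj_eqI) auto
  thus "adj T \<in> bop" and *: "cinner x (adj T y) = cinner (T x) y" using S by auto
  show "cinner (adj T y) x = cinner y (T x)"
    by (subst (1 2) cinner_commute) (simp add: *)
qed

lemma norm_adj_le:
  fixes T :: "'a::chilbert_space \<Rightarrow>\<^sub>L 'b::chilbert_space"
  assumes "T \<in> bop"
  shows "norm (adj T) \<le> norm T"
proof (rule norm_blinfun_bound)
  fix y
  show "norm (adj T y) \<le> norm T * norm y"
  proof (cases "adj T y = 0")
    case False
    have "(norm (adj T y))\<^sup>2 = cmod (cinner (adj T y) (adj T y))"
      by (subst cinner_self) (simp del: of_real_power)
    also have "\<dots> \<le> norm (T (adj T y)) * norm y"
      unfolding cinner_adj_right[OF assms] by (rule norm_cinner_le)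
    also have "\<dots> \<le> (norm T * norm (adj T y)) * norm y" by (intro mult_right_mono norm_blinfun) simp
    finally show ?thesis using False by (simp add: power2_eq_square mult_ac)
  qed simp
qed simp

lemma adj_compose:
  fixes S :: "'b::chilbert_space \<Rightarrow>\<^sub>L 'c::chilbert_space" and T :: "'a::chilbert_space \<Rightarrow>\<^sub>L 'b"
  assumes "S \<in> bop" "T \<in> bop"
  shows "adj (S o\<^sub>L T) = adj T o\<^sub>L adj S"
  by (rule adj_eqI) (simp add: assms cinner_adj_right)

lemma adj_adj:
  fixes T :: "'a::chilbert_space \<Rightarrow>\<^sub>L 'b::chilbert_space"
  assumes "T \<in> bop"
  shows "adj (adj T) = T"
  by (rule adj_eqI) (simp add: assms cinner_adj_left)

lemma adj_id [simp]: "adj (id_blinfun :: 'a::chilbert_space \<Rightarrow>\<^sub>L 'a) = id_blinfun"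
  by (rule adj_eqI) simp

text \<open>By polarization, an operator that preserves norms preserves inner products.\<close>
lemma adj_isometry:
  fixes V :: "'a::chilbert_space \<Rightarrow>\<^sub>L 'b::chilbert_space"
  assumes V: "V \<in> bop" and iso: "\<And>x. norm (V x) = norm x"
  shows "adj V (V x) = x"
proof -
  have pol: "inner u v = ((norm (u + v))\<^sup>2 - (norm u)\<^sup>2 - (norm v)\<^sup>2) / 2"
    for u v :: "'c::real_inner"
    by (simp add: power2_norm_eq_inner inner_add_left inner_add_right inner_commute)
  have i: "inner (V u) (V v) = inner u v" for u v
    by (simp only: pol iso blinfun.add_right[symmetric])
  have "inner (adj V (V x)) y = inner x y" for y
    using i[of x y] by (simp add: inner_eq_Re_cinner cinner_adj_left[OF V])
  hence "inner (adj V (V x) - x) y = 0" for y by (simp add: inner_diff_left)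
  hence "inner (adj V (V x) - x) (adj V (V x) - x) = 0" .
  thus ?thesis by simp
qed

section \<open>Orthogonal families of isometries\<close>

text \<open>
  A family of isometries with pairwise orthogonal ranges, i.e. \<open>W\<^sub>i\<^sup>* W\<^sub>j = \<delta>\<^sub>i\<^sub>j I\<close>. Orthonormal
  families are the case \<open>'a = complex\<close>; the larger domains allow the same lemmas to be applied to
  the slices of a tensor product and to the copies of a space inside another one.
\<close>
definition orth_family ::
  "'i set \<Rightarrow> ('i \<Rightarrow> 'a::chilbert_space \<Rightarrow>\<^sub>L 'k::chilbert_space) \<Rightarrow> bool" where
  "orth_family I W \<longleftrightarrow> (\<forall>i\<in>I. W i \<in> bop) \<and>
    (\<forall>i\<in>I. \<forall>j\<in>I. \<forall>x y. cinner (W i x) (W j y) = (if i = j then cinner x y else 0))"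

text \<open>Completeness says that the ranges span a dense subspace, so that \<open>\<Sum>\<^sub>i W\<^sub>i W\<^sub>i\<^sup>* = I\<close>.\<close>
definition complete_family ::
  "'i set \<Rightarrow> ('i \<Rightarrow> 'a::chilbert_space \<Rightarrow>\<^sub>L 'k::chilbert_space) \<Rightarrow> bool" where
  "complete_family I W \<longleftrightarrow> orth_family I W \<and>
    (\<forall>z. (\<forall>i\<in>I. \<forall>x. cinner (W i x) z = 0) \<longrightarrow> z = 0)"

lemma orth_family_bop: "orth_family I W \<Longrightarrow> i \<in> I \<Longrightarrow> W i \<in> bop"
  by (simp add: orth_family_def)

lemma orth_family_cinner:
  "orth_family I W \<Longrightarrow> i \<in> I \<Longrightarrow> j \<in> I \<Longrightarrow>
    cinner (blinfun_apply (W i) x) (blinfun_apply (W j) y) = (if i = j then cinner x y else 0)"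
  by (simp add: orth_family_def)

lemma complete_orth_family: "complete_family I W \<Longrightarrow> orth_family I W"
  by (simp add: complete_family_def)

lemma orth_family_norm:
  assumes "orth_family I W" "i \<in> I"
  shows "norm (blinfun_apply (W i) x) = norm x"
proof -
  have "complex_of_real ((norm (W i x))\<^sup>2) = complex_of_real ((norm x)\<^sup>2)"
    by (simp only: cinner_self[symmetric]) (simp add: orth_family_cinner[OF assms(1,2,2)])
  hence "(norm (W i x))\<^sup>2 = (norm x)\<^sup>2" using of_real_eq_iff by blast
  thus ?thesis by (simp add: power2_eq_iff_nonneg)
qed

lemma orth_family_adj:
  assumes "orth_family I W" "i \<in> I" "j \<in> I"
  shows "adj (W i) (blinfun_apply (W j) x) = (if i = j then x else 0)"
  by (rule cinner_ext_right)
    (simp add: cinner_adj_right[OF orth_family_bop[OF assms(1,2)]] orth_family_cinner[OF assms]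
      cinner.zero_right)

lemma orth_family_sum:
  assumes W: "orth_family I W" and h: "(\<lambda>i. (norm (h i))\<^sup>2) summable_on I"
  obtains s where "((\<lambda>i. blinfun_apply (W i) (h i)) has_sum s) I"
    "((\<lambda>i. (norm (h i))\<^sup>2) has_sum (norm s)\<^sup>2) I" "\<And>i. i \<in> I \<Longrightarrow> adj (W i) s = h i"
proof -
  have "(\<lambda>i. blinfun_apply (W i) (h i)) summable_on I"
  proof (rule orthogonal_summable)
    show "(\<lambda>i. (norm (blinfun_apply (W i) (h i)))\<^sup>2) summable_on I"
      using h by (rule summable_on_cong[THEN iffD1, rotated]) (simp add: orth_family_norm[OF W])
  qed (simp add: inner_eq_Re_cinner orth_family_cinner[OF W])
  then obtain s where s: "((\<lambda>i. blinfun_apply (W i) (h i)) has_sum s) I"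
    by (auto simp: summable_on_def)
  have a: "adj (W j) s = h j" if j: "j \<in> I" for j
  proof -
    have "((\<lambda>i. adj (W j) (W i (h i))) has_sum adj (W j) s) I"
      by (rule has_sum_bounded_linear[OF blinfun.bounded_linear_right s])
    moreover have "((\<lambda>i. adj (W j) (W i (h i))) has_sum h j) I"
      using j by (intro has_sum_finite_neutralI[of "{j}"]) (auto simp: orth_family_adj[OF W j])
    ultimately show ?thesis using has_sum_unique by blast
  qed
  have "((\<lambda>i. inner s (W i (h i))) has_sum inner s s) I"
    by (rule has_sum_bounded_linear[OF bounded_linear_inner_right s])
  moreover have "inner s (W i (h i)) = (norm (h i))\<^sup>2" if "i \<in> I" for i
    using a[OF that] by (simp add: inner_eq_Re_cinner power2_norm_eq_inner
        flip: cinner_adj_left[OF orth_family_bop[OF W that]])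
  ultimately have "((\<lambda>i. (norm (h i))\<^sup>2) has_sum inner s s) I"
    using has_sum_cong[of I "\<lambda>i. inner s (W i (h i))" "\<lambda>i. (norm (h i))\<^sup>2"] by blast
  hence "((\<lambda>i. (norm (h i))\<^sup>2) has_sum (norm s)\<^sup>2) I"
    by (simp only: power2_norm_eq_inner)
  thus ?thesis using that s a by blast
qed

lemma bessel_family:
  assumes W: "orth_family I W"
  shows "(\<lambda>i. (norm (adj (W i) x))\<^sup>2) summable_on I"
proof -
  have fin: "(\<Sum>i\<in>J. (norm (adj (W i) x))\<^sup>2) \<le> (norm x)\<^sup>2" if J: "finite J" "J \<subseteq> I" for J
  proof -
    define p where "p = (\<Sum>i\<in>J. W i (adj (W i) x))"
    have n: "(norm p)\<^sup>2 = (\<Sum>i\<in>J. (norm (adj (W i) x))\<^sup>2)"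
      unfolding p_def using J orth_family_norm[OF W]
      by (subst norm_orthogonal_sum_square)
        (auto simp: inner_eq_Re_cinner orth_family_cinner[OF W] subset_iff intro!: sum.cong)
    have "inner x p = (\<Sum>i\<in>J. inner x (W i (adj (W i) x)))"
      by (simp add: p_def inner_sum_right)
    also have "\<dots> = (\<Sum>i\<in>J. (norm (adj (W i) x))\<^sup>2)"
    proof (rule sum.cong)
      fix i assume "i \<in> J"
      hence "W i \<in> bop" using J orth_family_bop[OF W] by blast
      thus "inner x (W i (adj (W i) x)) = (norm (adj (W i) x))\<^sup>2"
        using cinner_adj_left[of "W i" x "adj (W i) x"]
        by (simp add: inner_eq_Re_cinner power2_norm_eq_inner)
    qed simp
    finally show ?thesis
      using norm_cauchy_schwarz[of x p] n by (intro le_square_of_le_mult_sqrt[of _ _ "norm p"]) auto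
  qed
  show ?thesis
    by (rule nonneg_bdd_above_summable_on) (auto intro!: bdd_aboveI2[of _ _ "(norm x)\<^sup>2"] fin)
qed

lemma
  assumes W: "complete_family I W"
  shows resolution: "((\<lambda>i. W i (adj (W i) x)) has_sum x) I"
    and parseval: "((\<lambda>i. (norm (adj (W i) x))\<^sup>2) has_sum (norm x)\<^sup>2) I"
proof -
  have o: "orth_family I W" using W by (rule complete_orth_family)
  obtain s where s: "((\<lambda>i. W i (adj (W i) x)) has_sum s) I"
    "((\<lambda>i. (norm (adj (W i) x))\<^sup>2) has_sum (norm s)\<^sup>2) I" "\<And>i. i \<in> I \<Longrightarrow> adj (W i) s = adj (W i) x"
    using orth_family_sum[OF o bessel_family[OF o, of x]] by blast
  have "cinner (W i y) (s - x) = 0" if "i \<in> I" for i y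
    using s(3)[OF that] orth_family_bop[OF o that]
    by (simp add: cinner.diff_right flip: cinner_adj_right)
  hence "s - x = 0" using W unfolding complete_family_def by blast
  hence "s = x" by simp
  with s show "((\<lambda>i. W i (adj (W i) x)) has_sum x) I" "((\<lambda>i. (norm (adj (W i) x))\<^sup>2) has_sum (norm x)\<^sup>2) I"
    by auto
qed

lemma complete_family_ext:
  assumes W: "complete_family I W"
    and eq: "\<And>i a. i \<in> I \<Longrightarrow> blinfun_apply S (W i a) = blinfun_apply T (W i a)"
  shows "S = T"
proof (rule blinfun_eqI)
  fix x
  have "((\<lambda>i. S (W i (adj (W i) x))) has_sum S x) I" "((\<lambda>i. T (W i (adj (W i) x))) has_sum T x) I"
    by (rule has_sum_bounded_linear[OF blinfun.bounded_linear_right resolution[OF W]])+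
  moreover have "((\<lambda>i. S (W i (adj (W i) x))) has_sum y) I \<longleftrightarrow> ((\<lambda>i. T (W i (adj (W i) x))) has_sum y) I" for y
    by (rule has_sum_cong) (rule eq)
  ultimately show "S x = T x" using has_sum_unique by blast
qed

text \<open>
  \<open>D = \<Sum>\<^sub>i W'\<^sub>i T W\<^sub>i\<^sup>*\<close> is a direct sum of copies of \<open>T\<close>, and its norm is controlled by Parseval's
  identity. Tensor products of operators, the free shift and the embeddings of the Fock space are
  all obtained in this way.
\<close>
lemma diagonal_operator:
  fixes W :: "'i \<Rightarrow> 'a::chilbert_space \<Rightarrow>\<^sub>L 'k::chilbert_space"
    and W' :: "'i \<Rightarrow> 'b::chilbert_space \<Rightarrow>\<^sub>L 'l::chilbert_space"
  assumes W: "complete_family I W" and W': "orth_family I W'" and T: "T \<in> bop"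
  obtains D where "D \<in> bop" "\<And>i a. i \<in> I \<Longrightarrow> blinfun_apply D (W i a) = W' i (T a)"
    "norm D \<le> norm T"
proof -
  have o: "orth_family I W" using W by (rule complete_orth_family)
  have sq: "(norm (T (adj (W i) x)))\<^sup>2 \<le> (norm T)\<^sup>2 * (norm (adj (W i) x))\<^sup>2" for i x
    unfolding power_mult_distrib[symmetric] by (intro power_mono norm_blinfun) simp
  have sm: "(\<lambda>i. (norm (T (adj (W i) x)))\<^sup>2) summable_on I" for x
    by (rule summable_on_comparison_test[OF summable_on_cmult_right[OF bessel_family[OF o]]])
      (use sq in auto)
  have "\<exists>s. ((\<lambda>i. W' i (T (adj (W i) x))) has_sum s) I \<and>
      ((\<lambda>i. (norm (T (adj (W i) x)))\<^sup>2) has_sum (norm s)\<^sup>2) I" for x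
    by (rule orth_family_sum[OF W' sm[of x]]) blast
  hence "\<exists>f. \<forall>x. ((\<lambda>i. W' i (T (adj (W i) x))) has_sum f x) I \<and>
      ((\<lambda>i. (norm (T (adj (W i) x)))\<^sup>2) has_sum (norm (f x))\<^sup>2) I"
    by (intro choice allI)
  then obtain f where f: "\<And>x. ((\<lambda>i. W' i (T (adj (W i) x))) has_sum f x) I"
    "\<And>x. ((\<lambda>i. (norm (T (adj (W i) x)))\<^sup>2) has_sum (norm (f x))\<^sup>2) I" by blast
  have bd: "norm (f x) \<le> norm T * norm x" for x
  proof -
    have "(norm (f x))\<^sup>2 \<le> (norm T)\<^sup>2 * (norm x)\<^sup>2"
      by (rule has_sum_mono[OF f(2) has_sum_cmult_right[OF parseval[OF W]]]) (rule sq)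
    thus ?thesis by (simp add: power_mult_distrib[symmetric] power2_le_iff_abs_le abs_mult)
  qed
  obtain D where D: "D \<in> bop" "\<And>x. blinfun_apply D x = f x"
  proof (rule bop_of_fun[of f "norm T"])
    show "f (x + y) = f x + f y" for x y
      using has_sum_unique[OF f(1)[of "x + y"]] has_sum_add[OF f(1)[of x] f(1)[of y]]
      by (simp add: blinfun.add_right)
    show "f (c *\<^sub>C x) = c *\<^sub>C f x" for c x
    proof (rule has_sum_unique[OF f(1)[of "c *\<^sub>C x"]])
      show "((\<lambda>i. W' i (T (adj (W i) (c *\<^sub>C x)))) has_sum c *\<^sub>C f x) I"
        using has_sum_bounded_linear[OF bounded_linear_scaleC f(1), of c x]
        by (rule has_sum_cong[THEN iffD1, rotated])
          (simp add: bop_scaleC T orth_family_bop[OF o] orth_family_bop[OF W'])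
    qed
  qed (use bd in auto)
  show ?thesis
  proof (rule that[OF D(1)])
    show "D (W j a) = W' j (T a)" if j: "j \<in> I" for j a
    proof (rule has_sum_unique)
      show "((\<lambda>i. W' i (T (adj (W i) (W j a)))) has_sum D (W j a)) I" unfolding D(2) by (rule f(1))
      show "((\<lambda>i. W' i (T (adj (W i) (W j a)))) has_sum W' j (T a)) I"
        using j by (intro has_sum_finite_neutralI[of "{j}"]) (auto simp: orth_family_adj[OF o])
    qed
    show "norm D \<le> norm T" by (rule norm_blinfun_bound) (simp_all add: D(2) bd)
  qed
qed

section \<open>Positive operators: invertibility and square roots\<close>

lemma norm_diff_square: "(norm (x - y))\<^sup>2 = (norm x)\<^sup>2 - 2 * inner y x + (norm y)\<^sup>2"
  for x y :: "'a::real_inner"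
  by (simp add: power2_norm_eq_inner inner_diff_left inner_diff_right inner_commute)

text \<open>
  For small \<open>t > 0\<close> the operator \<open>I - tT\<close> is a strict contraction, so \<open>T x = y\<close> is solved by
  iterating \<open>x \<mapsto> x - t (T x - y)\<close>.
\<close>
lemma bounded_below_imp_invertible_op:
  fixes T :: "'a::chilbert_space \<Rightarrow>\<^sub>L 'a"
  assumes T: "T \<in> bop" and "\<gamma> > 0" and low: "\<And>x. \<gamma> * (norm x)\<^sup>2 \<le> inner (T x) x"
  shows "invertible_op T"
proof -
  \<comment> \<open>\<open>\<parallel>(I - tT) x\<parallel>\<^sup>2 \<le> (1 - 2 t \<gamma> + t\<^sup>2 N\<^sup>2) \<parallel>x\<parallel>\<^sup>2\<close> is smallest at \<open>t = \<gamma>/N\<^sup>2\<close>; adding \<open>\<gamma>\<close> to the norm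
    keeps \<open>N\<close> positive and at least \<open>\<gamma>\<close>.\<close>
  define N where "N = norm T + \<gamma>"
  define t where "t = \<gamma> / N\<^sup>2"
  define c where "c = sqrt (1 - \<gamma>\<^sup>2 / N\<^sup>2)"
  have N: "N > 0" "norm T \<le> N" "\<gamma> \<le> N" using \<open>\<gamma> > 0\<close> by (auto simp: N_def add_nonneg_pos)
  hence "t > 0" using \<open>\<gamma> > 0\<close> by (simp add: t_def)
  have "\<gamma>\<^sup>2 \<le> N\<^sup>2" using N \<open>\<gamma> > 0\<close> by (intro power_mono) auto
  hence c: "0 \<le> c" "c < 1" "c\<^sup>2 = 1 - \<gamma>\<^sup>2 / N\<^sup>2" using N \<open>\<gamma> > 0\<close> by (auto simp: c_def)
  have contr: "norm (x - t *\<^sub>R T x) \<le> c * norm x" for x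
  proof -
    have "norm (T x) \<le> N * norm x"
      using norm_blinfun[of T x] mult_right_mono[OF N(2) norm_ge_zero[of x]] by linarith
    hence "(norm (T x))\<^sup>2 \<le> N\<^sup>2 * (norm x)\<^sup>2"
      using power_mono[of "norm (T x)" "N * norm x" 2] by (simp add: power_mult_distrib)
    hence "t\<^sup>2 * (norm (T x))\<^sup>2 \<le> t\<^sup>2 * (N\<^sup>2 * (norm x)\<^sup>2)" by (intro mult_left_mono) auto
    moreover have "t * (\<gamma> * (norm x)\<^sup>2) \<le> t * inner (T x) x"
      using low[of x] \<open>t > 0\<close> by (intro mult_left_mono) auto
    moreover have "(norm (x - t *\<^sub>R T x))\<^sup>2 = (norm x)\<^sup>2 - 2 * (t * inner (T x) x) + t\<^sup>2 * (norm (T x))\<^sup>2"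
      using norm_diff_square[of x "t *\<^sub>R T x"] by (simp add: power_mult_distrib)
    moreover have "t\<^sup>2 * (N\<^sup>2 * (norm x)\<^sup>2) = t * (\<gamma> * (norm x)\<^sup>2)"
      using N by (simp add: t_def power2_eq_square)
    moreover have "t * (\<gamma> * (norm x)\<^sup>2) = \<gamma>\<^sup>2 / N\<^sup>2 * (norm x)\<^sup>2"
      by (simp add: t_def power2_eq_square)
    ultimately have "(norm (x - t *\<^sub>R T x))\<^sup>2 \<le> (norm x)\<^sup>2 - \<gamma>\<^sup>2 / N\<^sup>2 * (norm x)\<^sup>2" by linarith
    also have "\<dots> = (c * norm x)\<^sup>2" by (simp add: power_mult_distrib c(3) algebra_simps)
    finally show ?thesis using c(1) by (simp add: power2_le_iff_abs_le)
  qed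
  have "\<exists>x. T x = y" for y
  proof -
    have "\<exists>!x. (\<lambda>x. x - t *\<^sub>R (T x - y)) x = x"
    proof (rule banach_fix_type[OF c(1,2)], intro allI)
      fix x x'
      have "x - t *\<^sub>R (T x - y) - (x' - t *\<^sub>R (T x' - y)) = (x - x') - t *\<^sub>R T (x - x')"
        by (simp add: blinfun.diff_right scaleR_diff_right)
      thus "dist (x - t *\<^sub>R (T x - y)) (x' - t *\<^sub>R (T x' - y)) \<le> c * dist x x'"
        using contr[of "x - x'"] by (simp only: dist_norm)
    qed
    then obtain x where "t *\<^sub>R (T x - y) = 0" by auto
    thus ?thesis using \<open>t > 0\<close> by auto
  qed
  then obtain S where S: "\<And>y. T (S y) = y" by metis
  have low': "\<gamma> * norm x \<le> norm (T x)" for x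
  proof (cases "x = 0")
    case False
    have "\<gamma> * (norm x)\<^sup>2 \<le> norm (T x) * norm x" using low[of x] norm_cauchy_schwarz[of "T x" x] by linarith
    thus ?thesis using False by (simp add: power2_eq_square)
  qed simp
  have inj: "x = y" if "T x = T y" for x y
    using low'[of "x - y"] that \<open>\<gamma> > 0\<close> by (simp add: blinfun.diff_right mult_le_0_iff)
  obtain R where R: "R \<in> bop" "\<And>y. blinfun_apply R y = S y"
  proof (rule bop_of_fun[of S "1 / \<gamma>"])
    show "norm (S x) \<le> 1 / \<gamma> * norm x" for x
      using low'[of "S x"] \<open>\<gamma> > 0\<close> by (simp add: S field_simps)
    show "S (x + y) = S x + S y" for x y by (rule inj) (simp add: S blinfun.add_right)
    show "S (c *\<^sub>C x) = c *\<^sub>C S x" for c x by (rule inj) (simp add: S bop_scaleC[OF T])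
  qed auto
  show ?thesis unfolding invertible_op_def
    by (intro bexI[of _ R] R(1) conjI blinfun_eqI) (simp_all add: R S inj)
qed

text \<open>
  Positivity at \<open>M x - T x\<close> with \<open>M > \<parallel>T\<parallel>\<close> gives \<open>\<parallel>T x\<parallel>\<^sup>2 \<le> M \<langle>T x, x\<rangle>\<close>, and invertibility bounds
  \<open>\<parallel>T x\<parallel>\<close> below by a multiple of \<open>\<parallel>x\<parallel>\<close>.
\<close>
lemma invertible_op_imp_bounded_below:
  fixes T :: "'a::chilbert_space \<Rightarrow>\<^sub>L 'a"
  assumes sym: "\<And>x y. inner (T x) y = inner x (T y)" and pos: "\<And>x. 0 \<le> inner (T x) x"
    and inv: "invertible_op T"
  obtains \<gamma> where "\<gamma> > 0" "\<And>x. \<gamma> * (norm x)\<^sup>2 \<le> inner (T x) x"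
proof -
  obtain S where S: "S o\<^sub>L T = id_blinfun" using inv by (auto simp: invertible_op_def)
  define M where "M = norm T + 1"
  have M: "M > 0" by (simp add: M_def add_nonneg_pos)
  have TT: "(norm (T x))\<^sup>2 \<le> M * inner (T x) x" for x
  proof -
    have "inner (T (T x)) (T x) \<le> norm T * norm (T x) * norm (T x)"
      using norm_cauchy_schwarz[of "T (T x)" "T x"] mult_right_mono[OF norm_blinfun[of T "T x"] norm_ge_zero[of "T x"]]
      by linarith
    also have "\<dots> \<le> M * (norm (T x))\<^sup>2" by (simp add: M_def power2_eq_square algebra_simps)
    finally have a: "inner (T (T x)) (T x) \<le> M * (norm (T x))\<^sup>2" .
    have "0 \<le> inner (T (M *\<^sub>R x - T x)) (M *\<^sub>R x - T x)" by (rule pos)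
    also have "\<dots> = M\<^sup>2 * inner (T x) x - 2 * M * (norm (T x))\<^sup>2 + inner (T (T x)) (T x)"
    proof -
      have "inner (T (T x)) x = (norm (T x))\<^sup>2" by (simp add: sym power2_norm_eq_inner)
      thus ?thesis
        by (simp add: blinfun.diff_right blinfun.scaleR_right inner_diff_left inner_diff_right
            power2_norm_eq_inner) (simp add: power2_eq_square algebra_simps)
    qed
    finally have "0 \<le> M * (M * inner (T x) x - (norm (T x))\<^sup>2)"
      using a by (simp add: power2_eq_square algebra_simps)
    thus ?thesis using M by (simp add: zero_le_mult_iff)
  qed
  define K where "K = (norm S)\<^sup>2 * M + 1"
  have K: "K > 0" using M by (simp add: K_def add_nonneg_pos)
  have "(norm x)\<^sup>2 \<le> K * inner (T x) x" for x
  proof -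
    have "S (T x) = x" using S by (metis blinfun_apply_blinfun_compose id_blinfun.rep_eq id_apply)
    hence "norm x \<le> norm S * norm (T x)" using norm_blinfun[of S "T x"] by simp
    hence "(norm x)\<^sup>2 \<le> (norm S)\<^sup>2 * (norm (T x))\<^sup>2"
      using power_mono[of "norm x" "norm S * norm (T x)" 2] by (simp add: power_mult_distrib)
    also have "\<dots> \<le> (norm S)\<^sup>2 * (M * inner (T x) x)" by (intro mult_left_mono TT) simp
    finally show ?thesis using pos[of x] by (simp add: K_def algebra_simps)
  qed
  thus ?thesis using K that[of "1 / K"] by (simp add: field_simps)
qed

text \<open>
  The square root of \<open>I - T\<close> is \<open>I - Z\<close>, where \<open>Z\<close> solves \<open>Z = (T + Z\<^sup>2)/2\<close>. As \<open>\<parallel>T\<parallel> < 1\<close>, the right-hand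
  side is a contraction of the complete set of selfadjoint operators of norm at most \<open>\<parallel>T\<parallel>\<close>.
\<close>
lemma sqrt_one_minus:
  fixes T :: "'a::chilbert_space \<Rightarrow>\<^sub>L 'a"
  assumes T: "T \<in> bop" and sym: "\<And>x y. cinner (T x) y = cinner x (T y)" and lt: "norm T < 1"
  obtains D where "D \<in> bop" "\<And>x y. cinner (blinfun_apply D x) y = cinner x (D y)"
    "\<And>x. D (D x) = x - T x"
proof -
  define s :: "('a \<Rightarrow>\<^sub>L 'a) set" where
    "s = {Z. Z \<in> bop \<and> (\<forall>x y. cinner (blinfun_apply Z x) y = cinner x (Z y)) \<and> norm Z \<le> norm T}"
  define f :: "('a \<Rightarrow>\<^sub>L 'a) \<Rightarrow> ('a \<Rightarrow>\<^sub>L 'a)" where "f Z = (1/2) *\<^sub>R (T + (Z o\<^sub>L Z))" for Z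
  have "closed s"
  proof -
    have "s = (\<Inter>c. \<Inter>x. {Z. blinfun_apply Z (c *\<^sub>C x) = c *\<^sub>C Z x}) \<inter>
        ((\<Inter>x. \<Inter>y. {Z. cinner (blinfun_apply Z x) y = cinner x (Z y)}) \<inter> {Z. norm Z \<le> norm T})"
      by (auto simp: s_def bop_def)
    also have "closed \<dots>"
      by (intro closed_Int closed_INT ballI closed_Collect_eq closed_Collect_le continuous_intros
          bounded_linear.continuous_on[OF bounded_linear_scaleC]
          bounded_linear.continuous_on[OF cinner.bounded_linear_left]
          bounded_linear.continuous_on[OF cinner.bounded_linear_right])
    finally show ?thesis .
  qed
  hence "complete s" by (simp add: complete_eq_closed)
  moreover have "T \<in> s" using T sym by (simp add: s_def)
  moreover have "f ` s \<subseteq> s"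
  proof
    fix W assume "W \<in> f ` s"
    then obtain Z where Z: "Z \<in> s" "W = f Z" by auto
    hence Zs: "\<And>x y. cinner (Z x) y = cinner x (Z y)" and Zb: "Z \<in> bop" and Zn: "norm Z \<le> norm T"
      by (auto simp: s_def)
    have "norm (Z o\<^sub>L Z) \<le> norm Z * norm Z" by (rule norm_blinfun_compose)
    also have "\<dots> \<le> norm T * 1" using Zn lt by (intro mult_mono) auto
    finally have "norm (T + (Z o\<^sub>L Z)) \<le> 2 * norm T"
      using norm_triangle_ineq[of T "Z o\<^sub>L Z"] by linarith
    hence "norm W \<le> norm T" by (simp add: Z f_def)
    moreover have "W \<in> bop" by (simp add: Z f_def T Zb)
    moreover have "cinner (W x) y = cinner x (W y)" for x y
      by (simp add: Z f_def blinfun.scaleR_left blinfun.add_left cinner.scaleR_left cinner.scaleR_right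
          cinner_add_left cinner_add_right sym Zs)
    ultimately show "W \<in> s" by (simp add: s_def)
  qed
  moreover have "dist (f Y) (f Z) \<le> norm T * dist Y Z" if "Y \<in> s" "Z \<in> s" for Y Z
  proof -
    have n: "norm Y \<le> norm T" "norm Z \<le> norm T" using that by (auto simp: s_def)
    have "f Y - f Z = (1/2) *\<^sub>R ((Y o\<^sub>L (Y - Z)) + ((Y - Z) o\<^sub>L Z))"
      by (rule blinfun_eqI) (simp add: f_def blinfun.bilinear_simps algebra_simps)
    hence "2 * dist (f Y) (f Z) = norm ((Y o\<^sub>L (Y - Z)) + ((Y - Z) o\<^sub>L Z))" by (simp add: dist_norm)
    also have "\<dots> \<le> norm (Y o\<^sub>L (Y - Z)) + norm ((Y - Z) o\<^sub>L Z)" by (rule norm_triangle_ineq)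
    also have "\<dots> \<le> norm Y * norm (Y - Z) + norm (Y - Z) * norm Z"
      by (intro add_mono norm_blinfun_compose)
    also have "\<dots> \<le> norm T * norm (Y - Z) + norm (Y - Z) * norm T"
      using n by (intro add_mono mult_mono) auto
    finally show ?thesis by (simp add: dist_norm mult_ac)
  qed
  ultimately have "\<exists>!Z. Z \<in> s \<and> f Z = Z"
    using lt by (intro Banach_fix[of s "norm T" f]) auto
  then obtain Z where Z: "Z \<in> s" "f Z = Z" by blast
  have "T x + Z (Z x) = 2 *\<^sub>R Z x" for x
    using arg_cong[OF Z(2), of "\<lambda>W. 2 *\<^sub>R blinfun_apply W x"]
    by (simp add: f_def blinfun.scaleR_left blinfun.add_left)
  hence "(id_blinfun - Z) ((id_blinfun - Z) x) = x - T x" for x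
    by (simp add: blinfun.bilinear_simps scaleR_2 algebra_simps)
  moreover have "cinner ((id_blinfun - Z) x) y = cinner x ((id_blinfun - Z) y)" for x y
    using Z(1) by (simp add: s_def blinfun.diff_left cinner.diff_left cinner.diff_right)
  moreover have "id_blinfun - Z \<in> bop" using Z(1) by (simp add: s_def)
  ultimately show ?thesis using that by blast
qed

section \<open>Tensor products of operators\<close>

text \<open>A vector as an operator from the scalars, so that orthonormal families become isometries.\<close>
lift_definition ray :: "'a::complex_inner \<Rightarrow> complex \<Rightarrow>\<^sub>L 'a" is "\<lambda>x c. c *\<^sub>C x"
  by (rule bounded_linear_intro[where K = "norm x" for x])
    (auto simp: scaleC_add_left scaleR_scaleC scaleC_scaleC scaleC_complex_def)

lemma ray_bop [simp]: "ray x \<in> bop"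
  by (simp add: bop_def ray.rep_eq scaleC_complex_def scaleC_scaleC)

lemma orth_family_ray:
  assumes "\<And>i j. i \<in> I \<Longrightarrow> j \<in> I \<Longrightarrow> cinner (u i) (u j) = (if i = j then 1 else 0)"
  shows "orth_family I (\<lambda>i. ray (u i))"
  using assms
  by (auto simp: orth_family_def ray.rep_eq cinner_scaleC_left cinner_scaleC_right cinner_complex_def)

lemma complete_family_ray:
  assumes "\<And>i j. i \<in> I \<Longrightarrow> j \<in> I \<Longrightarrow> cinner (u i) (u j) = (if i = j then 1 else 0)"
    and "\<And>z. (\<And>i. i \<in> I \<Longrightarrow> cinner (u i) z = 0) \<Longrightarrow> z = 0"
  shows "complete_family I (\<lambda>i. ray (u i))"
  unfolding complete_family_def
proof (intro conjI allI impI)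
  fix z assume *: "\<forall>i\<in>I. \<forall>x. cinner (ray (u i) x) z = 0"
  show "z = 0"
  proof (rule assms(2))
    fix i assume "i \<in> I"
    with * have "cinner (ray (u i) 1) z = 0" by blast
    thus "cinner (u i) z = 0" by (simp add: ray.rep_eq)
  qed
qed (rule orth_family_ray[OF assms(1)])

lemma orthonormal_basis_total:
  fixes z :: "'a::chilbert_space"
  assumes "orthonormal_basis B" "\<And>b. b \<in> B \<Longrightarrow> cinner b z = 0"
  shows "z = 0"
proof -
  have "cinner z b = 0" if "b \<in> B" for b using assms(2)[OF that] cinner_commute[of z b] by simp
  hence "((\<lambda>b. 0) has_sum z) B"
    using fourier_expansion[OF assms(1), of z] by (simp cong: has_sum_cong)
  thus ?thesis by (rule has_sum_unique) (simp add: has_sum_0)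
qed

lemma complete_family_onb: "complete_family (some_onb :: 'a::chilbert_space set) ray"
  using orthonormal_basis_total[OF some_onb] orthonormal_some_onb
  by (intro complete_family_ray[where u = "\<lambda>b. b"]) (auto simp: orthonormal_def)

lemma norm_tensor: "norm (h \<otimes> k) = norm h * norm k"
proof -
  have "complex_of_real ((norm (h \<otimes> k))\<^sup>2) = complex_of_real ((norm h * norm k)\<^sup>2)"
    by (simp only: cinner_self[symmetric] cinner_tensor) (simp add: cinner_self power_mult_distrib)
  hence "(norm (h \<otimes> k))\<^sup>2 = (norm h * norm k)\<^sup>2" using of_real_eq_iff by blast
  thus ?thesis by (simp add: power2_eq_iff_nonneg)
qed

lemma tensor_zero_left: "0 \<otimes> k = 0"
  using norm_tensor[of 0 k] by simp

lift_definition tensor_left :: "'a::chilbert_space \<Rightarrow> 'b::complex_inner \<Rightarrow>\<^sub>L ('a, 'b) htensor"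
  is "\<lambda>h k. h \<otimes> k"
proof -
  fix h :: 'a
  show "bounded_linear (\<lambda>k :: 'b. h \<otimes> k)"
    by (rule bounded_linear_intro[of _ "norm h"])
      (auto simp: tensor_add_right scaleR_scaleC tensor_scaleC_right norm_tensor)
qed

lift_definition tensor_right :: "'b::complex_inner \<Rightarrow> 'a::chilbert_space \<Rightarrow>\<^sub>L ('a, 'b) htensor"
  is "\<lambda>k h. h \<otimes> k"
proof -
  fix k :: 'b
  show "bounded_linear (\<lambda>h :: 'a. h \<otimes> k)"
    by (rule bounded_linear_intro[of _ "norm k"])
      (auto simp: tensor_add_left scaleR_scaleC tensor_scaleC_left norm_tensor)
qed

lemma tensor_left_bop [simp]: "tensor_left h \<in> bop"
  by (simp add: bop_def tensor_left.rep_eq tensor_scaleC_right)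

lemma tensor_right_bop [simp]: "tensor_right k \<in> bop"
  by (simp add: bop_def tensor_right.rep_eq tensor_scaleC_left)

lemma bop_tensor_ext:
  fixes R R' :: "('a::chilbert_space, 'b::chilbert_space) htensor \<Rightarrow>\<^sub>L 'c::complex_inner"
  assumes "R \<in> bop" "R' \<in> bop" and eq: "\<And>h k. blinfun_apply R (h \<otimes> k) = blinfun_apply R' (h \<otimes> k)"
  shows "R = R'"
proof -
  have sp: "R y = R' y" if "y \<in> complex_vector.span {h \<otimes> k | h k. True}" for y
    using that
    by (induction rule: complex_vector.span_induct_alt)
      (auto simp: blinfun.add_right bop_scaleC assms)
  have "closed {y. R y = R' y}"
    by (intro closed_Collect_eq continuous_intros)
  hence "closure (complex_vector.span {h \<otimes> k | h k. True}) \<subseteq> {y. R y = R' y}"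
    by (intro closure_minimal) (auto simp: sp)
  thus ?thesis using tensor_total[where ?'a = 'a and ?'b = 'b] by (intro blinfun_eqI) auto
qed

lemma tensor_zeroI:
  fixes z :: "('a::chilbert_space, 'b::chilbert_space) htensor"
  assumes "\<And>h k. cinner (h \<otimes> k) z = 0"
  shows "z = 0"
proof -
  have "adj (ray z) = 0"
  proof (rule bop_tensor_ext)
    show "adj (ray z) (h \<otimes> k) = blinfun_apply 0 (h \<otimes> k)" for h k
    proof (rule cinner_ext_left)
      show "cinner (adj (ray z) (h \<otimes> k)) c = cinner (blinfun_apply 0 (h \<otimes> k)) c" for c
        using assms[of h k] by (simp add: cinner_adj_left ray.rep_eq cinner_scaleC_right cinner.zero_left)
    qed
    show "(0 :: ('a, 'b) htensor \<Rightarrow>\<^sub>L complex) \<in> bop" by (simp add: bop_def)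
  qed simp
  hence "cinner (adj (ray z) z) 1 = 0" by (simp add: cinner.zero_left)
  hence "cinner z z = 0" by (simp add: cinner_adj_left ray.rep_eq)
  thus ?thesis by (simp add: cinner_self)
qed

text \<open>
  The slices \<open>k \<mapsto> b \<otimes> k\<close> and \<open>h \<mapsto> h \<otimes> c\<close> for basis vectors \<open>b\<close> and \<open>c\<close> decompose the tensor product
  in two ways.
\<close>
lemma complete_family_tensor_left:
  "complete_family some_onb (tensor_left :: 'a \<Rightarrow> 'b::chilbert_space \<Rightarrow>\<^sub>L ('a::chilbert_space, 'b) htensor)"
  unfolding complete_family_def orth_family_def
proof (intro conjI allI impI ballI)
  fix b c :: 'a and x y :: 'b assume "b \<in> some_onb" "c \<in> some_onb"
  thus "cinner (tensor_left b x) (tensor_left c y) = (if b = c then cinner x y else 0)"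
    using orthonormal_some_onb[where ?'a = 'a]
    by (auto simp: tensor_left.rep_eq cinner_tensor orthonormal_def)
next
  fix z :: "('a, 'b) htensor"
  assume z: "\<forall>b\<in>some_onb. \<forall>x. cinner (tensor_left b x) z = 0"
  show "z = 0"
  proof (rule tensor_zeroI)
    fix h :: 'a and k :: 'b
    have "adj (tensor_right k) z = 0"
    proof (rule orthonormal_basis_total[OF some_onb])
      fix b :: 'a assume "b \<in> some_onb"
      thus "cinner b (adj (tensor_right k) z) = 0"
        using z by (simp add: cinner_adj_right tensor_right.rep_eq tensor_left.rep_eq)
    qed
    hence "cinner h (adj (tensor_right k) z) = 0" by (simp add: cinner.zero_right)
    thus "cinner (h \<otimes> k) z = 0" by (simp add: cinner_adj_right tensor_right.rep_eq)
  qed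
qed simp

lemma complete_family_tensor_right:
  "complete_family some_onb (tensor_right :: 'b \<Rightarrow> 'a::chilbert_space \<Rightarrow>\<^sub>L ('a, 'b::chilbert_space) htensor)"
  unfolding complete_family_def orth_family_def
proof (intro conjI allI impI ballI)
  fix b c :: 'b and x y :: 'a assume "b \<in> some_onb" "c \<in> some_onb"
  thus "cinner (tensor_right b x) (tensor_right c y) = (if b = c then cinner x y else 0)"
    using orthonormal_some_onb[where ?'a = 'b]
    by (auto simp: tensor_right.rep_eq cinner_tensor orthonormal_def)
next
  fix z :: "('a, 'b) htensor"
  assume z: "\<forall>b\<in>some_onb. \<forall>x. cinner (tensor_right b x) z = 0"
  show "z = 0"
  proof (rule tensor_zeroI)
    fix h :: 'a and k :: 'b
    have "adj (tensor_left h) z = 0"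
    proof (rule orthonormal_basis_total[OF some_onb])
      fix b :: 'b assume "b \<in> some_onb"
      thus "cinner b (adj (tensor_left h) z) = 0"
        using z by (simp add: cinner_adj_right tensor_right.rep_eq tensor_left.rep_eq)
    qed
    hence "cinner k (adj (tensor_left h) z) = 0" by (simp add: cinner.zero_right)
    thus "cinner (h \<otimes> k) z = 0" by (simp add: cinner_adj_right tensor_left.rep_eq)
  qed
qed simp

text \<open>
  \<open>S \<otimes> T = (S \<otimes> I) (I \<otimes> T)\<close>, and each factor is diagonal with respect to one of the two
  decompositions into slices. This also yields \<open>\<parallel>S \<otimes> T\<parallel> \<le> \<parallel>S\<parallel> \<parallel>T\<parallel>\<close>.
\<close>
lemma tensor_op_exists:
  fixes S :: "'a::chilbert_space \<Rightarrow>\<^sub>L 'c::chilbert_space" and T :: "'b::chilbert_space \<Rightarrow>\<^sub>L 'd::chilbert_space"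
  assumes S: "S \<in> bop" and T: "T \<in> bop"
  obtains R where "R \<in> bop" "\<And>h k. blinfun_apply R (h \<otimes> k) = S h \<otimes> T k" "norm R \<le> norm S * norm T"
proof -
  obtain D1 :: "('a, 'b) htensor \<Rightarrow>\<^sub>L ('a, 'd) htensor" where D1: "D1 \<in> bop"
    "\<And>b k. b \<in> some_onb \<Longrightarrow> D1 (tensor_left b k) = tensor_left b (T k)" "norm D1 \<le> norm T"
    by (rule diagonal_operator[OF complete_family_tensor_left complete_orth_family[OF complete_family_tensor_left] T]) blast
  obtain D2 :: "('a, 'd) htensor \<Rightarrow>\<^sub>L ('c, 'd) htensor" where D2: "D2 \<in> bop"
    "\<And>b k. b \<in> some_onb \<Longrightarrow> D2 (tensor_right b k) = tensor_right b (S k)" "norm D2 \<le> norm S"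
    by (rule diagonal_operator[OF complete_family_tensor_right complete_orth_family[OF complete_family_tensor_right] S]) blast
  have a1: "D1 (h \<otimes> k) = h \<otimes> T k" for h k
  proof -
    have "D1 o\<^sub>L tensor_right k = tensor_right (T k)"
      by (rule complete_family_ext[OF complete_family_onb])
        (use D1(2) in \<open>simp add: ray.rep_eq tensor_right.rep_eq tensor_left.rep_eq tensor_scaleC_left
          bop_scaleC[OF D1(1)]\<close>)
    from arg_cong[OF this, of "\<lambda>R. blinfun_apply R h"] show ?thesis by (simp add: tensor_right.rep_eq)
  qed
  have a2: "D2 (h \<otimes> k) = S h \<otimes> k" for h k
  proof -
    have "D2 o\<^sub>L tensor_left h = tensor_left (S h)"
      by (rule complete_family_ext[OF complete_family_onb])
        (use D2(2) in \<open>simp add: ray.rep_eq tensor_right.rep_eq tensor_left.rep_eq tensor_scaleC_right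
          bop_scaleC[OF D2(1)]\<close>)
    from arg_cong[OF this, of "\<lambda>R. blinfun_apply R k"] show ?thesis by (simp add: tensor_left.rep_eq)
  qed
  show ?thesis
  proof (rule that[of "D2 o\<^sub>L D1"])
    show "norm (D2 o\<^sub>L D1) \<le> norm S * norm T"
      using norm_blinfun_compose[of D2 D1] mult_mono[OF D2(3) D1(3)] by simp
  qed (simp_all add: D1 D2 a1 a2)
qed

lemma tensor_op_eqI:
  fixes S :: "'a::chilbert_space \<Rightarrow>\<^sub>L 'c::chilbert_space" and T :: "'b::chilbert_space \<Rightarrow>\<^sub>L 'd::chilbert_space"
  assumes "R \<in> bop" "\<And>h k. blinfun_apply R (h \<otimes> k) = S h \<otimes> T k"
  shows "tensor_op S T = R"
  unfolding tensor_op_def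
proof (rule the_equality)
  fix R' assume "R' \<in> bop \<and> (\<forall>h k. blinfun_apply R' (h \<otimes> k) = S h \<otimes> T k)"
  thus "R' = R" by (intro bop_tensor_ext) (simp_all add: assms)
qed (use assms in auto)

lemma
  fixes S :: "'a::chilbert_space \<Rightarrow>\<^sub>L 'c::chilbert_space" and T :: "'b::chilbert_space \<Rightarrow>\<^sub>L 'd::chilbert_space"
  assumes "S \<in> bop" and "T \<in> bop"
  shows tensor_op_bop [simp]: "tensor_op S T \<in> bop"
    and tensor_op_tensor: "tensor_op S T (h \<otimes> k) = S h \<otimes> T k"
    and norm_tensor_op_le: "norm (tensor_op S T) \<le> norm S * norm T"
proof -
  obtain R where R: "R \<in> bop" "\<And>h k. blinfun_apply R (h \<otimes> k) = S h \<otimes> T k" "norm R \<le> norm S * norm T"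
    using tensor_op_exists[OF assms] by blast
  hence "tensor_op S T = R" by (intro tensor_op_eqI) auto
  with R show "tensor_op S T \<in> bop" "tensor_op S T (h \<otimes> k) = S h \<otimes> T k"
    "norm (tensor_op S T) \<le> norm S * norm T" by auto
qed

lemma blinfun_compose_id [simp]: "T o\<^sub>L id_blinfun = T" "id_blinfun o\<^sub>L T = T"
  by (auto intro: blinfun_eqI)

lemma tensor_op_compose:
  fixes S :: "'c::chilbert_space \<Rightarrow>\<^sub>L 'p::chilbert_space" and T :: "'d::chilbert_space \<Rightarrow>\<^sub>L 'q::chilbert_space"
    and S' :: "'a::chilbert_space \<Rightarrow>\<^sub>L 'c" and T' :: "'b::chilbert_space \<Rightarrow>\<^sub>L 'd"
  assumes "S \<in> bop" "T \<in> bop" "S' \<in> bop" "T' \<in> bop"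
  shows "tensor_op S T o\<^sub>L tensor_op S' T' = tensor_op (S o\<^sub>L S') (T o\<^sub>L T')"
  by (rule tensor_op_eqI[symmetric]) (simp_all add: assms tensor_op_tensor)

lemma tensor_op_id [simp]:
  "tensor_op (id_blinfun :: 'a::chilbert_space \<Rightarrow>\<^sub>L 'a) (id_blinfun :: 'b::chilbert_space \<Rightarrow>\<^sub>L 'b) = id_blinfun"
  by (rule tensor_op_eqI) simp_all

lemma adj_tensor_op:
  fixes S :: "'a::chilbert_space \<Rightarrow>\<^sub>L 'c::chilbert_space" and T :: "'b::chilbert_space \<Rightarrow>\<^sub>L 'd::chilbert_space"
  assumes S: "S \<in> bop" and T: "T \<in> bop"
  shows "adj (tensor_op S T) = tensor_op (adj S) (adj T)"
proof (rule bop_tensor_ext)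
  fix h k
  show "adj (tensor_op S T) (h \<otimes> k) = tensor_op (adj S) (adj T) (h \<otimes> k)" (is "?l = ?r")
  proof -
    have "?l - ?r = 0"
      by (rule tensor_zeroI)
        (simp add: assms cinner.diff_right cinner_adj_right tensor_op_tensor cinner_tensor)
    thus ?thesis by simp
  qed
qed (simp_all add: assms)

lemma complete_family_tensor_op:
  fixes W :: "'i \<Rightarrow> 'a::chilbert_space \<Rightarrow>\<^sub>L 'k::chilbert_space"
  assumes W: "complete_family I W"
  shows "complete_family I (\<lambda>i. tensor_op (W i) (id_blinfun :: 'b::chilbert_space \<Rightarrow>\<^sub>L 'b))"
    (is "complete_family I ?W")
proof -
  have o: "orth_family I W" using W by (rule complete_orth_family)
  have b: "W i \<in> bop" if "i \<in> I" for i using orth_family_bop[OF o that] .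
  have "cinner (?W i x) (?W j y) = (if i = j then cinner x y else 0)" if ij: "i \<in> I" "j \<in> I" for i j x y
  proof -
    have 1: "adj (?W i) o\<^sub>L ?W j = tensor_op (adj (W i) o\<^sub>L W j) (id_blinfun :: 'b \<Rightarrow>\<^sub>L 'b)"
      using ij by (simp add: adj_tensor_op tensor_op_compose b)
    have "adj (W i) o\<^sub>L W j = (if i = j then id_blinfun else 0)"
      by (rule blinfun_eqI) (simp add: orth_family_adj[OF o ij])
    moreover have "tensor_op 0 (id_blinfun :: 'b \<Rightarrow>\<^sub>L 'b) = (0 :: ('a, 'b) htensor \<Rightarrow>\<^sub>L ('a, 'b) htensor)"
      by (rule tensor_op_eqI) (simp_all add: bop_def tensor_zero_left)
    ultimately have "adj (?W i) (?W j y) = (if i = j then y else 0)"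
      using arg_cong[OF 1, of "\<lambda>R. blinfun_apply R y"] by auto
    moreover have "cinner (?W i x) (?W j y) = cinner x (adj (?W i) (?W j y))"
      using ij by (simp add: cinner_adj_right b)
    ultimately show ?thesis by (simp add: cinner.zero_right)
  qed
  moreover have "z = 0" if z: "\<forall>i\<in>I. \<forall>x. cinner (?W i x) z = 0" for z
  proof (rule tensor_zeroI)
    fix h k
    have "adj (tensor_right k) z = 0"
    proof -
      have "cinner (W i a) (adj (tensor_right k) z) = 0" if "i \<in> I" for i a
      proof -
        have "cinner (?W i (a \<otimes> k)) z = 0" using z that by blast
        thus ?thesis using that by (simp add: tensor_op_tensor b cinner_adj_right tensor_right.rep_eq)
      qed
      thus ?thesis using W unfolding complete_family_def by blast
    qed
    hence "cinner h (adj (tensor_right k) z) = 0" by (simp add: cinner.zero_right)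
    thus "cinner (h \<otimes> k) z = 0" by (simp add: cinner_adj_right tensor_right.rep_eq)
  qed
  ultimately show ?thesis by (auto simp: complete_family_def orth_family_def b)
qed

section \<open>Row contractions and free power series\<close>

lemma word_op_bop [simp]:
  "(\<And>i. X i \<in> bop) \<Longrightarrow> word_op X \<alpha> \<in> bop" for X :: "'n \<Rightarrow> 'h::complex_inner \<Rightarrow>\<^sub>L 'h"
  by (induction \<alpha>) auto

lemma word_op_intertwine:
  assumes "\<And>i. X' i o\<^sub>L M = M o\<^sub>L X i"
  shows "word_op X' \<alpha> o\<^sub>L M = M o\<^sub>L word_op X \<alpha>"
proof (induction \<alpha>)
  case (Cons i \<alpha>)
  have "word_op X' (i # \<alpha>) o\<^sub>L M = X' i o\<^sub>L (word_op X' \<alpha> o\<^sub>L M)" by (auto intro: blinfun_eqI)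
  also have "\<dots> = (X' i o\<^sub>L M) o\<^sub>L word_op X \<alpha>" unfolding Cons.IH by (auto intro: blinfun_eqI)
  also have "\<dots> = M o\<^sub>L word_op X (i # \<alpha>)" unfolding assms by (auto intro: blinfun_eqI)
  finally show ?case .
qed simp

lemma row_sum_unique: "row_sum X R \<Longrightarrow> row_sum X R' \<Longrightarrow> R = R'"
  unfolding row_sum_def by (intro blinfun_eqI has_sum_unique[where A = UNIV]) auto

lemma row_norm_eq: "row_sum X R \<Longrightarrow> row_norm X = sqrt (norm R)"
  unfolding row_norm_def by (subst the_equality[of "row_sum X" R]) (auto intro: row_sum_unique)

lemma row_ball_iff: "X \<in> row_ball \<longleftrightarrow> (\<forall>i. X i \<in> bop) \<and> (\<exists>R. row_sum X R \<and> norm R < 1)"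
  unfolding row_ball_def by (auto simp: row_norm_eq)

lemma
  assumes X: "\<And>i. X i \<in> bop" and R: "row_sum X R"
  shows row_sum_quadratic: "((\<lambda>i. (norm (adj (X i) x))\<^sup>2) has_sum inner (R x) x) UNIV"
    and row_sum_symmetric: "cinner (R x) y = cinner x (R y)"
    and row_sum_bop: "R \<in> bop"
proof -
  have s: "((\<lambda>i. X i (adj (X i) x)) has_sum R x) UNIV" for x
    using R by (simp add: row_sum_def)
  have "inner (X i (adj (X i) x)) x = (norm (adj (X i) x))\<^sup>2" for i x
    using X[of i] by (simp add: inner_eq_Re_cinner power2_norm_eq_inner flip: cinner_adj_right)
  thus "((\<lambda>i. (norm (adj (X i) x))\<^sup>2) has_sum inner (R x) x) UNIV"
    using has_sum_bounded_linear[OF bounded_linear_inner_left[of x] s[of x]] by simp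
  have "cinner (X i (adj (X i) x)) y = cinner x (X i (adj (X i) y))" for i
    using cinner_adj_right[OF X, of "adj (X i) x" i y] cinner_adj_left[OF X, of i x "adj (X i) y"] by simp
  hence "((\<lambda>i. cinner (X i (adj (X i) x)) y) has_sum cinner x (R y)) UNIV"
    using has_sum_bounded_linear[OF cinner.bounded_linear_right[of x] s[of y]] by simp
  with has_sum_bounded_linear[OF cinner.bounded_linear_left[of y] s[of x]]
  show "cinner (R x) y = cinner x (R y)" by (rule has_sum_unique)
  have "R (c *\<^sub>C x) = c *\<^sub>C R x" for c x
  proof (rule has_sum_unique[OF s])
    show "((\<lambda>i. X i (adj (X i) (c *\<^sub>C x))) has_sum c *\<^sub>C R x) UNIV"
      using has_sum_bounded_linear[OF bounded_linear_scaleC[of c] s[of x]] by (simp add: X bop_scaleC)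
  qed
  thus "R \<in> bop" by (simp add: bop_def)
qed

lemma adj_scaleR:
  fixes T :: "'a::chilbert_space \<Rightarrow>\<^sub>L 'b::chilbert_space"
  assumes "T \<in> bop"
  shows "adj (r *\<^sub>R T) = r *\<^sub>R adj T"
  by (rule adj_eqI)
    (simp add: blinfun.scaleR_left cinner.scaleR_left cinner.scaleR_right cinner_adj_right assms)

lemma row_sum_scaleR:
  assumes X: "\<And>i. X i \<in> bop" and R: "row_sum X R"
  shows "row_sum (\<lambda>i. r *\<^sub>R X i) (r\<^sup>2 *\<^sub>R R)"
  unfolding row_sum_def
proof
  fix x
  have "((\<lambda>i. X i (adj (X i) x)) has_sum R x) UNIV" using R by (simp add: row_sum_def)
  from has_sum_scaleR[OF this, of "r\<^sup>2"]
  show "((\<lambda>i. (r *\<^sub>R X i) (adj (r *\<^sub>R X i) x)) has_sum (r\<^sup>2 *\<^sub>R R) x) UNIV"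
    by (simp add: adj_scaleR X blinfun.scaleR_left blinfun.scaleR_right power2_eq_square)
qed

lemma has_free_sum_unique:
  assumes "has_free_sum A X T" "has_free_sum A X T'"
  shows "T = T'"
proof -
  obtain P P' where P: "\<And>k v. ((\<lambda>\<alpha>. tensor_op (word_op X \<alpha>) (A \<alpha>) v) has_sum blinfun_apply (P k) v) {\<alpha>. length \<alpha> = k}" "P sums T"
    and P': "\<And>k v. ((\<lambda>\<alpha>. tensor_op (word_op X \<alpha>) (A \<alpha>) v) has_sum blinfun_apply (P' k) v) {\<alpha>. length \<alpha> = k}" "P' sums T'"
    using assms unfolding has_free_sum_def by blast
  have "P = P'" by (intro ext blinfun_eqI has_sum_unique[OF P(1) P'(1)])
  thus ?thesis using P(2) P'(2) sums_unique2 by blast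
qed

lemma free_eval_eq: "has_free_sum A X T \<Longrightarrow> free_eval A X = T"
  unfolding free_eval_def using has_free_sum_unique by blast

lemma has_free_sum_bop:
  assumes "has_free_sum A X T" and A: "\<And>\<alpha>. A \<alpha> \<in> bop" and X: "\<And>i. X i \<in> bop"
  shows "T \<in> bop"
proof -
  obtain P where P: "\<And>k v. ((\<lambda>\<alpha>. tensor_op (word_op X \<alpha>) (A \<alpha>) v) has_sum blinfun_apply (P k) v) {\<alpha>. length \<alpha> = k}" "P sums T"
    using assms(1) unfolding has_free_sum_def by blast
  have "P k (c *\<^sub>C v) = c *\<^sub>C P k v" for k c v
  proof (rule has_sum_unique[OF P(1)])
    show "((\<lambda>\<alpha>. tensor_op (word_op X \<alpha>) (A \<alpha>) (c *\<^sub>C v)) has_sum c *\<^sub>C P k v) {\<alpha>. length \<alpha> = k}"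
      using has_sum_bounded_linear[OF bounded_linear_scaleC[of c] P(1)[of v k]] by (simp add: A X bop_scaleC)
  qed
  moreover have ap: "(\<lambda>k. P k v) sums T v" for v
    by (rule bounded_linear.sums[OF blinfun.bounded_linear_left P(2)])
  ultimately have "T (c *\<^sub>C v) = c *\<^sub>C T v" for c v
    using sums_unique2[OF ap[of "c *\<^sub>C v"]] bounded_linear.sums[OF bounded_linear_scaleC[of c] ap[of v]]
    by simp
  thus ?thesis by (simp add: bop_def)
qed

text \<open>
  Free power series respect intertwining operators. Together with the next lemma this replaces the
  functional calculus: it is how values of one function at different points are compared.
\<close>
lemma has_free_sum_intertwine:
  fixes A :: "'n::countable list \<Rightarrow> 'e::chilbert_space \<Rightarrow>\<^sub>L 'g::chilbert_space"
    and X :: "'n \<Rightarrow> 'h::chilbert_space \<Rightarrow>\<^sub>L 'h" and X' :: "'n \<Rightarrow> 'k::chilbert_space \<Rightarrow>\<^sub>L 'k"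
  assumes T: "has_free_sum A X T" and T': "has_free_sum A X' T'"
    and A: "\<And>\<alpha>. A \<alpha> \<in> bop" and X: "\<And>i. X i \<in> bop" and X': "\<And>i. X' i \<in> bop" and M: "M \<in> bop"
    and eq: "\<And>i. X' i o\<^sub>L M = M o\<^sub>L X i"
  shows "T' o\<^sub>L tensor_op M id_blinfun = tensor_op M id_blinfun o\<^sub>L T"
proof -
  let ?M = "tensor_op M id_blinfun :: ('h, 'e) htensor \<Rightarrow>\<^sub>L ('k, 'e) htensor"
  let ?N = "tensor_op M id_blinfun :: ('h, 'g) htensor \<Rightarrow>\<^sub>L ('k, 'g) htensor"
  obtain P P' where P: "\<And>k v. ((\<lambda>\<alpha>. tensor_op (word_op X \<alpha>) (A \<alpha>) v) has_sum blinfun_apply (P k) v) {\<alpha>. length \<alpha> = k}" "P sums T"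
    and P': "\<And>k v. ((\<lambda>\<alpha>. tensor_op (word_op X' \<alpha>) (A \<alpha>) v) has_sum blinfun_apply (P' k) v) {\<alpha>. length \<alpha> = k}" "P' sums T'"
    using T T' unfolding has_free_sum_def by blast
  have w: "tensor_op (word_op X' \<alpha>) (A \<alpha>) (?M v) = ?N (tensor_op (word_op X \<alpha>) (A \<alpha>) v)" for \<alpha> v
  proof -
    have "tensor_op (word_op X' \<alpha>) (A \<alpha>) o\<^sub>L ?M = ?N o\<^sub>L tensor_op (word_op X \<alpha>) (A \<alpha>)"
      by (simp add: tensor_op_compose A X X' M word_op_intertwine[OF eq])
    from arg_cong[OF this, of "\<lambda>R. blinfun_apply R v"] show ?thesis by simp
  qed
  have "P' k o\<^sub>L ?M = ?N o\<^sub>L P k" for k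
  proof (rule blinfun_eqI)
    fix v
    have "((\<lambda>\<alpha>. ?N (tensor_op (word_op X \<alpha>) (A \<alpha>) v)) has_sum ?N (P k v)) {\<alpha>. length \<alpha> = k}"
      by (rule has_sum_bounded_linear[OF blinfun.bounded_linear_right P(1)])
    thus "(P' k o\<^sub>L ?M) v = (?N o\<^sub>L P k) v"
      using has_sum_unique[OF P'(1)[of "?M v" k]] by (simp add: w)
  qed
  moreover have "(\<lambda>k. P' k o\<^sub>L ?M) sums (T' o\<^sub>L ?M)"
    by (rule bounded_linear.sums[OF bounded_bilinear.bounded_linear_left[OF bounded_bilinear_blinfun_compose] P'(2)])
  moreover have "(\<lambda>k. ?N o\<^sub>L P k) sums (?N o\<^sub>L T)"
    by (rule bounded_linear.sums[OF bounded_bilinear.bounded_linear_right[OF bounded_bilinear_blinfun_compose] P(2)])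
  ultimately show ?thesis using sums_unique2 by fastforce
qed

lemma has_free_sum_compress:
  fixes A :: "'n::countable list \<Rightarrow> 'e::chilbert_space \<Rightarrow>\<^sub>L 'g::chilbert_space"
    and X :: "'n \<Rightarrow> 'h::chilbert_space \<Rightarrow>\<^sub>L 'h" and X' :: "'n \<Rightarrow> 'k::chilbert_space \<Rightarrow>\<^sub>L 'k"
  assumes T: "has_free_sum A X T"
    and A: "\<And>\<alpha>. A \<alpha> \<in> bop" and X: "\<And>i. X i \<in> bop" and N: "N \<in> bop" and M: "M \<in> bop"
    and eq: "\<And>\<alpha>. N o\<^sub>L word_op X \<alpha> o\<^sub>L M = word_op X' \<alpha>"
  shows "has_free_sum A X' (tensor_op N id_blinfun o\<^sub>L T o\<^sub>L tensor_op M id_blinfun)"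
proof -
  let ?M = "tensor_op M id_blinfun :: ('k, 'e) htensor \<Rightarrow>\<^sub>L ('h, 'e) htensor"
  let ?N = "tensor_op N id_blinfun :: ('h, 'g) htensor \<Rightarrow>\<^sub>L ('k, 'g) htensor"
  obtain P where P: "\<And>k v. ((\<lambda>\<alpha>. tensor_op (word_op X \<alpha>) (A \<alpha>) v) has_sum blinfun_apply (P k) v) {\<alpha>. length \<alpha> = k}" "P sums T"
    using T unfolding has_free_sum_def by blast
  have w: "?N (tensor_op (word_op X \<alpha>) (A \<alpha>) (?M v)) = tensor_op (word_op X' \<alpha>) (A \<alpha>) v" for \<alpha> v
  proof -
    have "?N o\<^sub>L tensor_op (word_op X \<alpha>) (A \<alpha>) o\<^sub>L ?M = tensor_op (word_op X' \<alpha>) (A \<alpha>)"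
      by (simp add: tensor_op_compose A X M N eq)
    from arg_cong[OF this, of "\<lambda>R. blinfun_apply R v"] show ?thesis by simp
  qed
  have "((\<lambda>\<alpha>. tensor_op (word_op X' \<alpha>) (A \<alpha>) v) has_sum (?N o\<^sub>L P k o\<^sub>L ?M) v) {\<alpha>. length \<alpha> = k}" for k v
    using has_sum_bounded_linear[OF blinfun.bounded_linear_right[of ?N] P(1)[of "?M v" k]] by (simp add: w)
  moreover have "(\<lambda>k. ?N o\<^sub>L P k o\<^sub>L ?M) sums (?N o\<^sub>L T o\<^sub>L ?M)"
    by (rule bounded_linear.sums[OF bounded_bilinear.bounded_linear_left[OF bounded_bilinear_blinfun_compose]])
      (rule bounded_linear.sums[OF bounded_bilinear.bounded_linear_right[OF bounded_bilinear_blinfun_compose] P(2)])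
  ultimately show ?thesis unfolding has_free_sum_def
    by (intro exI[of _ "\<lambda>k. ?N o\<^sub>L P k o\<^sub>L ?M"]) simp
qed

lemma norm_compress_le:
  assumes "norm N \<le> 1" "norm M \<le> 1"
  shows "norm (N o\<^sub>L T o\<^sub>L M) \<le> norm T"
proof -
  have "norm (N o\<^sub>L T o\<^sub>L M) \<le> norm (N o\<^sub>L T) * norm M" by (rule norm_blinfun_compose)
  also have "\<dots> \<le> (norm N * norm T) * norm M" by (intro mult_right_mono norm_blinfun_compose) simp
  also have "\<dots> \<le> (1 * norm T) * 1" using assms by (intro mult_mono) auto
  finally show ?thesis by simp
qed

lemma norm_tensor_op_id_le:
  fixes M :: "'h::chilbert_space \<Rightarrow>\<^sub>L 'k::chilbert_space"
  assumes "M \<in> bop" "norm M \<le> 1"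
  shows "norm (tensor_op M (id_blinfun :: 'e::chilbert_space \<Rightarrow>\<^sub>L 'e)) \<le> 1"
proof -
  have "norm M * norm (id_blinfun :: 'e \<Rightarrow>\<^sub>L 'e) \<le> 1 * 1"
    using assms(2) by (intro mult_mono norm_blinfun_id_le) auto
  moreover have "norm (tensor_op M (id_blinfun :: 'e \<Rightarrow>\<^sub>L 'e)) \<le> norm M * norm (id_blinfun :: 'e \<Rightarrow>\<^sub>L 'e)"
    by (rule norm_tensor_op_le[OF assms(1) bop_id])
  ultimately show ?thesis by linarith
qed

section \<open>The free shift on a separable Hilbert space\<close>

text \<open>
  The space is the direct sum of the copies \<open>W\<^sub>\<alpha> 'h\<close> of itself, i.e. \<open>W\<close> identifies it with the
  tensor product of the Fock space and \<open>'h\<close>. Under this identification \<open>L\<^sub>i\<close> is \<open>S\<^sub>i \<otimes> I\<close>.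
\<close>
locale free_shift =
  fixes W :: "'n::countable list \<Rightarrow> 'h::chilbert_space \<Rightarrow>\<^sub>L 'h" and L :: "'n \<Rightarrow> 'h \<Rightarrow>\<^sub>L 'h"
  assumes complete: "complete_family UNIV W" and L_bop: "L i \<in> bop" and L_W: "L i (W \<alpha> x) = W (i # \<alpha>) x"
begin

lemma W_orth: "orth_family UNIV W"
  using complete by (rule complete_orth_family)

lemma W_bop: "W \<alpha> \<in> bop"
  using W_orth by (simp add: orth_family_def)

lemma adj_W_W: "adj (W \<alpha>) (W \<beta> x) = (if \<alpha> = \<beta> then x else 0)"
  by (rule orth_family_adj[OF W_orth]) simp_all

lemma adj_W_adj_L: "adj (W \<alpha>) (adj (L i) x) = adj (W (i # \<alpha>)) x"
  by (rule cinner_ext_right) (simp add: cinner_adj_right W_bop L_bop L_W)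

lemma W_ext: "(\<And>\<alpha>. adj (W \<alpha>) x = adj (W \<alpha>) y) \<Longrightarrow> x = y"
  using has_sum_unique[OF resolution[OF complete, of x]] resolution[OF complete, of y] by simp

text \<open>\<open>L\<^sub>i L\<^sub>i\<^sup>*\<close> projects onto the summands at words that begin with \<open>i\<close>; only the empty word is missed.\<close>
lemma row_sum_L: "row_sum L (id_blinfun - (W [] o\<^sub>L adj (W [])))"
  unfolding row_sum_def
proof
  fix x
  \<comment> \<open>the expansion of \<open>y\<close> is that of \<open>x\<close> without the empty word, regrouped by first letters\<close>
  define y where "y = (id_blinfun - (W [] o\<^sub>L adj (W []))) x"
  have y: "adj (W \<alpha>) y = (if \<alpha> = [] then 0 else adj (W \<alpha>) x)" for \<alpha>
    by (simp add: y_def blinfun.diff_left blinfun.diff_right adj_W_W)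
  have "((\<lambda>\<alpha>. W \<alpha> (adj (W \<alpha>) y)) has_sum y) UNIV" by (rule resolution[OF complete])
  hence "((\<lambda>\<alpha>. W \<alpha> (adj (W \<alpha>) x)) has_sum y) (- {[]})"
    by (rule has_sum_cong_neutral[THEN iffD1, rotated -1]) (auto simp: y)
  moreover have "- {[]} = (\<lambda>(i, \<alpha>). i # \<alpha>) ` (UNIV \<times> UNIV :: ('n \<times> 'n list) set)"
    by (auto simp: image_def neq_Nil_conv)
  ultimately have s1: "((\<lambda>(i, \<alpha>). W (i # \<alpha>) (adj (W (i # \<alpha>)) x)) has_sum y) (UNIV \<times> UNIV)"
    by (simp add: has_sum_reindex inj_on_def o_def case_prod_unfold)
  have s2: "((\<lambda>\<alpha>. W (i # \<alpha>) (adj (W (i # \<alpha>)) x)) has_sum L i (adj (L i) x)) UNIV" for i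
    using has_sum_bounded_linear[OF blinfun.bounded_linear_right[of "L i"] resolution[OF complete, of "adj (L i) x"]]
    by (simp add: L_W adj_W_adj_L)
  show "((\<lambda>i. L i (adj (L i) x)) has_sum (id_blinfun - (W [] o\<^sub>L adj (W []))) x) UNIV"
    unfolding y_def[symmetric] by (rule has_sum_SigmaD[OF s1]) (simp add: s2)
qed

lemma scaled_shift_row_ball:
  assumes "0 \<le> r" "r < 1"
  shows "(\<lambda>i. r *\<^sub>R L i) \<in> row_ball"
proof -
  let ?Q = "id_blinfun - (W [] o\<^sub>L adj (W []))"
  have "norm (?Q x) \<le> norm x" for x
  proof -
    have "inner (W [] (adj (W []) x)) x = (norm (W [] (adj (W []) x)))\<^sup>2"
      using W_bop[of "[]"] adj_W_W[of "[]" "[]"]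
      by (simp add: inner_eq_Re_cinner power2_norm_eq_inner flip: cinner_adj_right)
    hence "(norm (?Q x))\<^sup>2 = (norm x)\<^sup>2 - (norm (W [] (adj (W []) x)))\<^sup>2"
      using norm_diff_square[of x "W [] (adj (W []) x)"] by (simp add: blinfun.diff_left)
    hence "(norm (?Q x))\<^sup>2 \<le> (norm x)\<^sup>2" by simp
    thus ?thesis by (simp add: power2_le_iff_abs_le)
  qed
  hence "norm ?Q \<le> 1" by (intro norm_blinfun_bound) auto
  hence "norm (r\<^sup>2 *\<^sub>R ?Q) \<le> r\<^sup>2 * 1" unfolding norm_scaleR by (intro mult_mono) auto
  also have "\<dots> < 1" using assms by (simp add: abs_square_less_1)
  finally have "norm (r\<^sup>2 *\<^sub>R ?Q) < 1" .
  moreover have "row_sum (\<lambda>i. r *\<^sub>R L i) (r\<^sup>2 *\<^sub>R ?Q)"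
    by (rule row_sum_scaleR[OF L_bop row_sum_L])
  ultimately show ?thesis by (auto simp: row_ball_iff L_bop)
qed

end

lemma infinite_some_onb:
  assumes inf: "infinite_dimensional TYPE('h::chilbert_space)"
  shows "infinite (some_onb :: 'h set)" (is "infinite ?B")
proof
  assume fin: "finite ?B"
  have "x \<in> complex_vector.span ?B" for x
  proof -
    have "x = (\<Sum>b\<in>?B. cinner x b *\<^sub>C b)"
      by (rule has_sum_unique[OF fourier_expansion[OF some_onb] has_sum_finite[OF fin]])
    also have "\<dots> \<in> complex_vector.span ?B"
      by (intro complex_vector.span_sum complex_vector.span_scale complex_vector.span_base)
    finally show ?thesis .
  qed
  thus False using inf fin unfolding infinite_dimensional_def by blast
qed

text \<open>
  Distinct basis vectors have distance \<open>\<surd>2\<close>, so the balls of radius \<open>1/2\<close> about them are disjoint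
  and each contains a point of a countable dense set.
\<close>
lemma countable_some_onb:
  assumes sep: "separable_space (euclidean :: 'h::chilbert_space topology)"
  shows "countable (some_onb :: 'h set)" (is "countable ?B")
proof -
  have o: "cinner b c = (if b = c then 1 else 0)" if "b \<in> ?B" "c \<in> ?B" for b c
    using orthonormal_some_onb that by (auto simp: orthonormal_def)
  obtain C :: "'h set" where C: "countable C" "closure C = UNIV"
    using sep by (auto simp: separable_space_def)
  have "\<forall>b. \<exists>c. c \<in> C \<and> dist c b < 1/2"
  proof
    fix b :: 'h
    have "b \<in> closure C" by (simp add: C(2))
    hence "\<forall>e>0. \<exists>c\<in>C. dist c b < e" by (simp only: closure_approachable)
    from this[rule_format, of "1/2"] show "\<exists>c. c \<in> C \<and> dist c b < 1/2" by auto
  qed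
  from choice[OF this] obtain f where f: "\<And>b. f b \<in> C" "\<And>b. dist (f b) b < 1/2" by blast
  have "inj_on f ?B"
  proof (rule inj_onI, rule ccontr)
    fix b c assume bc: "b \<in> ?B" "c \<in> ?B" "f b = f c" "b \<noteq> c"
    have "(norm (b - c))\<^sup>2 = 2"
      using bc o[of c b] norm_orthonormal[OF orthonormal_some_onb bc(1)]
        norm_orthonormal[OF orthonormal_some_onb bc(2)]
      by (simp add: norm_diff_square inner_eq_Re_cinner)
    moreover have "norm (b - c) < 1"
      using f(2)[of b] f(2)[of c] bc(3) dist_triangle2[of b c "f b"] by (simp add: dist_norm norm_minus_commute)
    hence "(norm (b - c))\<^sup>2 < 1" by (simp add: power_less_one_iff abs_square_less_1)
    ultimately show False by simp
  qed
  moreover have "f ` ?B \<subseteq> C" using f(1) by auto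
  ultimately show ?thesis using C(1) countable_subset countable_image_inj_on by blast
qed

text \<open>
  An orthonormal basis \<open>B\<close> of the space is countably infinite, hence in bijection with the set of pairs
  of a word and an element of \<open>B\<close>. If \<open>u\<close> is such a bijection, \<open>W\<^sub>\<alpha> b = u \<alpha> b\<close>. That \<open>u\<close> is onto makes \<open>W\<close> complete.
\<close>
lemma free_shift_exists:
  assumes sep: "separable_space (euclidean :: 'h::chilbert_space topology)"
    and inf: "infinite_dimensional TYPE('h)"
  obtains W :: "'n::countable list \<Rightarrow> 'h::chilbert_space \<Rightarrow>\<^sub>L 'h" and L where "free_shift W L"
proof -
  let ?B = "some_onb :: 'h set"
  have o: "cinner b c = (if b = c then 1 else 0)" if "b \<in> ?B" "c \<in> ?B" for b c
    using orthonormal_some_onb that by (auto simp: orthonormal_def)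
  have "infinite ?B" by (rule infinite_some_onb[OF inf])
  moreover have "countable ?B" by (rule countable_some_onb[OF sep])
  moreover have "infinite (UNIV \<times> ?B :: ('n list \<times> 'h) set)"
    using \<open>infinite ?B\<close> infinite_imp_nonempty[OF \<open>infinite ?B\<close>]
    by (simp add: finite_cartesian_product_iff)
  moreover have "countable (UNIV \<times> ?B :: ('n list \<times> 'h) set)"
    using \<open>countable ?B\<close> by (intro countable_SIGMA) auto
  ultimately have "bij_betw (to_nat_on (UNIV \<times> ?B :: ('n list \<times> 'h) set)) (UNIV \<times> ?B) UNIV"
    "bij_betw (to_nat_on ?B) ?B UNIV"
    by (simp_all add: to_nat_on_infinite)
  then obtain p :: "'n list \<times> 'h \<Rightarrow> nat" and q :: "'h \<Rightarrow> nat"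
    where p: "bij_betw p (UNIV \<times> ?B) UNIV" and q: "bij_betw q ?B UNIV" by blast
  define u where "u \<alpha> b = inv_into ?B q (p (\<alpha>, b))" for \<alpha> b
  have "bij_betw (inv_into ?B q \<circ> p) (UNIV \<times> ?B) ?B"
    using p bij_betw_inv_into[OF q] by (rule bij_betw_trans)
  hence inj: "inj_on (\<lambda>(\<alpha>, b). u \<alpha> b) (UNIV \<times> ?B)" and im: "(\<lambda>(\<alpha>, b). u \<alpha> b) ` (UNIV \<times> ?B) = ?B"
    by (auto simp: bij_betw_def u_def[abs_def] o_def case_prod_unfold)
  have uB: "u \<alpha> b \<in> ?B" if "b \<in> ?B" for \<alpha> b using im that by blast
  have uo: "cinner (u \<alpha> b) (u \<beta> c) = (if \<alpha> = \<beta> \<and> b = c then 1 else 0)" if "b \<in> ?B" "c \<in> ?B" for \<alpha> \<beta> b c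
    using o[OF uB uB, OF that] inj_onD[OF inj, of "(\<alpha>, b)" "(\<beta>, c)"] that by auto
  have "\<exists>V. V \<in> bop \<and> (\<forall>b\<in>?B. blinfun_apply V b = u \<alpha> b)" for \<alpha>
  proof -
    have "orth_family ?B (\<lambda>b. ray (u \<alpha> b))" by (rule orth_family_ray) (simp add: uo)
    then obtain V where V: "V \<in> bop" "\<And>b c. b \<in> ?B \<Longrightarrow> V (ray b c) = ray (u \<alpha> b) (id_blinfun c)"
      by (rule diagonal_operator[OF complete_family_onb _ bop_id]) blast
    have "V b = u \<alpha> b" if "b \<in> ?B" for b using V(2)[OF that, of 1] by (simp add: ray.rep_eq)
    thus ?thesis using V(1) by blast
  qed
  hence "\<exists>W. \<forall>\<alpha>. W \<alpha> \<in> bop \<and> (\<forall>b\<in>?B. blinfun_apply (W \<alpha>) b = u \<alpha> b)"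
    by (intro choice allI)
  then obtain W where W: "\<And>\<alpha>. W \<alpha> \<in> bop" "\<And>\<alpha> b. b \<in> ?B \<Longrightarrow> blinfun_apply (W \<alpha>) b = u \<alpha> b" by blast
  have WW: "adj (W \<alpha>) (W \<beta> x) = (if \<alpha> = \<beta> then x else 0)" for \<alpha> \<beta> x
  proof -
    have "adj (W \<alpha>) o\<^sub>L W \<beta> = (if \<alpha> = \<beta> then id_blinfun else 0)"
    proof (rule complete_family_ext[OF complete_family_onb])
      fix b :: 'h and a assume b: "b \<in> ?B"
      have "adj (W \<alpha>) (W \<beta> b) - (if \<alpha> = \<beta> then b else 0) = 0"
      proof (rule orthonormal_basis_total[OF some_onb])
        fix c :: 'h assume c: "c \<in> ?B"
        show "cinner c (adj (W \<alpha>) (W \<beta> b) - (if \<alpha> = \<beta> then b else 0)) = 0"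
          using b c by (simp add: cinner.diff_right cinner_adj_right W uo o cinner.zero_right)
      qed
      thus "(adj (W \<alpha>) o\<^sub>L W \<beta>) (ray b a) = (if \<alpha> = \<beta> then id_blinfun else 0) (ray b a)"
        by (simp add: ray.rep_eq bop_scaleC W split: if_splits)
    qed
    from arg_cong[OF this, of "\<lambda>R. blinfun_apply R x"] show ?thesis by simp
  qed
  have "complete_family UNIV W"
    unfolding complete_family_def orth_family_def
  proof (intro conjI ballI allI impI)
    fix \<alpha> \<beta> x y
    show "cinner (W \<alpha> x) (W \<beta> y) = (if \<alpha> = \<beta> then cinner x y else 0)"
      using WW[of \<alpha> \<beta> y] by (simp add: cinner.zero_right flip: cinner_adj_right[OF W(1)])
  next
    fix z assume z: "\<forall>\<alpha>\<in>UNIV. \<forall>x. cinner (W \<alpha> x) z = 0"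
    show "z = 0"
    proof (rule orthonormal_basis_total[OF some_onb])
      fix b :: 'h assume "b \<in> ?B"
      hence "b \<in> (\<lambda>(\<alpha>, b). u \<alpha> b) ` (UNIV \<times> ?B)" by (simp only: im)
      then obtain \<alpha> c where "b = u \<alpha> c" "c \<in> ?B" by auto
      thus "cinner b z = 0" using z W(2)[of c \<alpha>] by (metis UNIV_I)
    qed
  qed (rule W)
  moreover have "\<forall>i. \<exists>L. L \<in> bop \<and> (\<forall>\<alpha> x. blinfun_apply L (W \<alpha> x) = W (i # \<alpha>) x)"
  proof
    fix i
    have "orth_family UNIV (\<lambda>\<alpha>. W (i # \<alpha>))"
      using \<open>complete_family UNIV W\<close> by (simp add: complete_family_def orth_family_def)
    then obtain V where V: "V \<in> bop" "\<And>\<alpha> x. \<alpha> \<in> UNIV \<Longrightarrow> V (W \<alpha> x) = W (i # \<alpha>) (id_blinfun x)"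
      by (rule diagonal_operator[OF \<open>complete_family UNIV W\<close> _ bop_id]) blast
    thus "\<exists>L. L \<in> bop \<and> (\<forall>\<alpha> x. blinfun_apply L (W \<alpha> x) = W (i # \<alpha>) x)" by auto
  qed
  from choice[OF this] obtain L where "\<And>i. L i \<in> bop" "\<And>i \<alpha> x. blinfun_apply (L i) (W \<alpha> x) = W (i # \<alpha>) x"
    by blast
  ultimately have "free_shift W L" by unfold_locales
  thus ?thesis by (rule that)
qed

section \<open>Copies of the Fock space\<close>

lift_definition ell2_unit :: "'i \<Rightarrow> ('i, complex) ell2" is "\<lambda>i j. if j = i then 1 else 0"
proof -
  fix i :: 'i
  have "((\<lambda>j. (norm (if j = i then 1 else 0 :: complex))\<^sup>2) has_sum 1) UNIV"
    by (rule has_sum_finite_neutralI[of "{i}"]) auto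
  thus "(\<lambda>j. (norm (if j = i then 1 else 0 :: complex))\<^sup>2) summable_on UNIV"
    by (auto simp: summable_on_def)
qed

lemma cinner_ell2_unit: "cinner f (ell2_unit i) = coord f i"
proof -
  have "((\<lambda>j. cinner (coord f j) (coord (ell2_unit i) j)) has_sum coord f i) UNIV"
    by (rule has_sum_finite_neutralI[of "{i}"]) (auto simp: ell2_unit.rep_eq cinner_complex_def)
  thus ?thesis by (simp add: cinner_ell2_def infsumI)
qed

lemma ell2_ext:
  assumes "\<And>i. coord f i = coord g i"
  shows "f = g"
  using assms by (simp add: coord_inject[symmetric] fun_eq_iff)

lemma complete_family_ell2_unit: "complete_family UNIV (\<lambda>i. ray (ell2_unit i :: ('i, complex) ell2))"
proof (rule complete_family_ray)
  fix z :: "('i, complex) ell2"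
  assume *: "\<And>i. i \<in> UNIV \<Longrightarrow> cinner (ell2_unit i) z = 0"
  show "z = 0"
  proof (rule ell2_ext)
    fix i
    have "cinner z (ell2_unit i) = 0" using *[of i] cinner_commute[of z] by simp
    thus "coord z i = coord 0 i" by (simp add: cinner_ell2_unit)
  qed
qed (simp add: cinner_ell2_unit ell2_unit.rep_eq)

lemma creation_bop [simp]: "creation i \<in> bop"
  by (auto simp: bop_def creation.rep_eq left_creation.rep_eq intro!: ell2_ext split: list.splits)

lemma creation_ell2_unit: "creation i (ell2_unit \<alpha>) = ell2_unit (i # \<alpha>)"
  by (rule ell2_ext) (auto simp: creation.rep_eq left_creation.rep_eq ell2_unit.rep_eq split: list.splits)

lemma compose_scaleR: "(r *\<^sub>R S) o\<^sub>L T = r *\<^sub>R (S o\<^sub>L T)" "S o\<^sub>L (r *\<^sub>R T) = r *\<^sub>R (S o\<^sub>L T)"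
  by (auto intro: blinfun_eqI simp: blinfun.scaleR_left blinfun.scaleR_right)

lemma norm_isometry_le:
  fixes V :: "'a::chilbert_space \<Rightarrow>\<^sub>L 'b::chilbert_space"
  assumes V: "V \<in> bop" and iso: "\<And>x. norm (blinfun_apply V x) = norm x"
  shows "norm V \<le> 1" "norm (adj V) \<le> 1"
proof -
  show "norm V \<le> 1" by (rule norm_blinfun_bound) (simp_all add: iso)
  thus "norm (adj V) \<le> 1" using norm_adj_le[OF V] by simp
qed

context free_shift
begin

text \<open>
  The embedding \<open>e\<^sub>\<alpha> \<mapsto> W\<^sub>\<alpha> b\<close>. For \<open>b\<close> running through an orthonormal basis these exhibit the space
  as an orthogonal sum of copies of the Fock space, each of which reduces all \<open>L\<^sub>i\<close> to \<open>S\<^sub>i\<close>.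
\<close>
definition fock_embedding :: "'h \<Rightarrow> 'n fock \<Rightarrow>\<^sub>L 'h" where
  "fock_embedding b = (SOME J. J \<in> bop \<and> (\<forall>\<alpha>. blinfun_apply J (ell2_unit \<alpha>) = W \<alpha> b))"

lemma
  assumes b: "b \<in> some_onb"
  shows fock_embedding_bop: "fock_embedding b \<in> bop"
    and fock_embedding_unit: "fock_embedding b (ell2_unit \<alpha>) = W \<alpha> b"
proof -
  have bb: "cinner b b = 1" using b orthonormal_some_onb by (auto simp: orthonormal_def)
  have "orth_family UNIV (\<lambda>\<alpha>. ray (W \<alpha> b))"
    by (rule orth_family_ray) (simp add: orth_family_cinner[OF W_orth] bb)
  then obtain J where J: "J \<in> bop"
    "\<And>\<alpha> c. \<alpha> \<in> UNIV \<Longrightarrow> blinfun_apply J (ray (ell2_unit \<alpha>) c) = ray (W \<alpha> b) (id_blinfun c)"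
    by (rule diagonal_operator[OF complete_family_ell2_unit _ bop_id]) blast
  have "J (ell2_unit \<alpha>) = W \<alpha> b" for \<alpha> using J(2)[of \<alpha> 1] by (simp add: ray.rep_eq)
  hence "\<exists>J. J \<in> bop \<and> (\<forall>\<alpha>. blinfun_apply J (ell2_unit \<alpha>) = W \<alpha> b)" using J(1) by blast
  from someI_ex[OF this] show "fock_embedding b \<in> bop" "fock_embedding b (ell2_unit \<alpha>) = W \<alpha> b"
    by (auto simp: fock_embedding_def)
qed

lemma adj_fock_embedding_W:
  assumes b: "b \<in> some_onb"
  shows "adj (fock_embedding b) (W \<alpha> x) = cinner x b *\<^sub>C ell2_unit \<alpha>"
proof (rule ell2_ext)
  fix \<beta>
  have "coord (adj (fock_embedding b) (W \<alpha> x)) \<beta> = cinner (W \<alpha> x) (W \<beta> b)"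
    by (simp add: fock_embedding_bop fock_embedding_unit b cinner_adj_left flip: cinner_ell2_unit)
  thus "coord (adj (fock_embedding b) (W \<alpha> x)) \<beta> = coord (cinner x b *\<^sub>C ell2_unit \<alpha>) \<beta>"
    by (simp add: orth_family_cinner[OF W_orth] ell2_unit.rep_eq scaleC_complex_def)
qed

lemma complete_family_fock_embedding: "complete_family some_onb fock_embedding"
  unfolding complete_family_def orth_family_def
proof (intro conjI ballI allI impI)
  fix b c :: 'h and f g assume bc: "b \<in> some_onb" "c \<in> some_onb"
  have cb: "cinner c b = (if b = c then 1 else 0)"
    using bc orthonormal_some_onb by (auto simp: orthonormal_def)
  have "adj (fock_embedding b) o\<^sub>L fock_embedding c = (if b = c then id_blinfun else 0)"
  proof (rule complete_family_ext[OF complete_family_ell2_unit])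
    fix \<alpha> :: "'n list" and a
    show "(adj (fock_embedding b) o\<^sub>L fock_embedding c) (ray (ell2_unit \<alpha>) a) =
        (if b = c then id_blinfun else 0) (ray (ell2_unit \<alpha>) a)"
      using bc cb by (simp add: ray.rep_eq bop_scaleC fock_embedding_bop fock_embedding_unit
          adj_fock_embedding_W)
  qed
  from arg_cong[OF this, of "\<lambda>R. blinfun_apply R g"]
  show "cinner (fock_embedding b f) (fock_embedding c g) = (if b = c then cinner f g else 0)"
    using bc by (simp add: fock_embedding_bop cinner.zero_right flip: cinner_adj_right)
next
  fix z assume z: "\<forall>b\<in>some_onb. \<forall>f. cinner (fock_embedding b f) z = 0"
  have "adj (W \<alpha>) z = 0" for \<alpha>
  proof (rule orthonormal_basis_total[OF some_onb])
    fix b :: 'h assume b: "b \<in> some_onb"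
    have "cinner (fock_embedding b (ell2_unit \<alpha>)) z = 0" using z b by blast
    thus "cinner b (adj (W \<alpha>) z) = 0" using b by (simp add: cinner_adj_right W_bop fock_embedding_unit)
  qed
  thus "z = 0" using W_ext[of z 0] by simp
qed (rule fock_embedding_bop)

lemma adj_fock_embedding_L:
  assumes b: "b \<in> some_onb"
  shows "adj (fock_embedding b) o\<^sub>L L i = creation i o\<^sub>L adj (fock_embedding b)"
proof (rule complete_family_ext[OF complete])
  fix \<alpha> x
  show "(adj (fock_embedding b) o\<^sub>L L i) (W \<alpha> x) = (creation i o\<^sub>L adj (fock_embedding b)) (W \<alpha> x)"
    by (simp add: L_W adj_fock_embedding_W b bop_scaleC creation_ell2_unit)
qed

lemma L_fock_embedding:
  assumes b: "b \<in> some_onb"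
  shows "L i o\<^sub>L fock_embedding b = fock_embedding b o\<^sub>L creation i"
proof (rule complete_family_ext[OF complete_family_ell2_unit])
  fix \<alpha> :: "'n list" and c
  show "(L i o\<^sub>L fock_embedding b) (ray (ell2_unit \<alpha>) c) = (fock_embedding b o\<^sub>L creation i) (ray (ell2_unit \<alpha>) c)"
    by (simp add: ray.rep_eq bop_scaleC L_bop fock_embedding_bop fock_embedding_unit b L_W creation_ell2_unit)
qed

text \<open>The Fock space need not be the space of the ball: convergence at \<open>rS\<close> is inherited from \<open>rL\<close>.\<close>
lemma free_eval_fock:
  fixes A :: "'n list \<Rightarrow> 'e::chilbert_space \<Rightarrow>\<^sub>L 'g::chilbert_space"
  assumes b: "b \<in> some_onb" and A: "\<And>\<alpha>. A \<alpha> \<in> bop" and T: "has_free_sum A (\<lambda>i. r *\<^sub>R L i) T"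
  shows "has_free_sum A (\<lambda>i. r *\<^sub>R creation i)
    (tensor_op (adj (fock_embedding b)) id_blinfun o\<^sub>L T o\<^sub>L tensor_op (fock_embedding b) id_blinfun)"
proof (rule has_free_sum_compress[OF T A])
  fix \<alpha> :: "'n list"
  have o: "adj (fock_embedding b) (fock_embedding b f) = f" for f
    using orth_family_adj[OF complete_orth_family[OF complete_family_fock_embedding] b b] by simp
  have "word_op (\<lambda>i. r *\<^sub>R L i) \<alpha> o\<^sub>L fock_embedding b = fock_embedding b o\<^sub>L word_op (\<lambda>i. r *\<^sub>R creation i) \<alpha>"
    by (rule word_op_intertwine) (simp add: compose_scaleR L_fock_embedding[OF b])
  from arg_cong[OF this, of "\<lambda>R. adj (fock_embedding b) (blinfun_apply R _)"]
  show "adj (fock_embedding b) o\<^sub>L word_op (\<lambda>i. r *\<^sub>R L i) \<alpha> o\<^sub>L fock_embedding b =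
      word_op (\<lambda>i. r *\<^sub>R creation i) \<alpha>"
    by (intro blinfun_eqI) (simp add: o)
qed (simp_all add: L_bop fock_embedding_bop b)

text \<open>
  The value at \<open>rL\<close> commutes with the projections to the copies of the Fock space and acts on each of
  them as the value at \<open>rS\<close>. Parseval's identity on both sides gives the bound.
\<close>
lemma norm_shift_le_fock:
  fixes A :: "'n list \<Rightarrow> 'e::chilbert_space \<Rightarrow>\<^sub>L 'g::chilbert_space"
  assumes A: "\<And>\<alpha>. A \<alpha> \<in> bop" and T: "has_free_sum A (\<lambda>i. r *\<^sub>R L i) T"
    and Tr: "has_free_sum A (\<lambda>i. r *\<^sub>R creation i) Tr"
  shows "norm T \<le> norm Tr"
proof (rule norm_blinfun_bound)
  fix v :: "('h, 'e) htensor"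
  let ?J = "\<lambda>b. tensor_op (fock_embedding b) (id_blinfun :: 'g \<Rightarrow>\<^sub>L 'g)"
  let ?K = "\<lambda>b. tensor_op (fock_embedding b) (id_blinfun :: 'e \<Rightarrow>\<^sub>L 'e)"
  have le: "(norm (adj (?J b) (T v)))\<^sup>2 \<le> (norm Tr)\<^sup>2 * (norm (adj (?K b) v))\<^sup>2" if b: "b \<in> some_onb" for b
  proof -
    have "Tr o\<^sub>L tensor_op (adj (fock_embedding b)) id_blinfun = tensor_op (adj (fock_embedding b)) id_blinfun o\<^sub>L T"
      by (rule has_free_sum_intertwine[OF T Tr A])
        (simp_all add: L_bop fock_embedding_bop b compose_scaleR adj_fock_embedding_L)
    from arg_cong[OF this, of "\<lambda>R. blinfun_apply R v"]
    have "adj (?J b) (T v) = Tr (adj (?K b) v)"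
      by (simp add: adj_tensor_op fock_embedding_bop b)
    hence "norm (adj (?J b) (T v)) \<le> norm Tr * norm (adj (?K b) v)" by (simp add: norm_blinfun)
    from power_mono[OF this, of 2] show ?thesis by (simp add: power_mult_distrib)
  qed
  have "(norm (T v))\<^sup>2 \<le> (norm Tr)\<^sup>2 * (norm v)\<^sup>2"
    by (rule has_sum_mono[OF parseval[OF complete_family_tensor_op[OF complete_family_fock_embedding]]
          has_sum_cmult_right[OF parseval[OF complete_family_tensor_op[OF complete_family_fock_embedding]]]]) (rule le)
  thus "norm (T v) \<le> norm Tr * norm v"
    by (simp add: power_mult_distrib[symmetric] power2_le_iff_abs_le abs_mult)
qed simp

end

section \<open>The Poisson kernel\<close>

text \<open>
  By \<open>\<parallel>D x\<parallel>\<^sup>2 = \<parallel>x\<parallel>\<^sup>2 - \<Sum>\<^sub>i \<parallel>Y\<^sub>i\<^sup>* x\<parallel>\<^sup>2\<close> the sum telescopes: over the words of length less than \<open>k\<close> it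
  is \<open>\<parallel>h\<parallel>\<^sup>2 - s\<^sub>k(h)\<close>, where \<open>s\<^sub>k(h) = \<Sum> \<parallel>Y\<^sub>\<alpha>\<^sup>* h\<parallel>\<^sup>2\<close> over the words of length \<open>k\<close>. As \<open>s\<^sub>k(h)\<close> is at
  most \<open>\<parallel>T\<parallel>\<^sup>k \<parallel>h\<parallel>\<^sup>2\<close>, it tends to \<open>0\<close>. The induction on \<open>k\<close> splits off the first letter of a word.
\<close>
lemma defect_sum:
  fixes Y :: "'n::countable \<Rightarrow> 'h::chilbert_space \<Rightarrow>\<^sub>L 'h"
  assumes Y: "\<And>i. Y i \<in> bop" and T: "row_sum Y T" "norm T < 1"
    and D: "\<And>x. (norm (blinfun_apply D x))\<^sup>2 = (norm x)\<^sup>2 - inner (T x) x"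
  shows "((\<lambda>\<alpha>. (norm (D (adj (word_op Y \<alpha>) h)))\<^sup>2) has_sum (norm h)\<^sup>2) UNIV"
proof -
  define g where "g \<alpha> h = (norm (D (adj (word_op Y \<alpha>) h)))\<^sup>2" for \<alpha> h
  have g0: "0 \<le> g \<alpha> h" for \<alpha> h by (simp add: g_def)
  have gN: "g [] h = (norm h)\<^sup>2 - inner (T h) h" for h by (simp add: g_def D)
  have gC: "g (i # \<alpha>) h = g \<alpha> (adj (Y i) h)" for i \<alpha> h
    by (simp add: g_def adj_compose Y)
  have q: "((\<lambda>i. (norm (adj (Y i) h))\<^sup>2) has_sum inner (T h) h) UNIV" for h
    by (rule row_sum_quadratic[OF Y T(1)])
  have Tq: "inner (T h) h \<le> norm T * (norm h)\<^sup>2" for h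
    using norm_cauchy_schwarz[of "T h" h] mult_right_mono[OF norm_blinfun[of T h] norm_ge_zero[of h]]
    by (simp add: power2_eq_square mult_ac)
  have "\<exists>s. (\<forall>h. 0 \<le> s h \<and> s h \<le> norm T ^ k * (norm h)\<^sup>2) \<and>
      (\<forall>h. ((\<lambda>\<alpha>. g \<alpha> h) has_sum (norm h)\<^sup>2 - s h) {\<alpha>. length \<alpha> < k})" for k
  proof (induction k)
    case 0
    show ?case by (rule exI[of _ "\<lambda>h. (norm h)\<^sup>2"]) simp
  next
    case (Suc k)
    then obtain s where s: "\<And>h. 0 \<le> s h" "\<And>h. s h \<le> norm T ^ k * (norm h)\<^sup>2"
      "\<And>h. ((\<lambda>\<alpha>. g \<alpha> h) has_sum (norm h)\<^sup>2 - s h) {\<alpha>. length \<alpha> < k}" by blast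
    define s' where "s' h = (\<Sum>\<^sub>\<infinity>i. s (adj (Y i) h))" for h
    have tq: "((\<lambda>i. norm T ^ k * (norm (adj (Y i) h))\<^sup>2) has_sum norm T ^ k * inner (T h) h) UNIV" for h
      by (rule has_sum_cmult_right[OF q])
    have "(\<lambda>i. s (adj (Y i) h)) summable_on UNIV" for h
      by (rule summable_on_comparison_test[OF has_sum_imp_summable[OF tq[of h]]]) (auto simp: s)
    hence s's: "((\<lambda>i. s (adj (Y i) h)) has_sum s' h) UNIV" for h by (simp add: s'_def)
    have "0 \<le> s' h" for h by (rule has_sum_nonneg[OF s's]) (simp add: s)
    moreover have "s' h \<le> norm T ^ Suc k * (norm h)\<^sup>2" for h
    proof -
      have "s' h \<le> norm T ^ k * inner (T h) h" by (rule has_sum_mono[OF s's tq]) (simp add: s)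
      also have "\<dots> \<le> norm T ^ k * (norm T * (norm h)\<^sup>2)" by (intro mult_left_mono Tq) simp
      finally show ?thesis by (simp add: mult_ac)
    qed
    moreover have "((\<lambda>\<alpha>. g \<alpha> h) has_sum (norm h)\<^sup>2 - s' h) {\<alpha>. length \<alpha> < Suc k}" for h
    proof -
      have 1: "((\<lambda>\<alpha>. g (i # \<alpha>) h) has_sum ((norm (adj (Y i) h))\<^sup>2 - s (adj (Y i) h))) {\<alpha>. length \<alpha> < k}" for i
        unfolding gC by (rule s(3))
      have 2: "((\<lambda>i. (norm (adj (Y i) h))\<^sup>2 - s (adj (Y i) h)) has_sum inner (T h) h - s' h) UNIV"
        using has_sum_add[OF q[of h] has_sum_uminusI[OF s's[of h]]] by simp
      have "((\<lambda>(i, \<alpha>). g (i # \<alpha>) h) has_sum inner (T h) h - s' h) (UNIV \<times> {\<alpha>. length \<alpha> < k})"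
      proof (rule has_sum_SigmaI[OF _ 2])
        show "(\<lambda>(i, \<alpha>). g (i # \<alpha>) h) summable_on UNIV \<times> {\<alpha>. length \<alpha> < k}"
          by (rule summable_on_SigmaI[OF _ has_sum_imp_summable[OF 2]]) (use 1 g0 in auto)
      qed (use 1 in auto)
      hence "((\<lambda>\<alpha>. g \<alpha> h) has_sum inner (T h) h - s' h) ((\<lambda>(i, \<alpha>). i # \<alpha>) ` (UNIV \<times> {\<alpha>. length \<alpha> < k}))"
        by (subst has_sum_reindex) (auto simp: inj_on_def o_def case_prod_unfold)
      hence "((\<lambda>\<alpha>. g \<alpha> h) has_sum g [] h + (inner (T h) h - s' h))
          (insert [] ((\<lambda>(i, \<alpha>). i # \<alpha>) ` (UNIV \<times> {\<alpha>. length \<alpha> < k})))"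
        by (intro has_sum_insert) auto
      moreover have "insert [] ((\<lambda>(i, \<alpha>). i # \<alpha>) ` (UNIV \<times> {\<alpha> :: 'n list. length \<alpha> < k})) = {\<alpha>. length \<alpha> < Suc k}"
        by (auto simp: image_def less_Suc_eq_0_disj length_Suc_conv)
      ultimately show ?thesis by (simp add: gN)
    qed
    ultimately show ?case by (intro exI[of _ s']) blast
  qed
  then have "\<exists>s. \<forall>k. (\<forall>h. 0 \<le> s k h \<and> s k h \<le> norm T ^ k * (norm h)\<^sup>2) \<and>
      (\<forall>h. ((\<lambda>\<alpha>. g \<alpha> h) has_sum (norm h)\<^sup>2 - s k h) {\<alpha>. length \<alpha> < k})"
    by (intro choice allI)
  then obtain s where s: "\<And>k h. 0 \<le> s k h" "\<And>k h. s k h \<le> norm T ^ k * (norm h)\<^sup>2"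
      "\<And>k h. ((\<lambda>\<alpha>. g \<alpha> h) has_sum (norm h)\<^sup>2 - s k h) {\<alpha>. length \<alpha> < k}" by blast
  have fin: "(\<Sum>\<alpha>\<in>J. g \<alpha> h) \<le> (norm h)\<^sup>2" if "finite J" for J
  proof -
    obtain k where k: "\<And>\<alpha>. \<alpha> \<in> J \<Longrightarrow> length \<alpha> < k"
      using finite_nat_set_iff_bounded[of "length ` J"] \<open>finite J\<close> by auto
    have "(\<Sum>\<alpha>\<in>J. g \<alpha> h) \<le> (norm h)\<^sup>2 - s k h"
      by (rule has_sum_mono'[OF has_sum_finite[OF that] s(3)]) (use k g0 in auto)
    thus ?thesis using s(1)[of k h] by simp
  qed
  have sm: "(\<lambda>\<alpha>. g \<alpha> h) summable_on UNIV"
    by (rule nonneg_bdd_above_summable_on) (auto intro!: bdd_aboveI2[of _ _ "(norm h)\<^sup>2"] fin g0)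
  hence S: "((\<lambda>\<alpha>. g \<alpha> h) has_sum (\<Sum>\<^sub>\<infinity>\<alpha>. g \<alpha> h)) UNIV" by simp
  have "(\<Sum>\<^sub>\<infinity>\<alpha>. g \<alpha> h) \<le> (norm h)\<^sup>2"
    by (rule infsum_le_finite_sums[OF sm]) (rule fin)
  moreover have "(norm h)\<^sup>2 \<le> (\<Sum>\<^sub>\<infinity>\<alpha>. g \<alpha> h)"
  proof (rule tendsto_upperbound)
    show "(\<lambda>k. (norm h)\<^sup>2 - norm T ^ k * (norm h)\<^sup>2) \<longlonglongrightarrow> (norm h)\<^sup>2"
      using T(2) by (auto intro!: tendsto_eq_intros LIMSEQ_power_zero)
    show "\<forall>\<^sub>F k in sequentially. (norm h)\<^sup>2 - norm T ^ k * (norm h)\<^sup>2 \<le> (\<Sum>\<^sub>\<infinity>\<alpha>. g \<alpha> h)"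
    proof (rule always_eventually, rule allI)
      fix k
      have "(norm h)\<^sup>2 - s k h \<le> (\<Sum>\<^sub>\<infinity>\<alpha>. g \<alpha> h)"
        by (rule has_sum_mono'[OF s(3) S]) (auto simp: g0)
      thus "(norm h)\<^sup>2 - norm T ^ k * (norm h)\<^sup>2 \<le> (\<Sum>\<^sub>\<infinity>\<alpha>. g \<alpha> h)" using s(2)[of k h] by simp
    qed
  qed simp
  ultimately show ?thesis using S by (simp add: g_def)
qed

context free_shift
begin

text \<open>
  \<open>K\<close> is determined by \<open>W\<^sub>\<alpha>\<^sup>* K = D Y\<^sub>\<alpha>\<^sup>*\<close> with \<open>Y = X/r\<close> and \<open>D\<close> the defect operator of \<open>Y\<close>; it is an isometry by
  \<open>defect_sum\<close>. The intertwining relation is the adjoint of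
  \<open>W\<^sub>\<alpha>\<^sup>* L\<^sub>i\<^sup>* K = W\<^bsub>i\<alpha>\<^esub>\<^sup>* K = D Y\<^sub>\<alpha>\<^sup>* Y\<^sub>i\<^sup>* = W\<^sub>\<alpha>\<^sup>* K Y\<^sub>i\<^sup>*\<close>.
\<close>
lemma poisson_kernel:
  fixes X :: "'n \<Rightarrow> 'h \<Rightarrow>\<^sub>L 'h"
  assumes X: "\<And>i. X i \<in> bop" and R: "row_sum X R" "norm R < r\<^sup>2" and r: "0 < r"
  obtains K where "K \<in> bop" "\<And>x. norm (blinfun_apply K x) = norm x"
    "\<And>i. X i o\<^sub>L adj K = adj K o\<^sub>L (r *\<^sub>R L i)"
proof -
  define Y where "Y i = (1 / r) *\<^sub>R X i" for i
  define T where "T = (1 / r)\<^sup>2 *\<^sub>R R"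
  have Y: "Y i \<in> bop" for i by (simp add: Y_def X)
  have T: "row_sum Y T" unfolding Y_def T_def by (rule row_sum_scaleR[OF X R(1)])
  have T1: "norm T < 1" using R(2) r by (simp add: T_def power_divide)
  obtain D where D: "D \<in> bop" "\<And>x y. cinner (blinfun_apply D x) y = cinner x (D y)"
    "\<And>x. D (D x) = x - T x"
    using sqrt_one_minus[OF row_sum_bop[OF Y T] row_sum_symmetric[OF Y T] T1] by blast
  have nD: "(norm (D x))\<^sup>2 = (norm x)\<^sup>2 - inner (T x) x" for x
  proof -
    have "(norm (D x))\<^sup>2 = inner x (D (D x))" by (simp add: power2_norm_eq_inner inner_eq_Re_cinner D(2))
    thus ?thesis by (simp add: D(3) inner_diff_right power2_norm_eq_inner inner_commute)
  qed
  let ?Z = "\<lambda>\<alpha> h. D (adj (word_op Y \<alpha>) h)"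
  have sum: "((\<lambda>\<alpha>. (norm (?Z \<alpha> h))\<^sup>2) has_sum (norm h)\<^sup>2) UNIV" for h
    by (rule defect_sum[OF Y T T1 nD])
  have "\<forall>h. \<exists>s. (norm s)\<^sup>2 = (norm h)\<^sup>2 \<and> (\<forall>\<alpha>. adj (W \<alpha>) s = ?Z \<alpha> h)"
  proof
    fix h
    obtain s where "((\<lambda>\<alpha>. (norm (?Z \<alpha> h))\<^sup>2) has_sum (norm s)\<^sup>2) UNIV" "\<And>\<alpha>. \<alpha> \<in> UNIV \<Longrightarrow> adj (W \<alpha>) s = ?Z \<alpha> h"
      by (rule orth_family_sum[OF W_orth has_sum_imp_summable[OF sum]]) blast
    thus "\<exists>s. (norm s)\<^sup>2 = (norm h)\<^sup>2 \<and> (\<forall>\<alpha>. adj (W \<alpha>) s = ?Z \<alpha> h)"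
      using has_sum_unique[OF _ sum] by blast
  qed
  from choice[OF this] obtain f where f: "\<And>h. (norm (f h))\<^sup>2 = (norm h)\<^sup>2" "\<And>h \<alpha>. adj (W \<alpha>) (f h) = ?Z \<alpha> h"
    by blast
  have nf: "norm (f h) = norm h" for h using f(1)[of h] by (simp add: power2_eq_iff_nonneg)
  obtain K where K: "K \<in> bop" "\<And>h. blinfun_apply K h = f h"
  proof (rule bop_of_fun[of f 1])
    show "f (x + y) = f x + f y" for x y by (rule W_ext) (simp add: f blinfun.add_right)
    show "f (c *\<^sub>C x) = c *\<^sub>C f x" for c x by (rule W_ext) (simp add: f bop_scaleC W_bop D Y)
  qed (simp_all add: nf)
  have "adj (L i) o\<^sub>L K = K o\<^sub>L adj (Y i)" for i
  proof (rule blinfun_eqI, rule W_ext)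
    fix h \<alpha>
    show "adj (W \<alpha>) ((adj (L i) o\<^sub>L K) h) = adj (W \<alpha>) ((K o\<^sub>L adj (Y i)) h)"
      by (simp add: adj_W_adj_L K f adj_compose Y)
  qed
  hence "adj (adj (L i) o\<^sub>L K) = adj (K o\<^sub>L adj (Y i))" for i by simp
  hence LK: "adj K o\<^sub>L L i = Y i o\<^sub>L adj K" for i
    by (simp add: adj_compose adj_adj L_bop K Y)
  show ?thesis
  proof (rule that[OF K(1)])
    show "X i o\<^sub>L adj K = adj K o\<^sub>L (r *\<^sub>R L i)" for i
      using r by (simp add: compose_scaleR LK) (simp add: Y_def compose_scaleR)
  qed (simp add: K nf)
qed

text \<open>
  Intertwining turns the Poisson kernel into \<open>T (K\<^sup>* \<otimes> I) = (K\<^sup>* \<otimes> I) T'\<close>; multiplying by \<open>K \<otimes> I\<close> from the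
  right exhibits \<open>T\<close> as the compression \<open>(K\<^sup>* \<otimes> I) T' (K \<otimes> I)\<close>.
\<close>
lemma von_neumann_inequality:
  fixes A :: "'n list \<Rightarrow> 'e::chilbert_space \<Rightarrow>\<^sub>L 'g::chilbert_space" and X :: "'n \<Rightarrow> 'h \<Rightarrow>\<^sub>L 'h"
  assumes X: "\<And>i. X i \<in> bop" and R: "row_sum X R" "norm R < r\<^sup>2" and r: "0 < r"
    and A: "\<And>\<alpha>. A \<alpha> \<in> bop" and T: "has_free_sum A X T" and T': "has_free_sum A (\<lambda>i. r *\<^sub>R L i) T'"
  shows "norm T \<le> norm T'"
proof -
  obtain K where K: "K \<in> bop" "\<And>x. norm (blinfun_apply K x) = norm x"
    "\<And>i. X i o\<^sub>L adj K = adj K o\<^sub>L (r *\<^sub>R L i)"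
    using poisson_kernel[OF X R r] by blast
  let ?K = "tensor_op K id_blinfun :: ('h, 'e) htensor \<Rightarrow>\<^sub>L ('h, 'e) htensor"
  let ?K' = "tensor_op (adj K) id_blinfun :: ('h, 'e) htensor \<Rightarrow>\<^sub>L ('h, 'e) htensor"
  let ?N = "tensor_op (adj K) id_blinfun :: ('h, 'g) htensor \<Rightarrow>\<^sub>L ('h, 'g) htensor"
  have "T o\<^sub>L ?K' = ?N o\<^sub>L T'"
    by (rule has_free_sum_intertwine[OF T' T A]) (simp_all add: X L_bop K)
  moreover have "adj K o\<^sub>L K = id_blinfun"
    by (rule blinfun_eqI) (simp add: adj_isometry K)
  hence "?K' o\<^sub>L ?K = id_blinfun" by (simp add: tensor_op_compose K)
  moreover have "(T o\<^sub>L ?K') o\<^sub>L ?K = T o\<^sub>L (?K' o\<^sub>L ?K)" by (rule blinfun_eqI) simp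
  ultimately have "T = ?N o\<^sub>L T' o\<^sub>L ?K" by simp
  moreover have "norm ?N \<le> 1" "norm ?K \<le> 1"
    using norm_isometry_le[OF K(1,2)] by (simp_all add: norm_tensor_op_id_le K)
  ultimately show ?thesis using norm_compress_le[of ?N ?K T'] by simp
qed

end

section \<open>Strict contractivity inside the ball\<close>

text \<open>Operators carry only a real scalar multiplication, so complex multiples are formed by composition.\<close>
lift_definition scalar_op :: "complex \<Rightarrow> 'a::complex_inner \<Rightarrow>\<^sub>L 'a" is "\<lambda>c x. c *\<^sub>C x"
  by (rule bounded_linear_scaleC)

lemma scalar_op_bop [simp]: "scalar_op c \<in> bop"
  by (simp add: bop_def scalar_op.rep_eq scaleC_scaleC mult.commute)

lemma word_op_scalar:
  fixes X :: "'n \<Rightarrow> 'h::complex_inner \<Rightarrow>\<^sub>L 'h"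
  assumes X: "\<And>i. X i \<in> bop"
  shows "word_op (\<lambda>i. scalar_op c o\<^sub>L X i) \<alpha> = scalar_op (c ^ length \<alpha>) o\<^sub>L word_op X \<alpha>"
proof (induction \<alpha>)
  case Nil
  show ?case by (rule blinfun_eqI) (simp add: scalar_op.rep_eq)
next
  case (Cons i \<alpha>)
  show ?case
    by (rule blinfun_eqI) (simp add: Cons scalar_op.rep_eq bop_scaleC X scaleC_scaleC)
qed

lemma tensor_op_scalar:
  fixes S :: "'a::chilbert_space \<Rightarrow>\<^sub>L 'c::chilbert_space" and T :: "'b::chilbert_space \<Rightarrow>\<^sub>L 'd::chilbert_space"
  assumes "S \<in> bop" "T \<in> bop"
  shows "tensor_op (scalar_op c o\<^sub>L S) T = scalar_op c o\<^sub>L tensor_op S T"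
  by (rule tensor_op_eqI) (simp_all add: assms tensor_op_tensor scalar_op.rep_eq tensor_scaleC_left)

lemma row_ball_scalar:
  fixes X :: "'n::countable \<Rightarrow> 'h::chilbert_space \<Rightarrow>\<^sub>L 'h"
  assumes X: "\<And>i. X i \<in> bop" and R: "row_sum X R" and c: "(cmod c)\<^sup>2 * norm R < 1"
  shows "(\<lambda>i. scalar_op c o\<^sub>L X i) \<in> row_ball"
proof -
  have a: "adj (scalar_op c o\<^sub>L X i) = adj (X i) o\<^sub>L scalar_op (cnj c)" for i
    by (rule adj_eqI)
      (simp add: scalar_op.rep_eq cinner_adj_right X bop_scaleC cinner_scaleC_left cinner_scaleC_right)
  have "row_sum (\<lambda>i. scalar_op c o\<^sub>L X i) ((cmod c)\<^sup>2 *\<^sub>R R)"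
    unfolding row_sum_def
  proof
    fix x
    have "((\<lambda>i. X i (adj (X i) x)) has_sum R x) UNIV" using R by (simp add: row_sum_def)
    from has_sum_scaleR[OF this, of "(cmod c)\<^sup>2"]
    show "((\<lambda>i. (scalar_op c o\<^sub>L X i) (adj (scalar_op c o\<^sub>L X i) x)) has_sum ((cmod c)\<^sup>2 *\<^sub>R R) x) UNIV"
      by (simp add: a scalar_op.rep_eq bop_scaleC X scaleC_scaleC blinfun.scaleR_left scaleR_scaleC
          complex_norm_square del: of_real_power)
  qed
  moreover have "norm ((cmod c)\<^sup>2 *\<^sub>R R) < 1" using c unfolding norm_scaleR by simp
  moreover have "\<forall>i. scalar_op c o\<^sub>L X i \<in> bop" by (simp add: X)
  ultimately show ?thesis unfolding row_ball_iff by blast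
qed

text \<open>The homogeneous part of degree \<open>k\<close> scales by \<open>c\<^sup>k\<close>, so \<open>z \<mapsto> G(zX)\<close> is a power series in \<open>z\<close>.\<close>
lemma has_free_sum_scalar:
  fixes A :: "'n::countable list \<Rightarrow> 'e::chilbert_space \<Rightarrow>\<^sub>L 'g::chilbert_space"
    and X :: "'n \<Rightarrow> 'h::chilbert_space \<Rightarrow>\<^sub>L 'h"
  assumes A: "\<And>\<alpha>. A \<alpha> \<in> bop" and X: "\<And>i. X i \<in> bop"
    and P: "\<And>k v. ((\<lambda>\<alpha>. tensor_op (word_op X \<alpha>) (A \<alpha>) v) has_sum blinfun_apply (P k) v) {\<alpha>. length \<alpha> = k}"
    and T: "has_free_sum A (\<lambda>i. scalar_op c o\<^sub>L X i) T"
  shows "(\<lambda>k. scalar_op (c ^ k) o\<^sub>L P k) sums T"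
proof -
  let ?X = "\<lambda>i. scalar_op c o\<^sub>L X i"
  obtain Q where Q: "\<And>k v. ((\<lambda>\<alpha>. tensor_op (word_op ?X \<alpha>) (A \<alpha>) v) has_sum blinfun_apply (Q k) v) {\<alpha>. length \<alpha> = k}"
    "Q sums T" using T unfolding has_free_sum_def by blast
  have "Q k = scalar_op (c ^ k) o\<^sub>L P k" for k
  proof (rule blinfun_eqI, rule has_sum_unique[OF Q(1)])
    fix v
    have "((\<lambda>\<alpha>. scalar_op (c ^ k) (tensor_op (word_op X \<alpha>) (A \<alpha>) v)) has_sum scalar_op (c ^ k) (P k v)) {\<alpha>. length \<alpha> = k}"
      by (rule has_sum_bounded_linear[OF blinfun.bounded_linear_right P])
    hence "((\<lambda>\<alpha>. scalar_op (c ^ k) (tensor_op (word_op X \<alpha>) (A \<alpha>) v)) has_sum (scalar_op (c ^ k) o\<^sub>L P k) v) {\<alpha>. length \<alpha> = k}"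
      by simp
    thus "((\<lambda>\<alpha>. tensor_op (word_op ?X \<alpha>) (A \<alpha>) v) has_sum (scalar_op (c ^ k) o\<^sub>L P k) v) {\<alpha>. length \<alpha> = k}"
      by (rule has_sum_cong[THEN iffD1, rotated]) (simp add: word_op_scalar X A tensor_op_scalar)
  qed
  hence "Q = (\<lambda>k. scalar_op (c ^ k) o\<^sub>L P k)" by (rule ext)
  thus ?thesis using Q(2) by simp
qed

text \<open>
  The Schwarz lemma is applied to \<open>g = (f - c) / (1 - cnj c f)\<close> with \<open>c = f 0\<close>. The identity
  \<open>|1 - cnj c u|\<^sup>2 - |u - c|\<^sup>2 = (1 - |c|\<^sup>2) (1 - |u|\<^sup>2)\<close> turns \<open>|g z| \<le> |z|\<close> into a bound on \<open>|f z|\<close>, and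
  \<open>|1 - cnj c f| \<ge> 1 - a\<close> makes it depend on \<open>f\<close> only through \<open>a\<close>.
\<close>
lemma schwarz_pick_bound:
  assumes f: "f holomorphic_on ball 0 1" and le: "\<And>z. cmod z < 1 \<Longrightarrow> cmod (f z) \<le> 1"
    and a: "cmod (f 0) \<le> a" "a < 1" and z: "cmod z < 1"
  shows "(1 - (cmod z)\<^sup>2) * (1 - a)\<^sup>2 \<le> 1 - (cmod (f z))\<^sup>2"
proof -
  \<comment> \<open>if the bound \<open>1\<close> were attained inside the disc, \<open>f\<close> would be constant, against \<open>|f 0| < 1\<close>\<close>
  have lt: "cmod (f w) < 1" if w: "cmod w < 1" for w
  proof (rule ccontr)
    assume "\<not> cmod (f w) < 1"
    hence "cmod (f u) \<le> cmod (f w)" if "u \<in> ball 0 1" for u using le[of u] that by simp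
    hence "f constant_on ball 0 1"
      using w by (intro maximum_modulus_principle[OF f, of "ball 0 1" w]) auto
    hence "f w = f 0" using w unfolding constant_on_def by force
    thus False using a \<open>\<not> cmod (f w) < 1\<close> by simp
  qed
  define c where "c = f 0"
  have "0 \<le> a" using a(1) norm_ge_zero[of "f 0"] by linarith
  hence nz: "1 - a \<le> cmod (1 - cnj c * f w)" if "cmod w < 1" for w
  proof -
    have "cmod (cnj c * f w) \<le> a * 1"
      unfolding norm_mult complex_mod_cnj using a(1) lt[OF that] \<open>0 \<le> a\<close> by (intro mult_mono) (auto simp: c_def)
    thus ?thesis using norm_triangle_ineq2[of 1 "cnj c * f w"] by simp
  qed
  have id: "(cmod (1 - cnj c * u))\<^sup>2 - (cmod (u - c))\<^sup>2 = (1 - (cmod c)\<^sup>2) * (1 - (cmod u)\<^sup>2)" for u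
    unfolding cmod_power2 by (simp add: power2_eq_square algebra_simps)
  define g where "g w = (f w - c) / (1 - cnj c * f w)" for w
  have d0: "1 - cnj c * f w \<noteq> 0" if "cmod w < 1" for w using nz[OF that] a(2) by auto
  have c1: "(cmod c)\<^sup>2 < 1" using a by (simp add: c_def abs_square_less_1)
  have "cmod (g z) \<le> cmod z"
  proof (rule Schwarz_Lemma(1)[of g, OF _ _ _ z])
    show "g holomorphic_on ball 0 1"
      unfolding g_def using d0 by (intro holomorphic_intros f) auto
    show "g 0 = 0" by (simp add: g_def c_def)
    fix w assume w: "cmod w < 1"
    have "0 < (1 - (cmod c)\<^sup>2) * (1 - (cmod (f w))\<^sup>2)"
      using c1 lt[OF w] by (intro mult_pos_pos) (simp_all add: abs_square_less_1)
    hence "(cmod (f w - c))\<^sup>2 < (cmod (1 - cnj c * f w))\<^sup>2" using id[of "f w"] by linarith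
    hence "cmod (f w - c) < cmod (1 - cnj c * f w)" by (simp add: power2_less_imp_less)
    thus "cmod (g w) < 1" using d0[OF w] by (simp add: g_def norm_divide)
  qed
  hence "cmod (f z - c) \<le> cmod z * cmod (1 - cnj c * f z)"
    using d0[OF z] by (simp add: g_def norm_divide divide_le_eq)
  hence "(cmod (f z - c))\<^sup>2 \<le> (cmod z)\<^sup>2 * (cmod (1 - cnj c * f z))\<^sup>2"
    using power_mono[of _ _ 2] by (metis norm_ge_zero power_mult_distrib)
  hence *: "(1 - (cmod z)\<^sup>2) * (cmod (1 - cnj c * f z))\<^sup>2 \<le> (1 - (cmod c)\<^sup>2) * (1 - (cmod (f z))\<^sup>2)"
    using id[of "f z"] by (simp add: algebra_simps)
  have "(1 - (cmod z)\<^sup>2) * (1 - a)\<^sup>2 \<le> (1 - (cmod z)\<^sup>2) * (cmod (1 - cnj c * f z))\<^sup>2"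
    using nz[OF z] a(2) z by (intro mult_left_mono power_mono) (auto simp: abs_square_le_1)
  also note *
  also have "(1 - (cmod c)\<^sup>2) * (1 - (cmod (f z))\<^sup>2) \<le> 1 * (1 - (cmod (f z))\<^sup>2)"
    using lt[OF z] by (intro mult_right_mono) (auto simp: abs_square_le_1)
  finally show ?thesis by simp
qed

lemma norm_blinfun_le_of_cinner:
  fixes T :: "'a::complex_inner \<Rightarrow>\<^sub>L 'b::complex_inner"
  assumes q: "0 \<le> q" and le: "\<And>v w. norm v \<le> 1 \<Longrightarrow> norm w \<le> 1 \<Longrightarrow> cmod (cinner (T v) w) \<le> q"
  shows "norm T \<le> q"
proof (rule norm_blinfun_bound[OF q])
  fix x
  show "norm (T x) \<le> q * norm x"
  proof (cases "T x = 0")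
    case False
    hence "x \<noteq> 0" by auto
    define v where "v = (1 / norm x) *\<^sub>R x"
    define w where "w = (1 / norm (T x)) *\<^sub>R T x"
    have "norm v \<le> 1" "norm w \<le> 1" by (simp_all add: v_def w_def)
    hence "cmod (cinner (T v) w) \<le> q" by (rule le)
    moreover have "cinner (T v) w = complex_of_real (norm (T x) / norm x)"
      using False by (simp add: v_def w_def blinfun.scaleR_right cinner.scaleR_left cinner.scaleR_right
          cinner_self scaleR_conv_of_real power2_eq_square)
    ultimately show ?thesis using \<open>x \<noteq> 0\<close> by (simp add: norm_divide divide_le_eq)
  qed (simp add: q)
qed

text \<open>
  The Schwarz--Pick bound for \<open>z \<mapsto> \<langle>G(\<rho>zX) v, w\<rangle>\<close> at \<open>z = 1/\<rho>\<close>, where \<open>\<rho> > 1\<close> is so close to \<open>1\<close> that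
  \<open>\<rho>X\<close> is still in the ball. The bound is uniform in \<open>v\<close> and \<open>w\<close>.
\<close>
lemma free_holomorphic_strict_contraction:
  fixes G :: "('n::countable \<Rightarrow> 'h::chilbert_space \<Rightarrow>\<^sub>L 'h) \<Rightarrow> ('h, 'e::chilbert_space) htensor \<Rightarrow>\<^sub>L ('h, 'y::chilbert_space) htensor"
  assumes G: "free_holomorphic G C" and le: "\<And>X. X \<in> row_ball \<Longrightarrow> norm (G X) \<le> 1"
    and G0: "norm (G (\<lambda>_. 0)) < 1" and X: "X \<in> row_ball"
  shows "norm (G X) < 1"
proof -
  have C: "C \<alpha> \<in> bop" for \<alpha> using G by (simp add: free_holomorphic_def)
  obtain R where R: "row_sum X R" "norm R < 1" and Xb: "\<And>i. X i \<in> bop"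
    using X by (auto simp: row_ball_iff)
  have "has_free_sum C X (G X)" using G X by (simp add: free_holomorphic_def)
  then obtain P where P: "\<And>k v. ((\<lambda>\<alpha>. tensor_op (word_op X \<alpha>) (C \<alpha>) v) has_sum blinfun_apply (P k) v) {\<alpha>. length \<alpha> = k}"
    unfolding has_free_sum_def by blast
  \<comment> \<open>chosen such that \<open>\<rho>\<^sup>2 > 1\<close> and \<open>\<rho>\<^sup>2 \<parallel>R\<parallel> < 1\<close>\<close>
  define \<rho> where "\<rho> = sqrt (2 / (1 + norm R))"
  have \<rho>2: "\<rho>\<^sup>2 = 2 / (1 + norm R)" by (simp add: \<rho>_def)
  have n: "0 < 1 + norm R" using norm_ge_zero[of R] by linarith
  hence "1 < \<rho>\<^sup>2" using R(2) by (simp add: \<rho>2 less_divide_eq)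
  hence \<rho>: "1 < \<rho>" using one_less_power[of \<rho> 2] by (simp add: \<rho>_def)
  define XX where "XX c = (\<lambda>i. scalar_op c o\<^sub>L X i)" for c
  have ball: "XX (complex_of_real \<rho> * z) \<in> row_ball" if "cmod z < 1" for z
    unfolding XX_def
  proof (rule row_ball_scalar[OF Xb R(1)])
    have "(cmod z)\<^sup>2 \<le> 1" using that by (simp add: abs_square_le_1)
    hence "(cmod z)\<^sup>2 * (\<rho>\<^sup>2 * norm R) \<le> 1 * (\<rho>\<^sup>2 * norm R)" by (intro mult_right_mono) auto
    also have "\<dots> < 1" using R(2) n by (simp add: \<rho>2 divide_less_eq)
    finally show "(cmod (complex_of_real \<rho> * z))\<^sup>2 * norm R < 1"
      by (simp add: norm_mult power_mult_distrib mult_ac)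
  qed
  define a where "a = norm (G (\<lambda>_. 0))"
  define \<delta> where "\<delta> = (1 - (1 / \<rho>)\<^sup>2) * (1 - a)\<^sup>2"
  have "\<delta> > 0" using \<rho> G0 by (simp add: \<delta>_def a_def power_divide)
  have X0: "XX 0 = (\<lambda>_. 0)" by (auto simp: XX_def scalar_op.rep_eq intro!: ext blinfun_eqI)
  have X1: "XX 1 = X" by (auto simp: XX_def scalar_op.rep_eq intro!: ext blinfun_eqI)
  have main: "(cmod (cinner (G X v) w))\<^sup>2 \<le> 1 - \<delta>" if v: "norm v \<le> 1" and w: "norm w \<le> 1" for v w
  proof -
    define \<phi> where "\<phi> z = cinner (G (XX (complex_of_real \<rho> * z)) v) w" for z
    have bd: "cmod (cinner (blinfun_apply T v) w) \<le> norm T" for T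
    proof -
      have "cmod (cinner (T v) w) \<le> norm (T v) * norm w" by (rule norm_cinner_le)
      also have "\<dots> \<le> (norm T * norm v) * norm w" by (intro mult_right_mono norm_blinfun) simp
      also have "\<dots> \<le> (norm T * 1) * 1" using v w by (intro mult_mono) auto
      finally show ?thesis by simp
    qed
    have "(\<lambda>k. (complex_of_real \<rho> ^ k * cinner (P k v) w) * (z - 0) ^ k) sums \<phi> z" if z: "z \<in> ball 0 1" for z
    proof -
      let ?c = "complex_of_real \<rho> * z"
      have "has_free_sum C (XX ?c) (G (XX ?c))"
        using G ball z by (simp add: free_holomorphic_def)
      hence "(\<lambda>k. scalar_op (?c ^ k) o\<^sub>L P k) sums G (XX ?c)"
        unfolding XX_def by (rule has_free_sum_scalar[OF C Xb P])
      moreover have "bounded_linear (\<lambda>T. cinner (blinfun_apply T v) w)"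
        by (rule bounded_linear_compose[OF cinner.bounded_linear_left blinfun.bounded_linear_left])
      ultimately have "(\<lambda>k. cinner ((scalar_op (?c ^ k) o\<^sub>L P k) v) w) sums \<phi> z"
        unfolding \<phi>_def by (rule bounded_linear.sums[rotated])
      thus ?thesis by (simp add: scalar_op.rep_eq cinner_scaleC_left power_mult_distrib mult_ac)
    qed
    hence "\<phi> holomorphic_on ball 0 1" by (rule power_series_holomorphic)
    moreover have "cmod (\<phi> z) \<le> 1" if "cmod z < 1" for z
      unfolding \<phi>_def using bd le[OF ball[OF that]] by (rule order_trans)
    moreover have "cmod (\<phi> 0) \<le> a" using bd by (simp add: \<phi>_def X0 a_def)
    moreover have "cmod (complex_of_real (1 / \<rho>)) < 1" using \<rho> by (simp add: norm_divide)
    ultimately have "(1 - (cmod (complex_of_real (1 / \<rho>)))\<^sup>2) * (1 - a)\<^sup>2 \<le> 1 - (cmod (\<phi> (complex_of_real (1 / \<rho>))))\<^sup>2"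
      using G0 unfolding a_def by (intro schwarz_pick_bound) auto
    moreover have "\<phi> (complex_of_real (1 / \<rho>)) = cinner (G X v) w"
      using \<rho> by (simp add: \<phi>_def X1)
    ultimately show ?thesis by (simp add: \<delta>_def norm_divide power_divide)
  qed
  have "norm (G X) \<le> sqrt (1 - \<delta>)"
  proof (rule norm_blinfun_le_of_cinner)
    have "0 \<le> 1 - \<delta>" using main[of 0 0] by (simp add: cinner.zero_left)
    thus "0 \<le> sqrt (1 - \<delta>)" by simp
    show "cmod (cinner (G X v) w) \<le> sqrt (1 - \<delta>)" if "norm v \<le> 1" "norm w \<le> 1" for v w
      using main[OF that] by (simp add: real_le_rsqrt)
  qed
  also have "\<dots> < sqrt 1" using \<open>\<delta> > 0\<close> by (intro real_sqrt_less_mono) simp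
  finally show ?thesis by simp
qed

section \<open>The factorization theorem\<close>

lemma op_less_bounded_below:
  fixes S T :: "'a::chilbert_space \<Rightarrow>\<^sub>L 'a"
  assumes "S \<in> bop" "T \<in> bop" and sym: "\<And>x y. cinner ((T - S) x) y = cinner x ((T - S) y)"
  shows "op_less S T \<longleftrightarrow> (\<exists>\<gamma>>0. \<forall>x. \<gamma> * (norm x)\<^sup>2 \<le> inner ((T - S) x) x)"
proof
  have isym: "inner ((T - S) x) y = inner x ((T - S) y)" for x y
    using sym by (simp add: inner_eq_Re_cinner)
  assume "op_less S T"
  hence "0 \<le> inner ((T - S) x) x" "invertible_op (T - S)" for x
    by (auto simp: op_less_def positive_op_def inner_eq_Re_cinner)
  thus "\<exists>\<gamma>>0. \<forall>x. \<gamma> * (norm x)\<^sup>2 \<le> inner ((T - S) x) x"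
    using invertible_op_imp_bounded_below[of "T - S", OF isym] by blast
next
  assume "\<exists>\<gamma>>0. \<forall>x. \<gamma> * (norm x)\<^sup>2 \<le> inner ((T - S) x) x"
  then obtain \<gamma> where \<gamma>: "\<gamma> > 0" "\<And>x. \<gamma> * (norm x)\<^sup>2 \<le> inner ((T - S) x) x" by blast
  have "invertible_op (T - S)" by (rule bounded_below_imp_invertible_op[OF _ \<gamma>]) (simp add: assms)
  moreover have "cinner ((T - S) x) x \<in> \<real>" for x
    unfolding Reals_cnj_iff by (metis sym cinner_commute)
  moreover have "0 \<le> Re (cinner ((T - S) x) x)" for x
    using order_trans[OF _ \<gamma>(2)[of x]] \<gamma>(1) unfolding inner_eq_Re_cinner by simp
  ultimately show "op_less S T" by (simp add: op_less_def positive_op_def assms)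
qed

lemma cinner_gram:
  fixes T :: "'a::chilbert_space \<Rightarrow>\<^sub>L 'b::chilbert_space"
  assumes "T \<in> bop"
  shows "cinner ((T o\<^sub>L adj T) x) y = cinner (adj T x) (adj T y)"
  by (simp add: assms cinner_adj_right)

lemma sup_norm_le_iff: "sup_norm F \<le> ereal c \<longleftrightarrow> (\<forall>X\<in>row_ball. norm (F X) \<le> c)"
  by (simp add: sup_norm_def SUP_le_iff)

text \<open>A left factor that is bounded below by \<open>m\<close> can be cancelled at the cost of \<open>1/m\<close>.\<close>
lemma norm_factor_le:
  fixes S :: "'b::real_normed_vector \<Rightarrow>\<^sub>L 'c::real_normed_vector" and T :: "'a::real_normed_vector \<Rightarrow>\<^sub>L 'b"
  assumes "norm (S o\<^sub>L T) \<le> 1" and m: "0 < m"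
    and low: "\<And>x. norm x = 1 \<Longrightarrow> m \<le> norm (blinfun_apply S x)"
  shows "norm T \<le> 1 / m"
proof (rule norm_blinfun_bound)
  fix x
  have "m * norm (T x) \<le> norm (S (T x))"
  proof (cases "T x = 0")
    case False
    hence "m \<le> norm (S ((1 / norm (T x)) *\<^sub>R T x))" by (intro low) simp
    thus ?thesis using False by (simp add: blinfun.scaleR_right le_divide_eq)
  qed simp
  also have "\<dots> = norm ((S o\<^sub>L T) x)" by simp
  also have "\<dots> \<le> norm (S o\<^sub>L T) * norm x" by (rule norm_blinfun)
  also have "\<dots> \<le> 1 * norm x" using assms(1) by (intro mult_right_mono) auto
  finally show "norm (T x) \<le> 1 / m * norm x" using m by (simp add: field_simps)
qed (use m in simp)

text \<open>
  On the Fock space the factor \<open>\<Theta>(rS)\<close> can be cancelled at the cost of \<open>1/m\<close> for any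
  \<open>m\<close> below its infimum on unit vectors; \<open>\<parallel>G(X)\<parallel> \<le> \<parallel>G(rL)\<parallel> \<le> \<parallel>G(rS)\<parallel>\<close> carries the result back to \<open>X\<close>.
\<close>
lemma factor_contractive:
  fixes F :: "('n::countable \<Rightarrow> 'h::chilbert_space \<Rightarrow>\<^sub>L 'h) \<Rightarrow> ('h, 'e::chilbert_space) htensor \<Rightarrow>\<^sub>L ('h, 'g::chilbert_space) htensor"
    and \<Theta> :: "('n \<Rightarrow> 'h \<Rightarrow>\<^sub>L 'h) \<Rightarrow> ('h, 'y::chilbert_space) htensor \<Rightarrow>\<^sub>L ('h, 'g) htensor"
    and G :: "('n \<Rightarrow> 'h \<Rightarrow>\<^sub>L 'h) \<Rightarrow> ('h, 'e) htensor \<Rightarrow>\<^sub>L ('h, 'y) htensor"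
  assumes sep: "separable_space (euclidean :: 'h topology)" and inf: "infinite_dimensional TYPE('h)"
    and F: "free_holomorphic F A" and \<Theta>: "free_holomorphic \<Theta> B" and G: "free_holomorphic G C"
    and factor: "\<And>X. X \<in> row_ball \<Longrightarrow> F X = \<Theta> X o\<^sub>L G X"
    and F1: "\<And>X. X \<in> row_ball \<Longrightarrow> norm (F X) \<le> 1"
    and rip: "radial_infimum_property \<Theta> B" and \<Theta>1: "sup_norm \<Theta> = 1"
    and X: "X \<in> row_ball"
  shows "norm (G X) \<le> 1"
proof -
  obtain W :: "'n list \<Rightarrow> 'h \<Rightarrow>\<^sub>L 'h" and L where "free_shift W L"
    using free_shift_exists[OF sep inf] .
  then interpret free_shift W L .
  obtain b :: 'h where b: "b \<in> some_onb"
    using infinite_imp_nonempty[OF infinite_some_onb[OF inf]] by blast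
  have bop: "A \<alpha> \<in> bop" "B \<alpha> \<in> bop" "C \<alpha> \<in> bop" for \<alpha>
    using F \<Theta> G by (auto simp: free_holomorphic_def)
  let ?L = "\<lambda>r i. r *\<^sub>R L i"
  let ?S = "\<lambda>r i. r *\<^sub>R creation i :: 'n fock \<Rightarrow>\<^sub>L 'n fock"
  let ?\<mu> = "\<lambda>r. INF x\<in>{x. norm x = 1}. ereal (norm (free_eval B (?S r) x))"
  have shift_bound: "norm (G (?L r)) \<le> 1 / m"
    if r: "0 < r" "r < 1" and m: "0 < m" "ereal m < ?\<mu> r" for r m
  proof -
    have ball: "?L r \<in> row_ball" using r by (intro scaled_shift_row_ball) auto
    have sums: "has_free_sum A (?L r) (F (?L r))" "has_free_sum B (?L r) (\<Theta> (?L r))" "has_free_sum C (?L r) (G (?L r))"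
      using F \<Theta> G ball by (auto simp: free_holomorphic_def)
    \<comment> \<open>the factorization at \<open>rL\<close>, compressed to one copy of the Fock space; only \<open>G\<close> has to
      leave that copy invariant\<close>
    note fock = free_eval_fock[OF b bop(1) sums(1)] free_eval_fock[OF b bop(2) sums(2)]
      free_eval_fock[OF b bop(3) sums(3)]
    let ?J = "fock_embedding b"
    have ev: "free_eval A (?S r) = tensor_op (adj ?J) id_blinfun o\<^sub>L F (?L r) o\<^sub>L tensor_op ?J id_blinfun"
      "free_eval B (?S r) = tensor_op (adj ?J) id_blinfun o\<^sub>L \<Theta> (?L r) o\<^sub>L tensor_op ?J id_blinfun"
      by (rule free_eval_eq[OF fock(1)], rule free_eval_eq[OF fock(2)])
    have evG: "has_free_sum C (?S r) (free_eval C (?S r))"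
      using fock(3) free_eval_eq[OF fock(3)] by simp
    have "G (?L r) o\<^sub>L tensor_op ?J id_blinfun = tensor_op ?J id_blinfun o\<^sub>L free_eval C (?S r)"
      by (rule has_free_sum_intertwine[OF evG sums(3) bop(3)])
        (simp_all add: L_bop fock_embedding_bop b compose_scaleR L_fock_embedding)
    hence "(G (?L r) o\<^sub>L tensor_op ?J id_blinfun) v = (tensor_op ?J id_blinfun o\<^sub>L free_eval C (?S r)) v" for v
      by (rule arg_cong)
    hence fac: "free_eval A (?S r) = free_eval B (?S r) o\<^sub>L free_eval C (?S r)"
      by (intro blinfun_eqI) (simp add: ev factor[OF ball])
    have iso: "norm (?J x) = norm x" for x
      by (rule orth_family_norm[OF complete_orth_family[OF complete_family_fock_embedding] b])
    have "norm (free_eval A (?S r)) \<le> norm (F (?L r))"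
      unfolding ev using norm_isometry_le[OF fock_embedding_bop[OF b] iso]
      by (intro norm_compress_le norm_tensor_op_id_le) (simp_all add: fock_embedding_bop b)
    hence "norm (free_eval B (?S r) o\<^sub>L free_eval C (?S r)) \<le> 1" using F1[OF ball] fac by simp
    hence "norm (free_eval C (?S r)) \<le> 1 / m"
    proof (rule norm_factor_le[OF _ m(1)])
      fix x :: "('n fock, 'y) htensor" assume "norm x = 1"
      hence "?\<mu> r \<le> ereal (norm (free_eval B (?S r) x))" by (intro INF_lower) simp
      with m(2) have "ereal m < ereal (norm (free_eval B (?S r) x))" by (rule less_le_trans)
      thus "m \<le> norm (free_eval B (?S r) x)" by simp
    qed
    moreover have "norm (G (?L r)) \<le> norm (free_eval C (?S r))"
      by (rule norm_shift_le_fock[OF bop(3) sums(3) evG])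
    ultimately show ?thesis by linarith
  qed
  obtain R where R: "row_sum X R" "norm R < 1" and Xb: "\<And>i. X i \<in> bop"
    using X by (auto simp: row_ball_iff)
  have "m * norm (G X) \<le> 1" if m: "0 < m" "m < 1" for m
  proof -
    have "1 \<le> Liminf (at_left 1) ?\<mu>"
      using rip \<Theta>1 by (simp add: radial_infimum_property_def)
    hence e1: "\<forall>\<^sub>F r in at_left 1. ereal m < ?\<mu> r"
      unfolding le_Liminf_iff using m by simp
    have "((\<lambda>r :: real. r\<^sup>2) \<longlongrightarrow> 1\<^sup>2) (at_left 1)" by (intro tendsto_intros)
    hence e2: "\<forall>\<^sub>F r in at_left (1 :: real). norm R < r\<^sup>2" using R(2) by (intro order_tendstoD(1)) auto
    have e3: "\<forall>\<^sub>F r in at_left (1 :: real). r \<in> {0<..<1}" by (rule eventually_at_left_real) simp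
    have "\<forall>\<^sub>F r in at_left 1. ereal m < ?\<mu> r \<and> norm R < r\<^sup>2 \<and> r \<in> {0<..<1}"
      using e1 e2 e3 by (intro eventually_conj)
    then obtain r where r: "ereal m < ?\<mu> r" "norm R < r\<^sup>2" "r \<in> {0<..<1}"
      using eventually_happens'[OF trivial_limit_at_left_real] by blast
    have "?L r \<in> row_ball" using r by (intro scaled_shift_row_ball) auto
    hence "norm (G X) \<le> norm (G (?L r))"
      using r G X by (intro von_neumann_inequality[OF Xb R(1) r(2) _ bop(3)]) (auto simp: free_holomorphic_def)
    also have "\<dots> \<le> 1 / m" using r m by (intro shift_bound) auto
    finally show ?thesis using m by (simp add: field_simps)
  qed
  thus ?thesis by (rule field_le_mult_one_interval)
qed

theorem theorem4p1:
  fixes F :: "('n::countable \<Rightarrow> 'h::chilbert_space \<Rightarrow>\<^sub>L 'h) \<Rightarrow> ('h, 'e::chilbert_space) htensor \<Rightarrow>\<^sub>L ('h, 'g::chilbert_space) htensor"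
    and \<Theta> :: "('n \<Rightarrow> 'h \<Rightarrow>\<^sub>L 'h) \<Rightarrow> ('h, 'y::chilbert_space) htensor \<Rightarrow>\<^sub>L ('h, 'g) htensor"
    and G :: "('n \<Rightarrow> 'h \<Rightarrow>\<^sub>L 'h) \<Rightarrow> ('h, 'e) htensor \<Rightarrow>\<^sub>L ('h, 'y) htensor"
    and A :: "'n list \<Rightarrow> 'e \<Rightarrow>\<^sub>L 'g" and B :: "'n list \<Rightarrow> 'y \<Rightarrow>\<^sub>L 'g" and C :: "'n list \<Rightarrow> 'e \<Rightarrow>\<^sub>L 'y"
  assumes "separable_space (euclidean :: 'h topology)" and "infinite_dimensional TYPE('h)"
    and "free_holomorphic F A" and "free_holomorphic \<Theta> B" and "free_holomorphic G C"
    and "\<forall>X\<in>row_ball. F X = \<Theta> X o\<^sub>L G X"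
    and "sup_norm F \<le> 1"
    and "radial_infimum_property \<Theta> B" and "sup_norm \<Theta> = 1"
  shows "sup_norm G \<le> 1
    \<and> (\<forall>X\<in>row_ball. op_le (F X o\<^sub>L adj (F X)) (\<Theta> X o\<^sub>L adj (\<Theta> X)))
    \<and> (\<forall>X\<in>row_ball. norm (F X) \<le> norm (\<Theta> X))
    \<and> (norm (G (\<lambda>_. 0)) < 1 \<longrightarrow> (\<forall>X\<^sub>0\<in>row_ball.
        (op_less (F X\<^sub>0 o\<^sub>L adj (F X\<^sub>0)) (\<Theta> X\<^sub>0 o\<^sub>L adj (\<Theta> X\<^sub>0))
          \<longleftrightarrow> op_less 0 (\<Theta> X\<^sub>0 o\<^sub>L adj (\<Theta> X\<^sub>0)))
        \<and> (norm (F X\<^sub>0) < norm (\<Theta> X\<^sub>0) \<longleftrightarrow> \<Theta> X\<^sub>0 \<noteq> 0)))"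
proof -
  have fac: "F X = \<Theta> X o\<^sub>L G X" if "X \<in> row_ball" for X using assms(6) that by blast
  have F1: "norm (F X) \<le> 1" if "X \<in> row_ball" for X
    using assms(7) that sup_norm_le_iff[of F 1] by (simp add: one_ereal_def)
  have G1: "norm (G X) \<le> 1" if "X \<in> row_ball" for X
    by (rule factor_contractive[OF assms(1-5) fac F1 assms(8,9) that])
  have bop: "F X \<in> bop" "\<Theta> X \<in> bop" "G X \<in> bop" if X: "X \<in> row_ball" for X
    using assms(3-5) X has_free_sum_bop[of A X "F X"] has_free_sum_bop[of B X "\<Theta> X"] has_free_sum_bop[of C X "G X"]
    by (auto simp: free_holomorphic_def row_ball_iff)
  define D where "D X = (\<Theta> X o\<^sub>L adj (\<Theta> X)) - (F X o\<^sub>L adj (F X))" for X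
  have Dc: "cinner (D X x) y = cinner (adj (\<Theta> X) x) (adj (\<Theta> X) y) - cinner (adj (F X) x) (adj (F X) y)"
    if "X \<in> row_ball" for X x y
    using bop[OF that] by (simp add: D_def blinfun.diff_left cinner.diff_left cinner_adj_right)
  have Dsym: "cinner (D X x) y = cinner x (D X y)" if X: "X \<in> row_ball" for X x y
    unfolding Dc[OF X] by (subst (3) cinner_commute) (simp add: Dc[OF X] cinner_commute[symmetric])
  have Dq: "cinner (D X x) x = complex_of_real ((norm (adj (\<Theta> X) x))\<^sup>2 - (norm (adj (F X) x))\<^sup>2)"
    if "X \<in> row_ball" for X x
    unfolding Dc[OF that] by (simp add: cinner_self)
  have adjF: "(norm (adj (F X) x))\<^sup>2 \<le> (norm (G X))\<^sup>2 * (norm (adj (\<Theta> X) x))\<^sup>2" if X: "X \<in> row_ball" for X x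
  proof -
    have "adj (F X) x = adj (G X) (adj (\<Theta> X) x)" using bop[OF X] by (simp add: fac[OF X] adj_compose)
    hence "norm (adj (F X) x) \<le> norm (adj (G X)) * norm (adj (\<Theta> X) x)" by (simp add: norm_blinfun)
    also have "\<dots> \<le> norm (G X) * norm (adj (\<Theta> X) x)"
      by (intro mult_right_mono norm_adj_le bop X) simp
    finally have "norm (adj (F X) x) \<le> norm (G X) * norm (adj (\<Theta> X) x)" .
    from power_mono[OF this, of 2] show ?thesis by (simp add: power_mult_distrib)
  qed
  have FG: "norm (F X) \<le> norm (\<Theta> X) * norm (G X)" if X: "X \<in> row_ball" for X
    unfolding fac[OF X] by (rule norm_blinfun_compose)
  have le: "op_le (F X o\<^sub>L adj (F X)) (\<Theta> X o\<^sub>L adj (\<Theta> X))" if X: "X \<in> row_ball" for X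
  proof -
    have "(norm (G X))\<^sup>2 * (norm (adj (\<Theta> X) x))\<^sup>2 \<le> 1 * (norm (adj (\<Theta> X) x))\<^sup>2" for x
      using G1[OF X] by (intro mult_right_mono) (auto simp: abs_square_le_1)
    hence "(norm (adj (F X) x))\<^sup>2 \<le> (norm (adj (\<Theta> X) x))\<^sup>2" for x
      using adjF[OF X, of x] order_trans by fastforce
    moreover have "D X \<in> bop" using bop[OF X] by (simp add: D_def)
    ultimately show ?thesis
      unfolding op_le_def positive_op_def D_def[symmetric] Dq[OF X] by (simp del: of_real_diff)
  qed
  have strict: "(op_less (F X o\<^sub>L adj (F X)) (\<Theta> X o\<^sub>L adj (\<Theta> X)) \<longleftrightarrow> op_less 0 (\<Theta> X o\<^sub>L adj (\<Theta> X)))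
      \<and> (norm (F X) < norm (\<Theta> X) \<longleftrightarrow> \<Theta> X \<noteq> 0)"
    if G0: "norm (G (\<lambda>_. 0)) < 1" and X: "X \<in> row_ball" for X
  proof
    have lt: "norm (G X) < 1"
      by (rule free_holomorphic_strict_contraction[OF assms(5) G1 G0 X])
    let ?q = "1 - (norm (G X))\<^sup>2"
    have q: "0 < ?q" using lt by (simp add: abs_square_less_1)
    have "op_less (F X o\<^sub>L adj (F X)) (\<Theta> X o\<^sub>L adj (\<Theta> X)) \<longleftrightarrow>
        (\<exists>\<gamma>>0. \<forall>x. \<gamma> * (norm x)\<^sup>2 \<le> (norm (adj (\<Theta> X) x))\<^sup>2 - (norm (adj (F X) x))\<^sup>2)"
    proof (subst op_less_bounded_below)
      have "inner (D X x) x = (norm (adj (\<Theta> X) x))\<^sup>2 - (norm (adj (F X) x))\<^sup>2" for x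
        unfolding inner_eq_Re_cinner Dq[OF X] by simp
      thus "(\<exists>\<gamma>>0. \<forall>x. \<gamma> * (norm x)\<^sup>2 \<le> inner (((\<Theta> X o\<^sub>L adj (\<Theta> X)) - (F X o\<^sub>L adj (F X))) x) x) \<longleftrightarrow>
          (\<exists>\<gamma>>0. \<forall>x. \<gamma> * (norm x)\<^sup>2 \<le> (norm (adj (\<Theta> X) x))\<^sup>2 - (norm (adj (F X) x))\<^sup>2)"
        by (simp add: D_def)
    qed (use bop[OF X] Dsym[OF X] in \<open>simp_all add: D_def\<close>)
    also have "\<dots> \<longleftrightarrow> (\<exists>\<gamma>>0. \<forall>x. \<gamma> * (norm x)\<^sup>2 \<le> (norm (adj (\<Theta> X) x))\<^sup>2)"
    proof
      assume "\<exists>\<gamma>>0. \<forall>x. \<gamma> * (norm x)\<^sup>2 \<le> (norm (adj (\<Theta> X) x))\<^sup>2 - (norm (adj (F X) x))\<^sup>2"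
      then obtain \<gamma> where \<gamma>: "\<gamma> > 0" "\<And>x. \<gamma> * (norm x)\<^sup>2 \<le> (norm (adj (\<Theta> X) x))\<^sup>2 - (norm (adj (F X) x))\<^sup>2" by blast
      have "\<gamma> * (norm x)\<^sup>2 \<le> (norm (adj (\<Theta> X) x))\<^sup>2" for x
        using \<gamma>(2)[of x] zero_le_power2[of "norm (adj (F X) x)"] by linarith
      thus "\<exists>\<gamma>>0. \<forall>x. \<gamma> * (norm x)\<^sup>2 \<le> (norm (adj (\<Theta> X) x))\<^sup>2" using \<gamma>(1) by blast
    next
      assume "\<exists>\<gamma>>0. \<forall>x. \<gamma> * (norm x)\<^sup>2 \<le> (norm (adj (\<Theta> X) x))\<^sup>2"
      then obtain \<gamma> where \<gamma>: "\<gamma> > 0" "\<And>x. \<gamma> * (norm x)\<^sup>2 \<le> (norm (adj (\<Theta> X) x))\<^sup>2" by blast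
      have "?q * \<gamma> * (norm x)\<^sup>2 \<le> (norm (adj (\<Theta> X) x))\<^sup>2 - (norm (adj (F X) x))\<^sup>2" for x
      proof -
        have "?q * (\<gamma> * (norm x)\<^sup>2) \<le> ?q * (norm (adj (\<Theta> X) x))\<^sup>2"
          using q by (intro mult_left_mono \<gamma>) simp
        thus ?thesis using adjF[OF X, of x] by (simp add: algebra_simps)
      qed
      thus "\<exists>\<gamma>>0. \<forall>x. \<gamma> * (norm x)\<^sup>2 \<le> (norm (adj (\<Theta> X) x))\<^sup>2 - (norm (adj (F X) x))\<^sup>2"
        using q \<gamma>(1) by (intro exI[of _ "?q * \<gamma>"]) simp
    qed
    also have "\<dots> \<longleftrightarrow> op_less 0 (\<Theta> X o\<^sub>L adj (\<Theta> X))"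
    proof (subst op_less_bounded_below)
      show "(0 :: ('h, 'g) htensor \<Rightarrow>\<^sub>L ('h, 'g) htensor) \<in> bop" by (simp add: bop_def)
      show "cinner (((\<Theta> X o\<^sub>L adj (\<Theta> X)) - 0) x) y = cinner x (((\<Theta> X o\<^sub>L adj (\<Theta> X)) - 0) y)" for x y
        by (simp flip: cinner_adj_left[OF bop(2)[OF X]] cinner_adj_right[OF bop(2)[OF X]])
      have "inner ((\<Theta> X o\<^sub>L adj (\<Theta> X)) x) x = (norm (adj (\<Theta> X) x))\<^sup>2" for x
        unfolding inner_eq_Re_cinner cinner_gram[OF bop(2)[OF X]] by (simp add: cinner_self)
      thus "(\<exists>\<gamma>>0. \<forall>x. \<gamma> * (norm x)\<^sup>2 \<le> (norm (adj (\<Theta> X) x))\<^sup>2) \<longleftrightarrow>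
          (\<exists>\<gamma>>0. \<forall>x. \<gamma> * (norm x)\<^sup>2 \<le> inner (((\<Theta> X o\<^sub>L adj (\<Theta> X)) - 0) x) x)"
        by simp
    qed (use bop[OF X] in simp)
    finally show "op_less (F X o\<^sub>L adj (F X)) (\<Theta> X o\<^sub>L adj (\<Theta> X)) \<longleftrightarrow> op_less 0 (\<Theta> X o\<^sub>L adj (\<Theta> X))" .
    show "norm (F X) < norm (\<Theta> X) \<longleftrightarrow> \<Theta> X \<noteq> 0"
    proof
      assume "\<Theta> X \<noteq> 0"
      hence "norm (\<Theta> X) * norm (G X) < norm (\<Theta> X) * 1" using lt by (intro mult_strict_left_mono) auto
      thus "norm (F X) < norm (\<Theta> X)" using FG[OF X] by simp
    qed auto
  qed
  have "norm (F X) \<le> norm (\<Theta> X)" if X: "X \<in> row_ball" for X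
    using FG[OF X] mult_left_mono[OF G1[OF X] norm_ge_zero[of "\<Theta> X"]] by simp
  moreover have "sup_norm G \<le> 1" using sup_norm_le_iff[of G 1] G1 by (simp add: one_ereal_def)
  ultimately show ?thesis using le strict by blast
qed

end
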